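(* There is a function $\beta:(0,1)\to(0,\infty)$ with $\beta(\lambda)\to 0$ as $\lambda\to0^+$, and for every constant $\lambda_0\in(0,1)$ there is a constant $C=C(\lambda_0)$, such that the following holds. Let $S$ be a finite set. For every $\lambda\in(0,1)$ there is a deterministic polynomial time algorithm (polynomial in $|S|$ and $1/\lambda$) that constructs, for some positive integer $t$, a collection $W\subseteq S^t$ of size $|W|\le C\,|S|/\lambda^{2+\beta(\lambda)}$ such that for every positive integer $\ell$ and every function $f:S\to M_\ell(\mathbb{C})$ with $\left\|\mathbb{E}_{s\sim S}[f(s)]\right\|_{\mathrm{op}}\le\lambda_0$ and $\max_{s\in S}\|f(s)\|_{\mathrm{op}}\le1$, we have $$\left\|\mathbb{E}_{w\sim W}[f(w)]\right\|_{\mathrm{op}}\le\lambda .$$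
   Context: $M_\ell(\mathbb{C})$ is the space of $\ell\times\ell$ complex matrices, $\|\cdot\|_{\mathrm{op}}$ the operator norm. For $w=(s_1,\dots,s_t)\in S^t$, $f(w):=f(s_t)\cdots f(s_1)$. Expectations are uniform; $W$ is a collection of tuples, possibly counted with multiplicity. *)

theory Defs
  imports "HOL-Analysis.L2_Norm" "HOL-Library.Multiset" "Jordan_Normal_Form.Matrix"
begin

section \<open>Matrices\<close>

definition vec_norm2 :: "complex vec \<Rightarrow> real" where
  "vec_norm2 v = L2_set (\<lambda>i. cmod (v $ i)) {..<dim_vec v}"

definition op_norm :: "complex mat \<Rightarrow> real" where
  "op_norm A = (SUP v \<in> {v \<in> carrier_vec (dim_col A). vec_norm2 v \<le> 1}. vec_norm2 (A *\<^sub>v v))"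

text \<open>The uniform average over a nonempty finite multiset \<open>X\<close> of the \<open>l \<times> l\<close> matrices \<open>g x\<close>.
  It is the zero matrix if \<open>X\<close> is empty, so nonemptiness has to be required where it is used.\<close>

definition mat_expectation :: "nat \<Rightarrow> 'b multiset \<Rightarrow> ('b \<Rightarrow> complex mat) \<Rightarrow> complex mat" where
  "mat_expectation l X g = mat l l (\<lambda>(i, j). (\<Sum>x\<in>#X. g x $$ (i, j)) / of_nat (size X))"

text \<open>For \<open>w = [s\<^sub>1, \<dots>, s\<^sub>t]\<close> this is \<open>f s\<^sub>t * \<dots> * f s\<^sub>1\<close>: the first letter is the rightmost factor.\<close>

definition word_mat :: "nat \<Rightarrow> ('b \<Rightarrow> complex mat) \<Rightarrow> 'b list \<Rightarrow> complex mat" where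
  "word_mat l f w = foldl (\<lambda>M s. f s * M) (1\<^sub>m l) w"


section \<open>Deterministic algorithms\<close>

text \<open>
  Algorithms are programs of a random access machine with successively written output, in
  structured form. The memory is a map from addresses to natural numbers, \<open>Cell\<close> and \<open>Store\<close>
  may use computed addresses, and every elementary command and every test costs one unit. The only
  arithmetic is addition and truncated subtraction, so within one step the bit length of the
  largest number in memory grows by at most a constant depending on the program; for this
  instruction set (without multiplication) the unit cost measure is polynomially equivalent to
  Turing machine time.
\<close>

datatype aexp =
    Const nat
  | Cell aexp
  | Plus aexp aexp
  | Minus aexp aexp

fun aval :: "(nat \<Rightarrow> nat) \<Rightarrow> aexp \<Rightarrow> nat" where
  "aval m (Const n) = n"
| "aval m (Cell a) = m (aval m a)"
| "aval m (Plus a b) = aval m a + aval m b"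
| "aval m (Minus a b) = aval m a - aval m b"

datatype com =
    Skip
  | Store aexp aexp
  | Emit aexp
  | Seq com com
  | If aexp com com
  | While aexp com

text \<open>\<open>exec p s T s'\<close>: program \<open>p\<close> started in \<open>s\<close> halts in \<open>s'\<close> after exactly \<open>T\<close> steps. A state is
  the memory together with the output written so far. Tests succeed on nonzero values.\<close>

type_synonym state = "(nat \<Rightarrow> nat) \<times> nat list"

inductive exec :: "com \<Rightarrow> state \<Rightarrow> nat \<Rightarrow> state \<Rightarrow> bool" where
  Skip: "exec Skip s 1 s"
| Store: "exec (Store a b) (m, out) 1 (m(aval m a := aval m b), out)"
| Emit: "exec (Emit a) (m, out) 1 (m, out @ [aval m a])"
| Seq: "exec p s T s' \<Longrightarrow> exec q s' U s'' \<Longrightarrow> exec (Seq p q) s (T + U) s''"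
| IfTrue: "aval (fst s) a \<noteq> 0 \<Longrightarrow> exec p s T s' \<Longrightarrow> exec (If a p q) s (Suc T) s'"
| IfFalse: "aval (fst s) a = 0 \<Longrightarrow> exec q s T s' \<Longrightarrow> exec (If a p q) s (Suc T) s'"
| WhileFalse: "aval (fst s) a = 0 \<Longrightarrow> exec (While a p) s 1 s"
| WhileTrue: "aval (fst s) a \<noteq> 0 \<Longrightarrow> exec p s T s' \<Longrightarrow> exec (While a p) s' U s'' \<Longrightarrow>
    exec (While a p) s (Suc (T + U)) s''"

inductive_cases exec_SkipE: "exec Skip s T s'"
inductive_cases exec_StoreE: "exec (Store a b) s T s'"
inductive_cases exec_EmitE: "exec (Emit a) s T s'"
inductive_cases exec_SeqE: "exec (Seq p q) s T s'"
inductive_cases exec_IfE: "exec (If a p q) s T s'"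
inductive_cases exec_WhileE: "exec (While a p) s T s'"

lemma exec_deterministic:
  "exec p s T s' \<Longrightarrow> exec p s U s'' \<Longrightarrow> U = T \<and> s'' = s'"
proof (induction arbitrary: U s'' rule: exec.induct)
  case (Skip s)
  from Skip.prems show ?case by (rule exec_SkipE) simp
next
  case (Store a b m out)
  from Store.prems show ?case by (rule exec_StoreE) simp
next
  case (Emit a m out)
  from Emit.prems show ?case by (rule exec_EmitE) simp
next
  case (Seq p s T s1 q V s2)
  from Seq.prems show ?case
  proof (rule exec_SeqE)
    fix T' r V' assume *: "U = T' + V'" "exec p s T' r" "exec q r V' s''"
    with Seq.IH(1)[OF *(2)] have "exec q s1 V' s''" by simp
    from Seq.IH(1)[OF *(2)] Seq.IH(2)[OF this] *(1) show ?case by simp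
  qed
next
  case (IfTrue s a p T s1 q)
  from IfTrue.prems show ?case
  proof (rule exec_IfE)
    fix T' assume *: "U = Suc T'" "exec p s T' s''"
    from IfTrue.IH[OF *(2)] *(1) show ?case by simp
  qed (use IfTrue.hyps(1) in simp)
next
  case (IfFalse s a q T s1 p)
  from IfFalse.prems show ?case
  proof (rule exec_IfE)
    fix T' assume *: "U = Suc T'" "exec q s T' s''"
    from IfFalse.IH[OF *(2)] *(1) show ?case by simp
  qed (use IfFalse.hyps(1) in simp)
next
  case (WhileFalse s a p)
  from WhileFalse.prems show ?case by (rule exec_WhileE) (use WhileFalse.hyps in simp_all)
next
  case (WhileTrue s a p T s1 V s2)
  from WhileTrue.prems show ?case
  proof (rule exec_WhileE)
    fix T' r V' assume *: "U = Suc (T' + V')" "exec p s T' r" "exec (While a p) r V' s''"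
    with WhileTrue.IH(1)[OF *(2)] have "exec (While a p) s1 V' s''" by simp
    from WhileTrue.IH(1)[OF *(2)] WhileTrue.IH(2)[OF this] *(1) show ?case by simp
  qed (use WhileTrue.hyps(1) in simp)
qed

lemma exec_output_length:
  "exec p s T s' \<Longrightarrow> length (snd s') \<le> length (snd s) + T"
  by (induction rule: exec.induct) simp_all

text \<open>The two inputs are placed in cells 0 and 1, all other cells are 0.\<close>

definition runs :: "com \<Rightarrow> nat \<Rightarrow> nat \<Rightarrow> nat \<Rightarrow> nat list \<Rightarrow> bool" where
  "runs p x y T out \<longleftrightarrow> (\<exists>m. exec p ((\<lambda>_. 0)(0 := x, 1 := y), []) T (m, out))"

text \<open>
  A finite set \<open>S\<close> is presented to a machine by an enumeration \<open>e\<close> of \<open>S\<close> by \<open>{..<card S}\<close>; the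
  machine sees only \<open>card S\<close> and refers to the element \<open>e i\<close> as \<open>i\<close>. A collection of \<open>t\<close>-tuples
  with multiplicities is written out in full, as \<open>t\<close> followed by all entries of all tuples.
  A real parameter \<open>\<lambda>\<close> in \<open>(0, 1)\<close> is presented by the integer \<open>\<lceil>1 / \<lambda>\<rceil>\<close>.
  \<open>constructs p S e \<lambda> T t W\<close>: on input \<open>S\<close> and \<open>\<lambda>\<close>, the program \<open>p\<close> halts after \<open>T\<close> steps having
  written out the nonempty collection \<open>W\<close> of elements of \<open>S\<^sup>t\<close>.
\<close>

definition constructs ::
  "com \<Rightarrow> 'a set \<Rightarrow> (nat \<Rightarrow> 'a) \<Rightarrow> real \<Rightarrow> nat \<Rightarrow> nat \<Rightarrow> 'a list multiset \<Rightarrow> bool" where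
  "constructs p S e lam T t W \<longleftrightarrow>
     (\<exists>J :: nat list list. J \<noteq> [] \<and> (\<forall>w \<in> set J. length w = t \<and> set w \<subseteq> {..<card S}) \<and>
        runs p (card S) (nat \<lceil>1 / lam\<rceil>) T (t # concat J) \<and> W = mset (map (map e) J))"

end

theory Submission
  imports Defs "HOL-Analysis.Convex" "HOL-Library.FuncSet" "HOL-Library.Function_Algebras"
    "HOL-Computational_Algebra.Polynomial" "HOL-Computational_Algebra.Primes" "HOL-Number_Theory.Cong"
begin

text \<open>
  The words are read off a walk on pairs \<open>(v, y)\<close> (the wide replacement product of Ta-Shma). Here \<open>v\<close> is a
  vertex of the Gabber-Galil expander on \<open>\<int>\<^sub>q \<times> \<int>\<^sub>q\<close>, whose \<open>q\<^sup>2 = O(|S|)\<close> vertices are labelled almost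
  uniformly by \<open>S\<close>, and \<open>y\<close> is a vector of length \<open>m = s b\<close> over \<open>\<int>\<^sub>p\<close>. In one superstep the next \<open>b\<close> coordinates
  of \<open>y\<close> direct \<open>b\<close> steps of \<open>v\<close>, each of which contributes a letter; then \<open>y\<close> is shifted by
  \<open>c (1, x, \<dots>, x\<^bsup>m-1\<^esup>)\<close> with one of the \<open>p\<^sup>2\<close> choices of \<open>(c, x)\<close>.

  A nonzero polynomial of degree below \<open>m\<close> has fewer than \<open>m\<close> roots, so the operator \<open>Y\<close> that averages over the
  shifts differs by at most \<open>m / p\<close> in norm from the full average \<open>J\<close> over \<open>y\<close>. In a block
  \<open>M\<^sub>1 Y M\<^sub>2 Y \<dots> M\<^sub>s Y\<close> every superstep reads other coordinates, and shifts preserve the uniform distribution. Hence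
  between two occurrences of \<open>J\<close> the walk of \<open>v\<close> is a genuine random walk on the expander, and every superstep gains
  a factor \<open>m / p\<close> if \<open>b\<close> is large enough. Splitting \<open>Y = J + (Y - J)\<close> from both ends, a block has norm at
  most \<open>(s + 1)\<^sup>2 (m / p)\<^bsup>s-1\<^esup> \<le> p\<^bsup>-(s-2)\<^esup>\<close>, at the price of \<open>p\<^bsup>2s\<^esup>\<close> choices of shifts. This gives the
  exponent \<open>2 s / (s - 2)\<close>, where \<open>s\<close> grows so slowly with \<open>1 / \<lambda>\<close> that the \<open>p\<^sup>m\<close> initial vectors are negligible.
\<close>

section \<open>Fourier analysis on cyclic groups\<close>

text \<open>The exponent 2 is a balance of cost and gain: a shift is one of p^2 choices and gains m
  / p, which up to the small factor m is the inverse square root of its cost. A plain expander walk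
  cannot guarantee this. The letter matrices are arbitrary contractions, so they may turn a
  mean-zero vector into a constant one, and only every second step is sure to gain; this doubles the
  exponent to 4. The inner vector repairs it: the labels of later supersteps in a block are
  independent of those already read, so even where the inner component collapses to its average, the
  outer walk is random and gains. Hence the outer expander may be crude. A fixed gap is enough,
  since b letters per superstep bring its contraction below m / p, and b affects the number of words
  only through p^m. With kk blocks there are q^2 p^m p^(2 s kk) words, and p^m is small against 1 /
  \<lambda> because p is at most logarithmic in 1 / \<lambda>, up to the threshold. Matrices are
  used only through their action on vectors, so the dimension l enters no bound.\<close>

lemma parseval_kernel:
  fixes h :: "'a \<Rightarrow> complex" and e :: "'b \<Rightarrow> 'a \<Rightarrow> complex"
  assumes "finite G"
    and orth: "\<And>x y. x \<in> G \<Longrightarrow> y \<in> G \<Longrightarrow> (\<Sum>g\<in>\<Gamma>. e g x * cnj (e g y)) = (if x = y then of_real c else 0)"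
  shows "(\<Sum>g\<in>\<Gamma>. (cmod (\<Sum>x\<in>G. h x * e g x))\<^sup>2) = c * (\<Sum>x\<in>G. (cmod (h x))\<^sup>2)"
proof -
  have "complex_of_real (\<Sum>g\<in>\<Gamma>. (cmod (\<Sum>x\<in>G. h x * e g x))\<^sup>2)
      = (\<Sum>g\<in>\<Gamma>. (\<Sum>x\<in>G. h x * e g x) * cnj (\<Sum>y\<in>G. h y * e g y))"
    by (simp only: of_real_sum complex_norm_square)
  also have "\<dots> = (\<Sum>g\<in>\<Gamma>. \<Sum>x\<in>G. \<Sum>y\<in>G. (h x * e g x) * cnj (h y * e g y))"
    by (simp only: cnj_sum sum_product)
  also have "\<dots> = (\<Sum>x\<in>G. \<Sum>y\<in>G. \<Sum>g\<in>\<Gamma>. (h x * e g x) * cnj (h y * e g y))"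
    by (subst sum.swap, intro sum.cong refl sum.swap)
  also have "\<dots> = (\<Sum>x\<in>G. \<Sum>y\<in>G. h x * cnj (h y) * (\<Sum>g\<in>\<Gamma>. e g x * cnj (e g y)))"
    by (simp add: sum_distrib_left algebra_simps)
  also have "\<dots> = (\<Sum>x\<in>G. \<Sum>y\<in>G. if x = y then h x * cnj (h y) * of_real c else 0)"
    by (intro sum.cong refl) (simp add: orth)
  also have "\<dots> = (\<Sum>x\<in>G. h x * cnj (h x) * of_real c)"
    using assms(1) by (intro sum.cong refl) simp
  also have "\<dots> = of_real (c * (\<Sum>x\<in>G. (cmod (h x))\<^sup>2))"
    by (simp only: of_real_mult of_real_sum complex_norm_square sum_distrib_left mult.commute mult.left_commute)
  finally show ?thesis by (metis of_real_eq_iff)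
qed

definition ew :: "nat \<Rightarrow> int \<Rightarrow> complex" where
  "ew n k = cis (2 * pi * of_int k / of_nat n)"

lemma ew_add: "ew n (a + b) = ew n a * ew n b"
  by (simp add: ew_def cis_mult ring_distribs add_divide_distrib)

lemma ew_0 [simp]: "ew n 0 = 1"
  by (simp add: ew_def)

lemma cmod_ew [simp]: "cmod (ew n k) = 1"
  by (simp add: ew_def)

lemma cnj_ew: "cnj (ew n k) = ew n (- k)"
  by (simp add: ew_def cis_cnj)

lemma ew_period:
  assumes "n > 0" shows "ew n (k + int n * j) = ew n k"
proof -
  have "ew n (int n * j) = 1"
  proof -
    have "2 * pi * of_int (int n * j) / of_nat n = 2 * pi * real_of_int j"
      using assms by simp
    thus ?thesis unfolding ew_def by (simp only: cis_multiple_2pi Ints_of_int)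
  qed
  thus ?thesis by (simp add: ew_add)
qed

lemma ew_mod: assumes "n > 0" shows "ew n (k mod int n) = ew n k"
  by (metis assms ew_period mult_div_mod_eq add.commute)

lemma ew_cong: assumes "n > 0" "k mod int n = j mod int n" shows "ew n k = ew n j"
  by (metis assms ew_mod)

lemma ew_dvd: assumes "n > 0" "int n dvd k" shows "ew n k = 1"
  using ew_cong[of n k 0] assms by simp

lemma ew_eq_1_iff: assumes "n > 0" shows "ew n k = 1 \<longleftrightarrow> int n dvd k"
proof
  assume "ew n k = 1"
  hence "cos (2 * pi * of_int k / of_nat n) = 1" by (simp add: ew_def complex_eq_iff)
  then obtain j :: int where "2 * pi * of_int k / of_nat n = of_int j * 2 * pi"
    by (auto simp: cos_one_2pi_int)
  hence "real_of_int k = real_of_int (j * int n)" using assms by (simp add: field_simps)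
  hence "k = j * int n" by linarith
  thus "int n dvd k" by simp
qed (use assms ew_dvd in auto)

lemma ew_power: "ew n (int j * k) = ew n k ^ j"
  by (simp add: ew_def Complex.DeMoivre field_simps)

lemma sum_ew:
  assumes "n > 0"
  shows "(\<Sum>j<n. ew n (int j * k)) = (if int n dvd k then of_nat n else 0)"
proof (cases "int n dvd k")
  case True
  have "(\<Sum>j<n. ew n (int j * k)) = (\<Sum>j<n. 1)"
    using assms True by (intro sum.cong refl ew_dvd) auto
  thus ?thesis using True by simp
next
  case False
  have "ew n k ^ n = 1" using ew_power[of n n k] ew_dvd[OF assms, of "int n * k"] by simp
  moreover have "ew n k \<noteq> 1" using False assms ew_eq_1_iff by blast
  ultimately show ?thesis using False by (simp add: ew_power sum_gp_strict)
qed

section \<open>The Gabber-Galil expander\<close>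

text \<open>The distance of \<open>z\<close> to the nearest multiple of \<open>n\<close>: the size
  of a frequency on the circle of residues.\<close>

definition rabs :: "nat \<Rightarrow> int \<Rightarrow> int" where
  "rabs n z = min (z mod int n) (int n - z mod int n)"

text \<open>Weights of Jimbo and Maruoka for the Cauchy-Schwarz inequality in \<open>norm_ft_gg_le\<close>: near the
  origin of the frequency plane at most one of the four neighbours of a point is closer to 0, and far
  from the origin the cosines in \<open>cos_rabs\<close> are small.\<close>

definition gam :: "int \<Rightarrow> int \<Rightarrow> real" where
  "gam a b = (if a < b then 4/5 else if b < a then 5/4 else 1)"

lemma gam_mult: "gam a b * gam b a = 1" by (simp add: gam_def)
lemma gam_pos: "gam a b > 0" by (simp add: gam_def)
lemma gam_le: "gam a b \<le> 5/4" by (simp add: gam_def)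

lemma rabs_nonneg: "n > 0 \<Longrightarrow> 0 \<le> rabs n z"
  unfolding rabs_def
  by (smt (verit, best) of_nat_0_less_iff pos_mod_bound pos_mod_sign)

lemma rabs_half: "2 * rabs n z \<le> int n"
  unfolding rabs_def min_def by auto

lemma rabs_minus: assumes "n > 0" shows "rabs n (- z) = rabs n z"
  using assms by (auto simp: rabs_def zmod_zminus1_eq_if)

lemma rabs_mod: "rabs n (z mod int n) = rabs n z"
  by (simp add: rabs_def)

lemma rabs_cong: "z mod int n = w mod int n \<Longrightarrow> rabs n z = rabs n w"
  by (simp add: rabs_def)

lemma rabs_eq_0: assumes "n > 0" shows "rabs n z = 0 \<longleftrightarrow> int n dvd z"
proof -
  have "z mod int n < int n" using assms by simp
  thus ?thesis by (auto simp: rabs_def min_def dvd_eq_mod_eq_0)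
qed

lemma rabs_cases:
  assumes "n > 0"
  shows "z mod int n = rabs n z mod int n \<or> z mod int n = (- rabs n z) mod int n"
proof (cases "z mod int n \<le> int n - z mod int n")
  case True thus ?thesis by (simp add: rabs_def)
next
  case False
  hence "rabs n z = int n - z mod int n" by (simp add: rabs_def)
  hence "- rabs n z = z mod int n - int n" by simp
  hence "(- rabs n z) mod int n = z mod int n" by (metis minus_mod_self2 mod_mod_trivial)
  thus ?thesis by simp
qed

lemma rabs_of_small:
  assumes "n > 0" "\<bar>z\<bar> \<le> int n"
  shows "rabs n z = min \<bar>z\<bar> (int n - \<bar>z\<bar>)"
proof -
  have *: "rabs n z = min z (int n - z)" if "0 \<le> z" "z \<le> int n" for z
  proof (cases "z = int n")
    case True thus ?thesis using assms(1) by (simp add: rabs_def)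
  next
    case False thus ?thesis using that by (simp add: rabs_def)
  qed
  show ?thesis using *[of z] *[of "- z"] rabs_minus[OF assms(1), of z] assms(2) by (cases "z \<ge> 0") auto
qed

text \<open>The half-angle formula. Reducing the frequency by \<open>rabs\<close> keeps the angle
  between 0 and \<open>pi / 2\<close>, so the cosine is nonnegative and no absolute value is carried
  along.\<close>

lemma cos_rabs:
  assumes "n > 0"
  shows "cmod (1 + ew n z) = 2 * cos (pi * of_int (rabs n z) / n)"
proof -
  have bound: "0 \<le> cos (pi * of_int (rabs n z) / n)"
  proof (rule cos_ge_zero)
    have "0 \<le> pi * of_int (rabs n z) / n" using rabs_nonneg[OF assms] by simp
    thus "- (pi / 2) \<le> pi * of_int (rabs n z) / n" using pi_gt_zero by linarith
    have "real_of_int (rabs n z) \<le> n / 2" using rabs_half[of n z] by linarith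
    hence "pi * of_int (rabs n z) / n \<le> pi * (n/2) / n"
      by (intro divide_right_mono mult_left_mono) auto
    thus "pi * of_int (rabs n z) / n \<le> pi / 2" using assms by simp
  qed
  have main: "cmod (1 + ew n w) = 2 * \<bar>cos (pi * of_int w / n)\<bar>" for w
  proof -
    have "1 + ew n w = cis (pi * w / n) * (cis (- (pi * w / n)) + cis (pi * w / n))"
      by (simp add: ew_def ring_distribs cis_mult mult.assoc)
    also have "cis (- (pi * w / n)) + cis (pi * w / n) = of_real (2 * cos (pi * w / n))"
      by (simp add: complex_eq_iff)
    finally show ?thesis by (simp add: norm_mult del: of_real_mult)
  qed
  from rabs_cases[OF assms, of z] show ?thesis
  proof
    assume "z mod int n = rabs n z mod int n"
    hence "ew n z = ew n (rabs n z)" using ew_cong assms by blast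
    thus ?thesis using main[of "rabs n z"] bound by simp
  next
    assume "z mod int n = (- rabs n z) mod int n"
    hence "ew n z = ew n (- rabs n z)" using ew_cong assms by blast
    thus ?thesis using main[of "- rabs n z"] bound by simp
  qed
qed

text \<open>Three weights \<open>4/5\<close> and one \<open>5/4\<close> sum to \<open>73/20\<close>;
  this is the origin of the constant. On the axis and on the diagonal two neighbours keep their
  distance, and the sum is only \<open>18/5\<close>.\<close>

lemma gam_key_small:
  assumes n: "n > 0" and ab: "0 \<le> b" "b \<le> a" "0 < a" "2 * (a + b) < int n"
  shows "gam b (rabs n (b + 2 * a)) + gam b (rabs n (b - 2 * a))
       + (gam a (rabs n (a + 2 * b)) + gam a (rabs n (a - 2 * b))) \<le> 73/20"
proof -
  have r1: "rabs n (b + 2 * a) = min (b + 2*a) (int n - (b + 2 * a))"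
    using ab by (subst rabs_of_small[OF n]) auto
  have r2: "rabs n (b - 2 * a) = min (2*a - b) (int n - (2 * a - b))"
    using ab by (subst rabs_of_small[OF n]) auto
  have r3: "rabs n (a + 2 * b) = min (a + 2*b) (int n - (a + 2 * b))"
    using ab by (subst rabs_of_small[OF n]) auto
  have r4: "rabs n (a - 2 * b) = min \<bar>a - 2*b\<bar> (int n - \<bar>a - 2 * b\<bar>)"
    using ab by (subst rabs_of_small[OF n]) auto
  have g1: "gam b (rabs n (b + 2 * a)) = 4/5" using ab by (simp add: r1 gam_def)
  show ?thesis
  proof (cases "b = 0")
    case True
    have "rabs n (b - 2 * a) > b" using ab True unfolding r2 by auto
    hence "gam b (rabs n (b - 2 * a)) = 4/5" by (simp add: gam_def)
    moreover have "rabs n a = a" using ab True by (subst rabs_of_small[OF n]) auto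
    ultimately show ?thesis using g1 True by (simp add: gam_def)
  next
    case b: False
    have g3: "gam a (rabs n (a + 2 * b)) = 4/5" using ab b by (simp add: r3 gam_def)
    show ?thesis
    proof (cases "a = b")
      case True
      have "gam b (rabs n (b - 2 * a)) = 1" unfolding r2 gam_def using ab True by simp
      moreover have "gam a (rabs n (a - 2 * b)) = 1" unfolding r4 gam_def using ab True by simp
      ultimately show ?thesis using g1 g3 by simp
    next
      case False
      have "gam b (rabs n (b - 2 * a)) = 4/5" using ab False by (simp add: r2 gam_def)
      thus ?thesis using g1 g3 gam_le[of a "rabs n (a - 2 * b)"] by simp
    qed
  qed
qed

lemma cos_add_le_sqrt2:
  assumes "0 \<le> x" "x \<le> pi/2" "0 \<le> y" "y \<le> pi/2" "pi/2 \<le> x + y"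
  shows "cos x + cos y \<le> sqrt 2"
proof -
  have "cos y \<le> cos (pi/2 - x)"
    using assms by (subst cos_mono_le_eq) auto
  hence "cos x + cos y \<le> cos x + sin x" by (simp add: cos_diff)
  also have "(cos x + sin x)\<^sup>2 \<le> 2"
  proof -
    have "(cos x + sin x)\<^sup>2 + (cos x - sin x)\<^sup>2 = 2 * ((sin x)\<^sup>2 + (cos x)\<^sup>2)"
      by (simp add: power2_eq_square algebra_simps)
    also have "\<dots> = 2" by simp
    finally show ?thesis by (smt (verit) zero_le_power2)
  qed
  hence "cos x + sin x \<le> sqrt 2" by (rule real_le_rsqrt)
  finally show ?thesis .
qed

lemma gam_key:
  assumes n: "n > 0" and nz: "\<not> (int n dvd x \<and> int n dvd y)"
  shows "cos (pi * of_int (rabs n x) / n) * (gam (rabs n y) (rabs n (y + 2 * x)) + gam (rabs n y) (rabs n (y - 2 * x)))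
       + cos (pi * of_int (rabs n y) / n) * (gam (rabs n x) (rabs n (x + 2 * y)) + gam (rabs n x) (rabs n (x - 2 * y))) \<le> 73/20"
    (is "?cx * ?gx + ?cy * ?gy \<le> _")
proof -
  define a b where "a = rabs n x" and "b = rabs n y"
  have a0: "0 \<le> a" "2 * a \<le> int n" and b0: "0 \<le> b" "2 * b \<le> int n"
    unfolding a_def b_def using rabs_nonneg[OF n] rabs_half by auto
  have ang: "0 \<le> pi * of_int c / n \<and> pi * of_int c / n \<le> pi/2" if "0 \<le> c" "2 * c \<le> int n" for c
  proof -
    have "real_of_int c \<le> n / 2" using that by linarith
    hence "pi * of_int c / n \<le> pi * (n/2) / n"
      by (intro divide_right_mono mult_left_mono) auto
    thus ?thesis using that n by simp
  qed
  have cpos: "0 \<le> ?cx" "0 \<le> ?cy"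
    using ang[OF a0] ang[OF b0] pi_gt_zero unfolding a_def b_def
    by (auto intro!: cos_ge_zero elim: order_trans[rotated])
  show ?thesis
  proof (cases "2 * (a + b) < int n")
    case True
    \<comment> \<open>Negating \<open>x\<close> or \<open>y\<close> only exchanges the two
      neighbours of a pair, so the frequency may be moved to the quadrant of nonnegative
      coordinates.\<close>
    have swap: "gam b (rabs n (y + 2 * x)) + gam b (rabs n (y - 2 * x)) = gam b (rabs n (b + 2 * a)) + gam b (rabs n (b - 2 * a))"
      if yb: "y mod int n = b mod int n \<or> y mod int n = (- b) mod int n"
        and xa: "x mod int n = a mod int n \<or> x mod int n = (- a) mod int n" for x y a b
    proof -
      have cong: "rabs n (y + 2 * x) = rabs n (v + 2 * u)" "rabs n (y - 2 * x) = rabs n (v - 2 * u)"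
        if "y mod int n = v mod int n" "x mod int n = u mod int n" for u v
        using that by (auto intro!: rabs_cong intro: mod_add_cong mod_diff_cong mod_mult_cong)
      have m1: "rabs n (- b + 2 * a) = rabs n (b - 2 * a)" using rabs_minus[OF n, of "b - 2 * a"] by simp
      have m2: "rabs n (- b - 2 * a) = rabs n (b + 2 * a)" using rabs_minus[OF n, of "b + 2 * a"] by simp
      from yb xa show ?thesis
        by (elim disjE) (use cong m1 m2 in \<open>fastforce simp: add.commute\<close>)+
    qed
    have X: "?gx = gam b (rabs n (b + 2 * a)) + gam b (rabs n (b - 2 * a))"
      using swap[of y b x a] rabs_cases[OF n, of x] rabs_cases[OF n, of y] unfolding a_def b_def by blast
    have Y: "?gy = gam a (rabs n (a + 2 * b)) + gam a (rabs n (a - 2 * b))"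
      using swap[of x a y b] rabs_cases[OF n, of x] rabs_cases[OF n, of y] unfolding a_def b_def by blast
    have "?cx * ?gx + ?cy * ?gy \<le> 1 * ?gx + 1 * ?gy"
      by (intro add_mono mult_right_mono cos_le_one add_nonneg_nonneg order.strict_implies_order[OF gam_pos])
    also have "\<dots> \<le> 73/20"
    proof (cases "b \<le> a")
      case le: True
      have "a \<noteq> 0 \<or> b \<noteq> 0" using nz rabs_eq_0[OF n] unfolding a_def b_def by auto
      hence "0 < a" using le b0 by auto
      thus ?thesis using gam_key_small[OF n b0(1) le _ True] X Y by simp
    next
      case False
      thus ?thesis using gam_key_small[OF n a0(1), of b] True X Y a0 by (simp add: add.commute)
    qed
    finally show ?thesis .
  next
    case False
    hence "real_of_int (int n) \<le> real_of_int (2 * (a + b))" by (simp only: of_int_le_iff)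
    hence "real n / 2 \<le> real_of_int a + of_int b" by simp
    hence "pi * (n / 2) / n \<le> pi * (of_int a + of_int b) / n"
      by (intro divide_right_mono mult_left_mono) auto
    hence "pi / 2 \<le> pi * of_int a / n + pi * of_int b / n"
      using n by (simp add: ring_distribs add_divide_distrib)
    hence "?cx + ?cy \<le> sqrt 2"
      using ang[OF a0] ang[OF b0] unfolding a_def b_def by (intro cos_add_le_sqrt2) auto
    \<comment> \<open>Far from the origin every weight is bounded by \<open>5/4\<close>, and
      \<open>73/50 * 5/2 = 73/20\<close> is the same constant as near the origin.\<close>
    also have "\<dots> \<le> 73/50" by (rule real_le_lsqrt) (auto simp: power2_eq_square)
    finally have cc: "?cx + ?cy \<le> 73/50" .
    have "?cx * ?gx + ?cy * ?gy \<le> ?cx * (5/4+5/4) + ?cy * (5/4+5/4)"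
      by (intro add_mono mult_left_mono cpos gam_le)
    also have "\<dots> \<le> 73/20" using cc by simp
    finally show ?thesis .
  qed
qed

section \<open>Shears of the discrete torus and their action on frequencies\<close>

lemma sum_ints_nat: "(\<Sum>x\<in>{0..<int q}. f x) = (\<Sum>x<q. f (int x))"
  by (rule sum.reindex_bij_witness[of _ int nat]) auto

lemma sum_period_shift:
  fixes f :: "int \<Rightarrow> 'a :: comm_monoid_add"
  assumes q: "q > 0" and per: "\<And>x. f (x mod int q) = f x"
  shows "(\<Sum>x\<in>{0..<int q}. f (x + d)) = (\<Sum>x\<in>{0..<int q}. f x)"
proof (rule sum.reindex_bij_witness[of _ "\<lambda>x. (x - d) mod int q" "\<lambda>x. (x + d) mod int q"])
  fix x assume "x \<in> {0..<int q}"
  thus "((x + d) mod int q - d) mod int q = x" "((x - d) mod int q + d) mod int q = x"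
    by (simp_all add: mod_diff_left_eq mod_add_left_eq)
qed (use q per in auto)

text \<open>Functions on the torus are doubly periodic functions of integers, so shears and negative
  steps are written without reductions.\<close>

locale grid =
  fixes q :: nat and h :: "int \<Rightarrow> int \<Rightarrow> complex"
  assumes q: "q > 0"
    and perx: "\<And>x y. h (x mod int q) y = h x y"
    and pery: "\<And>x y. h x (y mod int q) = h x y"
begin

abbreviation "R \<equiv> {0..<int q}"

definition ft :: "int \<Rightarrow> int \<Rightarrow> complex" where
  "ft z w = (\<Sum>x\<in>R. \<Sum>y\<in>R. h x y * ew q (x * z + y * w))"

lemma ft_period: "ft (z mod int q) w = ft z w" "ft z (w mod int q) = ft z w"
proof -
  have "ew q (x * (z mod int q) + y * w) = ew q (x * z + y * w)"
    "ew q (x * z + y * (w mod int q)) = ew q (x * z + y * w)" for x y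
    by (rule ew_cong[OF q]; intro mod_add_cong mod_mult_cong; simp)+
  thus "ft (z mod int q) w = ft z w" "ft z (w mod int q) = ft z w"
    unfolding ft_def by simp_all
qed

lemma parseval: "(\<Sum>z\<in>R. \<Sum>w\<in>R. (cmod (ft z w))\<^sup>2) = (real q)\<^sup>2 * (\<Sum>x\<in>R. \<Sum>y\<in>R. (cmod (h x y))\<^sup>2)"
proof -
  have R1: "(\<Sum>z\<in>R. ew q (z * d)) = (if int q dvd d then of_nat q else 0)" for d
    by (subst sum_ints_nat) (rule sum_ew[OF q])
  have orth: "(\<Sum>g\<in>R \<times> R. ew q (fst a * fst g + snd a * snd g) * cnj (ew q (fst b * fst g + snd b * snd g)))
      = (if a = b then of_real ((real q)\<^sup>2) else 0)" if "a \<in> R \<times> R" "b \<in> R \<times> R" for a b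
  proof -
    have "(\<Sum>g\<in>R \<times> R. ew q (fst a * fst g + snd a * snd g) * cnj (ew q (fst b * fst g + snd b * snd g)))
       = (\<Sum>z\<in>R. \<Sum>w\<in>R. ew q (z * (fst a - fst b)) * ew q (w * (snd a - snd b)))"
      by (subst sum.cartesian_product, intro sum.cong refl)
         (auto simp: cnj_ew ew_add[symmetric] algebra_simps)
    also have "\<dots> = (\<Sum>z\<in>R. ew q (z * (fst a - fst b))) * (\<Sum>w\<in>R. ew q (w * (snd a - snd b)))"
      by (simp add: sum_product)
    also have "\<dots> = (if a = b then of_real ((real q)\<^sup>2) else 0)"
    proof -
      have "int q dvd u - v \<longleftrightarrow> u = v" if "u \<in> R" "v \<in> R" for u v
        using that by (metis atLeastLessThan_iff mod_eq_dvd_iff mod_pos_pos_trivial)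
      thus ?thesis using that by (auto simp: R1 power2_eq_square prod_eq_iff mem_Times_iff)
    qed
    finally show ?thesis .
  qed
  have "(\<Sum>g\<in>R \<times> R. (cmod (\<Sum>a\<in>R \<times> R. h (fst a) (snd a) * ew q (fst a * fst g + snd a * snd g)))\<^sup>2)
     = (real q)\<^sup>2 * (\<Sum>a\<in>R \<times> R. (cmod (h (fst a) (snd a)))\<^sup>2)"
    by (rule parseval_kernel) (use orth in auto)
  thus ?thesis
    by (simp add: ft_def sum.cartesian_product case_prod_beta)
qed

text \<open>The unnormalized adjacency operator. The eight neighbours come from the shears by
  \<open>2 * y + e\<close> and \<open>2 * x + e\<close> and from their inverses, for the offsets 0
  and 1.\<close>

definition gg :: "int \<Rightarrow> int \<Rightarrow> complex" where
  "gg x y = (\<Sum>s\<in>{1,-1}. \<Sum>e\<in>{0,1}. h (x + s * (2 * y + e)) y + h x (y + s * (2 * x + e)))"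

text \<open>A shear acts on frequencies by the transposed inverse shear, and an offset contributes
  only a phase. The two offsets add up to a factor \<open>1 + ew\<close>, whose modulus drops as the
  frequency moves away from 0; the offsets are there for this factor.\<close>

lemma ft_gg: "(\<Sum>x\<in>R. \<Sum>y\<in>R. gg x y * ew q (x * z + y * w))
   = (\<Sum>s\<in>{1,-1}. (1 + ew q (- s * z)) * ft z (w - 2 * s * z) + (1 + ew q (- s * w)) * ft (z - 2 * s * w) w)"
proof -
  have 1: "(\<Sum>x\<in>R. \<Sum>y\<in>R. h (x + s * (2 * y + e)) y * ew q (x * z + y * w)) = ew q (- s * e * z) * ft z (w - 2 * s * z)" for s e
  proof -
    have "(\<Sum>x\<in>R. h (x + s * (2 * y + e)) y * ew q (x * z + y * w))
        = (\<Sum>x\<in>R. h x y * ew q ((x - s * (2 * y + e)) * z + y * w))" for y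
    proof -
      have "h (x mod int q) y * ew q ((x mod int q - s * (2 * y + e)) * z + y * w) =
          h x y * ew q ((x - s * (2 * y + e)) * z + y * w)" for x
        unfolding perx by (intro arg_cong2[where f = "(*)"] refl ew_cong[OF q] mod_add_cong mod_mult_cong mod_diff_cong) simp_all
      from sum_period_shift[of q "\<lambda>x. h x y * ew q ((x - s * (2 * y + e)) * z + y * w)" "s * (2 * y + e)", OF q this]
      show ?thesis by simp
    qed
    hence "(\<Sum>x\<in>R. \<Sum>y\<in>R. h (x + s * (2 * y + e)) y * ew q (x * z + y * w))
        = (\<Sum>y\<in>R. \<Sum>x\<in>R. h x y * ew q ((x - s * (2 * y + e)) * z + y * w))"
      by (subst sum.swap) simp
    also have "\<dots> = (\<Sum>x\<in>R. \<Sum>y\<in>R. ew q (- s * e * z) * (h x y * ew q (x * z + y * (w - 2 * s * z))))"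
    proof (subst sum.swap, intro sum.cong refl)
      fix x y :: int
      have "(x - s * (2 * y + e)) * z + y * w = - s * e * z + (x * z + y * (w - 2 * s * z))"
        by (simp add: algebra_simps)
      thus "h x y * ew q ((x - s * (2 * y + e)) * z + y * w) = ew q (- s * e * z) * (h x y * ew q (x * z + y * (w - 2 * s * z)))"
        by (simp only: ew_add) simp
    qed
    finally show ?thesis by (simp add: ft_def sum_distrib_left)
  qed
  have 2: "(\<Sum>x\<in>R. \<Sum>y\<in>R. h x (y + s * (2 * x + e)) * ew q (x * z + y * w)) = ew q (- s * e * w) * ft (z - 2 * s * w) w" for s e
  proof -
    have "(\<Sum>y\<in>R. h x (y + s * (2 * x + e)) * ew q (x * z + y * w))
        = (\<Sum>y\<in>R. h x y * ew q (x * z + (y - s * (2 * x + e)) * w))" for x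
    proof -
      have "h x (y mod int q) * ew q (x * z + (y mod int q - s * (2 * x + e)) * w) =
          h x y * ew q (x * z + (y - s * (2 * x + e)) * w)" for y
        unfolding pery by (intro arg_cong2[where f = "(*)"] refl ew_cong[OF q] mod_add_cong mod_mult_cong mod_diff_cong) simp_all
      from sum_period_shift[of q "\<lambda>y. h x y * ew q (x * z + (y - s * (2 * x + e)) * w)" "s * (2 * x + e)", OF q this]
      show ?thesis by simp
    qed
    hence "(\<Sum>x\<in>R. \<Sum>y\<in>R. h x (y + s * (2 * x + e)) * ew q (x * z + y * w))
        = (\<Sum>x\<in>R. \<Sum>y\<in>R. h x y * ew q (x * z + (y - s * (2 * x + e)) * w))"
      by simp
    also have "\<dots> = (\<Sum>x\<in>R. \<Sum>y\<in>R. ew q (- s * e * w) * (h x y * ew q (x * (z - 2 * s * w) + y * w)))"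
    proof (intro sum.cong refl)
      fix x y :: int
      have "x * z + (y - s * (2 * x + e)) * w = - s * e * w + (x * (z - 2 * s * w) + y * w)"
        by (simp add: algebra_simps)
      thus "h x y * ew q (x * z + (y - s * (2 * x + e)) * w) = ew q (- s * e * w) * (h x y * ew q (x * (z - 2 * s * w) + y * w))"
        by (simp only: ew_add) simp
    qed
    finally show ?thesis by (simp add: ft_def sum_distrib_left)
  qed
  have "(\<Sum>x\<in>R. \<Sum>y\<in>R. gg x y * ew q (x * z + y * w)) =
    (\<Sum>s\<in>{1,-1}. \<Sum>e\<in>{0,1}. (\<Sum>x\<in>R. \<Sum>y\<in>R. h (x + s * (2 * y + e)) y * ew q (x * z + y * w))
        + (\<Sum>x\<in>R. \<Sum>y\<in>R. h x (y + s * (2 * x + e)) * ew q (x * z + y * w)))"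
    by (simp add: gg_def sum.distrib ring_distribs)
  also have "\<dots> = (\<Sum>s\<in>{1,-1}. \<Sum>e\<in>{0,1}. ew q (- s * e * z) * ft z (w - 2 * s * z) + ew q (- s * e * w) * ft (z - 2 * s * w) w)"
    by (simp only: 1 2)
  also have "\<dots> = (\<Sum>s\<in>{1,-1}. (1 + ew q (- s * z)) * ft z (w - 2 * s * z) + (1 + ew q (- s * w)) * ft (z - 2 * s * w) w)"
    by (intro sum.cong refl) (simp add: ring_distribs)
  finally show ?thesis .
qed


text \<open>Cauchy-Schwarz with unequal weights: each term is split as \<open>sqrt (c * g)\<close>
  times \<open>sqrt (c / g)\<close>. The first factors are summed by \<open>gam_key\<close>; in the
  second ones inverting a weight exchanges its two arguments.\<close>

lemma norm_ft_gg_le: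
  assumes "ft 0 0 = 0" "z \<in> R" "w \<in> R"
  shows "(cmod (\<Sum>x\<in>R. \<Sum>y\<in>R. gg x y * ew q (x * z + y * w)))\<^sup>2
    \<le> 73/10 * (\<Sum>s\<in>{1,-1}. 2 * cos (pi * of_int (rabs q z) / q) * (gam (rabs q (w - 2 * s * z)) (rabs q w) * (cmod (ft z (w - 2 * s * z)))\<^sup>2)
      + 2 * cos (pi * of_int (rabs q w) / q) * (gam (rabs q (z - 2 * s * w)) (rabs q z) * (cmod (ft (z - 2 * s * w) w))\<^sup>2))"
proof -
  define cz cw where "cz = cos (pi * of_int (rabs q z) / q)" and "cw = cos (pi * of_int (rabs q w) / q)"
  have ez: "cmod (1 + ew q (- s * z)) = 2 * cz" if "s \<in> {1,-1}" for s
    using that cos_rabs[OF q, of "- s * z"] rabs_minus[OF q, of z] by (auto simp: cz_def)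
  have ew': "cmod (1 + ew q (- s * w)) = 2 * cw" if "s \<in> {1,-1}" for s
    using that cos_rabs[OF q, of "- s * w"] rabs_minus[OF q, of w] by (auto simp: cw_def)
  have c0: "cz \<ge> 0" "cw \<ge> 0" using ez[of 1] ew'[of 1] norm_ge_zero[of "1 + ew q (- 1 * z)"] norm_ge_zero[of "1 + ew q (- 1 * w)"] by auto
  show ?thesis
  proof (cases "z = 0 \<and> w = 0")
    case True
    \<comment> \<open>The key inequality excludes the origin. The shears fix it, so there the sum is
      a multiple of \<open>ft 0 0 = 0\<close>.\<close>
    have "(\<Sum>x\<in>R. \<Sum>y\<in>R. gg x y * ew q (x * z + y * w)) = 0"
      unfolding ft_gg using True assms(1) by simp
    moreover have "0 \<le> gam a b" for a b using gam_pos[of a b] by simp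
    ultimately show ?thesis unfolding cz_def[symmetric] cw_def[symmetric] using c0 by simp
  next
    case False
    define I where "I = {(1::int,True),(-1,True),(1,False),(-1,False)}"
    define c where "c = (\<lambda>(s::int,t). if t then 2 * cz else 2 * cw)"
    define g where "g = (\<lambda>(s,t). if t then gam (rabs q w) (rabs q (w - 2 * s * z)) else gam (rabs q z) (rabs q (z - 2 * s * w)))"
    define a where "a = (\<lambda>(s,t). if t then cmod (ft z (w - 2 * s * z)) else cmod (ft (z - 2 * s * w) w))"
    have gp: "g i > 0" for i by (auto simp: g_def gam_pos split: prod.splits)
    have cp: "c i \<ge> 0" for i using c0 by (auto simp: c_def split: prod.splits)
    have "cmod (\<Sum>x\<in>R. \<Sum>y\<in>R. gg x y * ew q (x * z + y * w)) \<le> (\<Sum>s\<in>{1,-1}. 2 * cz * cmod (ft z (w - 2 * s * z)) + 2 * cw * cmod (ft (z - 2 * s * w) w))"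
      unfolding ft_gg
      by (rule sum_norm_le, rule norm_triangle_le) (simp only: norm_mult ez ew' order_refl)
    also have "\<dots> = (\<Sum>i\<in>I. c i * a i)" by (simp add: I_def c_def a_def)
    also have "\<dots> = (\<Sum>i\<in>I. sqrt (c i * g i) * (sqrt (c i / g i) * a i))"
    proof (intro sum.cong refl)
      fix i
      have "sqrt (c i * g i) * sqrt (c i / g i) = c i"
        using gp[of i] cp[of i] by (simp add: real_sqrt_mult[symmetric])
      thus "c i * a i = sqrt (c i * g i) * (sqrt (c i / g i) * a i)" by (metis mult.assoc)
    qed
    finally have "(cmod (\<Sum>x\<in>R. \<Sum>y\<in>R. gg x y * ew q (x * z + y * w)))\<^sup>2 \<le> (\<Sum>i\<in>I. sqrt (c i * g i) * (sqrt (c i / g i) * a i))\<^sup>2"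
      by (intro power_mono) auto
    also have "\<dots> \<le> (\<Sum>i\<in>I. (sqrt (c i * g i))\<^sup>2) * (\<Sum>i\<in>I. (sqrt (c i / g i) * a i)\<^sup>2)"
      by (rule Cauchy_Schwarz_ineq_sum)
    also have "\<dots> = (\<Sum>i\<in>I. c i * g i) * (\<Sum>i\<in>I. c i / g i * (a i)\<^sup>2)"
    proof -
      have "(sqrt (c i * g i))\<^sup>2 = c i * g i" "(sqrt (c i / g i) * a i)\<^sup>2 = c i / g i * (a i)\<^sup>2" for i
        using gp[of i] cp[of i] by (simp_all add: power_mult_distrib)
      thus ?thesis by simp
    qed
    also have "\<dots> \<le> 73/10 * (\<Sum>i\<in>I. c i / g i * (a i)\<^sup>2)"
    proof (rule mult_right_mono)
      have "\<not> (int q dvd z \<and> int q dvd w)"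
        using False assms(2,3) by (auto dest: zdvd_imp_le)
      from gam_key[OF q this] show "(\<Sum>i\<in>I. c i * g i) \<le> 73/10"
        by (simp add: I_def c_def g_def cz_def cw_def algebra_simps)
      show "0 \<le> (\<Sum>i\<in>I. c i / g i * (a i)\<^sup>2)"
        using gp cp by (intro sum_nonneg mult_nonneg_nonneg divide_nonneg_pos) auto
    qed
    also have "(\<Sum>i\<in>I. c i / g i * (a i)\<^sup>2) = (\<Sum>s\<in>{1,-1}. 2 * cz * (gam (rabs q (w - 2 * s * z)) (rabs q w) * (cmod (ft z (w - 2 * s * z)))\<^sup>2)
      + 2 * cw * (gam (rabs q (z - 2 * s * w)) (rabs q z) * (cmod (ft (z - 2 * s * w) w))\<^sup>2))"
    proof -
      have inv: "x / gam u v = x * gam v u" for x u v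
        using gam_mult[of u v] gam_pos[of u v] by (simp add: field_simps)
      show ?thesis by (simp add: I_def c_def g_def a_def inv)
    qed
    finally show ?thesis unfolding cz_def cw_def .
  qed
qed

text \<open>A Schur test on the Fourier side. Reindexing moves the weight of each edge to its other
  end, where the four weights again form the sum in \<open>gam_key\<close>; the inequality is thus
  applied twice. That \<open>73/10\<close> is below the degree 8 is the spectral gap.\<close>

theorem gg_contract:
  assumes "(\<Sum>x\<in>R. \<Sum>y\<in>R. h x y) = 0"
  shows "(\<Sum>x\<in>R. \<Sum>y\<in>R. (cmod (gg x y))\<^sup>2) \<le> (73/10)\<^sup>2 * (\<Sum>x\<in>R. \<Sum>y\<in>R. (cmod (h x y))\<^sup>2)"
proof -
  have ft0: "ft 0 0 = 0" using assms by (simp add: ft_def)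
  have gper: "gg (x mod int q) y = gg x y" "gg x (y mod int q) = gg x y" for x y
  proof -
    have "h ((x mod int q) + d) y = h (x + d) y" "h x ((y mod int q) + d) = h x (y + d)" for x y d
      by (metis mod_add_left_eq perx, metis mod_add_left_eq pery)
    moreover have "h (x + s * (2 * (y mod int q) + e)) y = h (x + s * (2 * y + e)) y" for x y s e
    proof -
      have "(x + s * (2 * (y mod int q) + e)) mod int q = (x + s * (2 * y + e)) mod int q"
        by (intro mod_add_cong mod_mult_cong) simp_all
      thus ?thesis by (metis perx)
    qed
    moreover have "h y (x + s * (2 * (y mod int q) + e)) = h y (x + s * (2 * y + e))" for x y s e
    proof -
      have "(x + s * (2 * (y mod int q) + e)) mod int q = (x + s * (2 * y + e)) mod int q"
        by (intro mod_add_cong mod_mult_cong) simp_all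
      thus ?thesis by (metis pery)
    qed
    ultimately show "gg (x mod int q) y = gg x y" "gg x (y mod int q) = gg x y"
      unfolding gg_def by (simp_all only: perx pery)
  qed
  interpret G: grid q gg by unfold_locales (use q gper in auto)
  define cz where "cz z = cos (pi * of_int (rabs q z) / q)" for z
  define P where "P s z w = 2 * cz z * (gam (rabs q w) (rabs q (w + 2 * s * z)) * (cmod (ft z w))\<^sup>2)" for s z w
  define Q where "Q s z w = 2 * cz w * (gam (rabs q z) (rabs q (z + 2 * s * w)) * (cmod (ft z w))\<^sup>2)" for s z w
  have P: "(\<Sum>w\<in>R. P s z (w - 2 * s * z)) = (\<Sum>w\<in>R. P s z w)" for s z
  proof -
    have "rabs q (w mod int q + 2 * s * z) = rabs q (w + 2 * s * z)" for w
      by (rule rabs_cong) (simp add: mod_simps)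
    hence "P s z (w mod int q) = P s z w" for w by (simp add: P_def rabs_mod ft_period)
    from sum_period_shift[of q "P s z" "- 2 * s * z", OF q this] show ?thesis by simp
  qed
  have Q: "(\<Sum>z\<in>R. Q s (z - 2 * s * w) w) = (\<Sum>z\<in>R. Q s z w)" for s w
  proof -
    have "rabs q (z mod int q + 2 * s * w) = rabs q (z + 2 * s * w)" for z
      by (rule rabs_cong) (simp add: mod_simps)
    hence "Q s (z mod int q) w = Q s z w" for z by (simp add: Q_def rabs_mod ft_period)
    from sum_period_shift[of q "\<lambda>z. Q s z w" "- 2 * s * w", OF q this] show ?thesis by simp
  qed
  have PQ: "(\<Sum>s\<in>{1,-1}. P s z w + Q s z w) \<le> 73/10 * (cmod (ft z w))\<^sup>2" if "z \<in> R" "w \<in> R" for z w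
  proof (cases "z = 0 \<and> w = 0")
    case True thus ?thesis by (simp add: P_def Q_def ft0)
  next
    case False
    hence "\<not> (int q dvd z \<and> int q dvd w)" using that by (auto dest: zdvd_imp_le)
    from mult_right_mono[OF gam_key[OF q this], of "2 * (cmod (ft z w))\<^sup>2"]
    show ?thesis by (simp add: P_def Q_def cz_def algebra_simps)
  qed
  have "(real q)\<^sup>2 * (\<Sum>x\<in>R. \<Sum>y\<in>R. (cmod (gg x y))\<^sup>2) = (\<Sum>z\<in>R. \<Sum>w\<in>R. (cmod (G.ft z w))\<^sup>2)"
    by (rule G.parseval[symmetric])
  also have "\<dots> \<le> (\<Sum>z\<in>R. \<Sum>w\<in>R. 73/10 * (\<Sum>s\<in>{1,-1}. P s z (w - 2 * s * z) + Q s (z - 2 * s * w) w))"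
    unfolding G.ft_def using norm_ft_gg_le[OF ft0]
    by (intro sum_mono) (simp add: P_def Q_def cz_def)
  also have "\<dots> = 73/10 * (\<Sum>s\<in>{1,-1}. (\<Sum>z\<in>R. \<Sum>w\<in>R. P s z (w - 2 * s * z)) + (\<Sum>w\<in>R. \<Sum>z\<in>R. Q s (z - 2 * s * w) w))"
    by (simp add: sum.distrib sum_distrib_left[symmetric] sum.swap[of "\<lambda>z w. Q _ (z - _ * w) w"] sum.swap[of "\<lambda>z w. Q _ (z - 2 * w) w"]
        sum.swap[of "\<lambda>z w. Q _ (z + 2 * w) w"] ring_distribs sum_divide_distrib[symmetric])
  also have "\<dots> = 73/10 * (\<Sum>s\<in>{1,-1}. (\<Sum>z\<in>R. \<Sum>w\<in>R. P s z w) + (\<Sum>w\<in>R. \<Sum>z\<in>R. Q s z w))"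
    by (simp only: P Q)
  also have "\<dots> = 73/10 * (\<Sum>z\<in>R. \<Sum>w\<in>R. \<Sum>s\<in>{1,-1}. P s z w + Q s z w)"
    by (simp add: sum.distrib ring_distribs) (subst (1 2) sum.swap, simp)
  also have "\<dots> \<le> 73/10 * (\<Sum>z\<in>R. \<Sum>w\<in>R. 73/10 * (cmod (ft z w))\<^sup>2)"
    by (intro mult_left_mono sum_mono PQ) auto
  also have "\<dots> = (73/10)\<^sup>2 * ((real q)\<^sup>2 * (\<Sum>x\<in>R. \<Sum>y\<in>R. (cmod (h x y))\<^sup>2))"
    unfolding parseval[symmetric] by (simp add: sum_distrib_left power2_eq_square mult.assoc)
  finally have "(real q)\<^sup>2 * (\<Sum>x\<in>R. \<Sum>y\<in>R. (cmod (gg x y))\<^sup>2) \<le> (real q)\<^sup>2 * ((73/10)\<^sup>2 * (\<Sum>x\<in>R. \<Sum>y\<in>R. (cmod (h x y))\<^sup>2))"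
    by (simp add: algebra_simps)
  thus ?thesis using q by (simp only: mult_le_cancel_left_pos zero_less_power of_nat_0_less_iff)
qed

end

section \<open>Norms and averages\<close>

definition l2 :: "'a set \<Rightarrow> ('a \<Rightarrow> complex) \<Rightarrow> real" where
  "l2 I x = L2_set (\<lambda>i. cmod (x i)) I"

lemma l2_nonneg [simp]: "0 \<le> l2 I x" by (simp add: l2_def)

lemma l2_sq: "(l2 I x)\<^sup>2 = (\<Sum>i\<in>I. (cmod (x i))\<^sup>2)"
  by (simp add: l2_def L2_set_def sum_nonneg)

lemma l2_cong: "(\<And>i. i \<in> I \<Longrightarrow> x i = y i) \<Longrightarrow> l2 I x = l2 I y"
  unfolding l2_def by (intro L2_set_cong) auto

lemma l2_add: "l2 I (\<lambda>i. x i + y i) \<le> l2 I x + l2 I y"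
proof -
  have "l2 I (\<lambda>i. x i + y i) \<le> L2_set (\<lambda>i. cmod (x i) + cmod (y i)) I"
    unfolding l2_def by (intro L2_set_mono norm_triangle_ineq) auto
  also have "\<dots> \<le> l2 I x + l2 I y" unfolding l2_def by (rule L2_set_triangle_ineq)
  finally show ?thesis .
qed

lemma l2_cmult: "l2 I (\<lambda>i. c * x i) = cmod c * l2 I x"
  by (simp add: l2_def norm_mult L2_set_right_distrib)

lemma l2_zero [simp]: "l2 I (\<lambda>i. 0) = 0"
  by (simp add: l2_def L2_set_def)

lemma l2_sum: "l2 I (\<lambda>i. \<Sum>k\<in>K. f k i) \<le> (\<Sum>k\<in>K. l2 I (f k))"
proof (induction K rule: infinite_finite_induct)
  case (insert k K)
  have "l2 I (\<lambda>i. \<Sum>k\<in>insert k K. f k i) = l2 I (\<lambda>i. f k i + (\<Sum>k\<in>K. f k i))"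
    using insert by simp
  also have "\<dots> \<le> l2 I (f k) + l2 I (\<lambda>i. \<Sum>k\<in>K. f k i)" by (rule l2_add)
  finally show ?case using insert by simp
qed simp_all

lemma l2_bij: assumes "bij_betw \<pi> I I" shows "l2 I (\<lambda>i. x (\<pi> i)) = l2 I x"
proof -
  have "(\<Sum>i\<in>I. (cmod (x (\<pi> i)))\<^sup>2) = (\<Sum>i\<in>I. (cmod (x i))\<^sup>2)"
    by (rule sum.reindex_bij_betw[OF assms])
  thus ?thesis by (simp add: l2_def L2_set_def)
qed

lemma l2_leI: "(l2 I x)\<^sup>2 \<le> (c * l2 J y)\<^sup>2 \<Longrightarrow> 0 \<le> c \<Longrightarrow> l2 I x \<le> c * l2 J y"
  by (rule power2_le_imp_le) auto

lemma sum_sqrt_card: "cmod (\<Sum>i\<in>I. x i) \<le> sqrt (card I) * l2 I x"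
proof -
  have "cmod (\<Sum>i\<in>I. x i) \<le> (\<Sum>i\<in>I. \<bar>1\<bar> * \<bar>cmod (x i)\<bar>)" by (simp add: norm_sum)
  also have "\<dots> \<le> L2_set (\<lambda>_. 1) I * L2_set (\<lambda>i. cmod (x i)) I" by (rule L2_set_mult_ineq)
  also have "\<dots> = sqrt (card I) * l2 I x" by (simp add: L2_set_constant l2_def)
  finally show ?thesis .
qed

definition mean :: "'a set \<Rightarrow> ('a \<Rightarrow> complex) \<Rightarrow> complex" where
  "mean I x = (\<Sum>i\<in>I. x i) / of_nat (card I)"

lemma l2_mean_decomp:
  assumes "finite I"
  shows "(l2 I x)\<^sup>2 = real (card I) * (cmod (mean I x))\<^sup>2 + (l2 I (\<lambda>i. x i - mean I x))\<^sup>2"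
proof (cases "I = {}")
  case False
  hence c: "of_nat (card I) \<noteq> (0::complex)" using assms by simp
  define \<mu> where "\<mu> = mean I x"
  have s0: "(\<Sum>i\<in>I. x i - \<mu>) = 0" using c by (simp add: sum_subtractf \<mu>_def mean_def)
  have "complex_of_real (\<Sum>i\<in>I. (cmod (x i))\<^sup>2) = (\<Sum>i\<in>I. (\<mu> + (x i - \<mu>)) * cnj (\<mu> + (x i - \<mu>)))"
    by (simp only: of_real_sum complex_norm_square) simp
  also have "\<dots> = (\<Sum>i\<in>I. \<mu> * cnj \<mu> + \<mu> * cnj (x i - \<mu>) + cnj \<mu> * (x i - \<mu>) + (x i - \<mu>) * cnj (x i - \<mu>))"
    by (intro sum.cong refl) (simp add: algebra_simps)
  also have "\<dots> = of_nat (card I) * (\<mu> * cnj \<mu>) + \<mu> * cnj (\<Sum>i\<in>I. x i - \<mu>) + cnj \<mu> * (\<Sum>i\<in>I. x i - \<mu>) + (\<Sum>i\<in>I. (x i - \<mu>) * cnj (x i - \<mu>))"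
    by (simp only: sum.distrib sum_distrib_left sum_constant cnj_sum)
  also have "\<dots> = of_real (real (card I) * (cmod \<mu>)\<^sup>2 + (\<Sum>i\<in>I. (cmod (x i - \<mu>))\<^sup>2))"
    by (simp only: s0 of_real_add of_real_mult of_real_sum complex_norm_square of_real_of_nat_eq) simp
  finally show ?thesis unfolding l2_sq \<mu>_def by (metis of_real_eq_iff)
qed (simp add: l2_def)

text \<open>The vertex \<open>(x, y)\<close> is encoded as \<open>x + q * y\<close>. The bits of the label mod 8 select the coordinate that moves,
  the sign (\<open>q - 1\<close> represents \<open>-1\<close>), and the offset.\<close>

definition move :: "nat \<Rightarrow> nat \<Rightarrow> nat \<Rightarrow> nat" where
  "move q a v = (let x = v mod q; y = v div q; j = a mod 8; c = (if (j div 2) mod 2 = 0 then 1 else q - 1); e = j mod 2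
     in if j < 4 then (x + c * (2 * y + e)) mod q + q * y else x + q * ((y + c * (2 * x + e)) mod q))"

section \<open>The expander as permutations of an initial segment of the naturals\<close>

lemma grid_less: "x < q \<Longrightarrow> y < q \<Longrightarrow> x + q * y < q * (q::nat)"
proof -
  assume "x < q" "y < q"
  hence "x + q * y < q + q * y" "q * Suc y \<le> q * q" by (simp, intro mult_le_mono2) simp
  thus ?thesis by simp
qed

lemma grid_sum:
  fixes f :: "nat \<Rightarrow> 'a :: comm_monoid_add"
  assumes "q > 0"
  shows "(\<Sum>v<q*q. f v) = (\<Sum>x<q. \<Sum>y<q. f (x + q * y))"
proof -
  have "(\<Sum>v<q*q. f v) = (\<Sum>p\<in>{..<q}\<times>{..<q}. f (fst p + q * snd p))"
    by (rule sum.reindex_bij_witness[of _ "\<lambda>p. fst p + q * snd p" "\<lambda>v. (v mod q, v div q)"])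
       (use assms in \<open>auto simp: less_mult_imp_div_less add.commute intro: grid_less\<close>)
  thus ?thesis by (simp add: sum.cartesian_product case_prod_beta)
qed

lemma move_xy:
  assumes "q > 0" "x < q" "y < q"
  shows "move q a (x + q * y) = (let j = a mod 8; c = (if (j div 2) mod 2 = 0 then 1 else q - 1); e = j mod 2
     in if j < 4 then (x + c * (2 * y + e)) mod q + q * y else x + q * ((y + c * (2 * x + e)) mod q))"
  using assms by (simp add: move_def)

lemma move_less: assumes "q > 0" "v < q * q" shows "move q a v < q * q"
  using assms by (auto simp: move_def Let_def less_mult_imp_div_less intro!: grid_less)

lemma move_mod8: "move q (a mod 8) = move q a"
  by (simp add: move_def fun_eq_iff)

lemma mod_add_left_cancel_nat: "(u + w) mod q = (v + w) mod (q::nat) \<Longrightarrow> u < q \<Longrightarrow> v < q \<Longrightarrow> u = v"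
proof -
  assume a: "(u + w) mod q = (v + w) mod q" "u < q" "v < q"
  hence "[u + w = v + w] (mod q)" by (simp add: cong_def)
  hence "[u = v] (mod q)" by (simp add: cong_add_rcancel_nat)
  thus "u = v" using a by (simp add: cong_def)
qed

lemma move_bij: assumes q: "q > 0" shows "bij_betw (move q a) {..<q*q} {..<q*q}"
proof -
  have inj: "inj_on (move q a) {..<q*q}"
  proof (rule inj_onI)
    fix v w assume vw: "v \<in> {..<q*q}" "w \<in> {..<q*q}" "move q a v = move q a w"
    define x y x' y' where xy: "x = v mod q" "y = v div q" "x' = w mod q" "y' = w div q"
    have lt: "x < q" "y < q" "x' < q" "y' < q" using vw q by (auto simp: xy less_mult_imp_div_less)
    have v: "v = x + q * y" "w = x' + q * y'" by (auto simp: xy)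
    define c where "c = (if ((a mod 8) div 2) mod 2 = 0 then 1 else q - 1)"
    define e where "e = (a mod 8) mod 2"
    have split: "u = u' \<and> z = z'" if "u + q * z = u' + q * z'" "u < q" "u' < q" for u z u' z' :: nat
      using that by (metis add.commute div_mult_self4 div_less add.left_neutral mod_less mod_mult_self2 less_zeroE)
    have "x = x' \<and> y = y'"
    proof (cases "a mod 8 < 4")
      case True
      have "(x + c * (2 * y + e)) mod q + q * y = (x' + c * (2 * y' + e)) mod q + q * y'"
        using vw(3) unfolding v move_xy[OF q lt(1,2)] move_xy[OF q lt(3,4)] by (simp only: Let_def c_def e_def True if_True)
      from split[OF this] have "y = y'" "(x + c * (2 * y + e)) mod q = (x' + c * (2 * y' + e)) mod q" using q by auto
      thus ?thesis using lt mod_add_left_cancel_nat by blast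
    next
      case False
      have "x + q * ((y + c * (2 * x + e)) mod q) = x' + q * ((y' + c * (2 * x' + e)) mod q)"
        using vw(3) unfolding v move_xy[OF q lt(1,2)] move_xy[OF q lt(3,4)] by (simp only: Let_def c_def e_def False if_False)
      from split[OF this] have "x = x'" "(y + c * (2 * x + e)) mod q = (y' + c * (2 * x' + e)) mod q" using lt by auto
      thus ?thesis using lt mod_add_left_cancel_nat by blast
    qed
    thus "v = w" using v by simp
  qed
  moreover have "move q a ` {..<q*q} = {..<q*q}"
    by (rule endo_inj_surj) (use inj move_less[OF q] in auto)
  ultimately show ?thesis by (simp add: bij_betw_def)
qed

text \<open>Transport of \<open>gg_contract\<close> along the encoding: \<open>H\<close> is the
  periodic extension of \<open>h\<close>, and the eight labels enumerate the summands of
  \<open>gg\<close>.\<close>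

lemma move8_contract:
  assumes q: "q > 0" and s0: "(\<Sum>v<q*q. h v) = 0"
  shows "l2 {..<q*q} (\<lambda>v. \<Sum>j<8. h (move q j v)) \<le> 73/10 * l2 {..<q*q} h"
proof -
  define H where "H x y = h (nat (x mod int q) + q * nat (y mod int q))" for x y :: int
  interpret grid q H by unfold_locales (use q in \<open>auto simp: H_def\<close>)
  have Hn: "H (int x) (int y) = h (x + q * y)" if "x < q" "y < q" for x y
    using that by (simp add: H_def nat_mod_distrib)
  have Hm: "H (int x) (int y) = h (x mod q + q * (y mod q))" for x y
    by (simp add: H_def nat_mod_as_int zmod_int)
  have neg: "H (int x - int u) (int y) = h ((x + (q-1) * u) mod q + q * (y mod q))"
           "H (int y) (int x - int u) = h (y mod q + q * ((x + (q-1) * u) mod q))" for x y u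
  proof -
    have "int x - int u + int q * int u = int (x + (q-1) * u)"
      using q by (cases q) (simp_all add: algebra_simps)
    hence "(int x - int u) mod int q = int (x + (q-1) * u) mod int q"
      by (metis mod_mult_self2)
    thus "H (int x - int u) (int y) = h ((x + (q-1) * u) mod q + q * (y mod q))"
         "H (int y) (int x - int u) = h (y mod q + q * ((x + (q-1) * u) mod q))"
      using Hm[of "x + (q-1) * u" y] Hm[of y "x + (q-1) * u"] by (metis perx, metis pery)
  qed
  have gg: "gg (int x) (int y) = (\<Sum>j<8. h (move q j (x + q * y)))" if "x < q" "y < q" for x y
  proof -
    have e: "{..<8::nat} = {0,1,2,3,4,5,6,7}" by auto
    have "int x + 1 * (2 * int y + 0) = int (x + 2 * y)" "int x + 1 * (2 * int y + 1) = int (x + (2 * y + 1))"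
      "int y + 1 * (2 * int x + 0) = int (y + 2 * x)" "int y + 1 * (2 * int x + 1) = int (y + (2 * x + 1))"
      "int x + -1 * (2 * int y + 0) = int x - int (2 * y)" "int x + -1 * (2 * int y + 1) = int x - int (2 * y + 1)"
      "int y + -1 * (2 * int x + 0) = int y - int (2 * x)" "int y + -1 * (2 * int x + 1) = int y - int (2 * x + 1)"
      by simp_all
    note arith = this
    have "gg (int x) (int y) = H (int (x + 2 * y)) (int y) + H (int x) (int (y + 2 * x))
       + (H (int (x + (2 * y + 1))) (int y) + H (int x) (int (y + (2 * x + 1))))
       + ((H (int x - int (2 * y)) (int y) + H (int x) (int y - int (2 * x)))
       + (H (int x - int (2 * y + 1)) (int y) + H (int x) (int y - int (2 * x + 1))))"
      unfolding gg_def arith[symmetric] by simp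
    also have "\<dots> = (\<Sum>j<8. h (move q j (x + q * y)))"
      unfolding Hm neg using that by (simp add: e move_xy[OF q that] Let_def)
    finally show ?thesis .
  qed
  have S: "(\<Sum>x\<in>R. \<Sum>y\<in>R. f x y) = (\<Sum>x<q. \<Sum>y<q. f (int x) (int y))" for f :: "int \<Rightarrow> int \<Rightarrow> 'z::comm_monoid_add"
    by (simp only: sum_ints_nat)
  have "(\<Sum>x\<in>R. \<Sum>y\<in>R. H x y) = 0"
    unfolding S using s0 by (simp add: grid_sum[OF q] Hn)
  from gg_contract[OF this]
  have "(l2 {..<q*q} (\<lambda>v. \<Sum>j<8. h (move q j v)))\<^sup>2 \<le> (73/10)\<^sup>2 * (l2 {..<q*q} h)\<^sup>2"
    unfolding S l2_sq grid_sum[OF q] by (simp add: gg Hn)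
  hence "(l2 {..<q*q} (\<lambda>v. \<Sum>j<8. h (move q j v)))\<^sup>2 \<le> (73/10 * l2 {..<q*q} h)\<^sup>2"
    by (simp only: power_mult_distrib)
  thus ?thesis by (rule l2_leI) simp
qed

text \<open>Labels will range over a prime number of values, so residues mod 8 are not hit equally
  often. The at most 7 excess labels are permutations and contribute at most the norm of
  \<open>h\<close> each; relaxing \<open>73/80\<close> to \<open>19/20\<close> absorbs them.\<close>

lemma move_p_contract:
  assumes q: "q > 0" and p: "p \<ge> 200" and s0: "(\<Sum>v<q*q. h v) = 0"
  shows "l2 {..<q*q} (\<lambda>v. (\<Sum>a<p. h (move q a v)) / of_nat p) \<le> 19/20 * l2 {..<q*q} h"
proof -
  let ?I = "{..<q*q}"
  have mv: "move q (j + 8 * n) = move q j" for j n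
    using move_mod8[of q "j + 8 * n"] move_mod8[of q j] by simp
  have sum8: "(\<Sum>a<8 * n. h (move q a v)) = of_nat n * (\<Sum>j<8. h (move q j v))" for n v
  proof (induction n)
    case (Suc n)
    have "(\<Sum>a<8 * Suc n. h (move q a v)) = (\<Sum>a<8 * n. h (move q a v)) + (\<Sum>j<8. h (move q (j + 8 * n) v))"
      using sum.atLeastLessThan_concat[of 0 "8*n" "8*n+8" "\<lambda>a. h (move q a v)"] sum.shift_bounds_nat_ivl[of "\<lambda>a. h (move q a v)" 0 "8*n" 8]
      by (simp add: lessThan_atLeast0 add.commute)
    also have "\<dots> = (\<Sum>a<8 * n. h (move q a v)) + (\<Sum>j<8. h (move q j v))"
      by (simp only: mv)
    finally show ?case using Suc by (simp add: ring_distribs)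
  qed simp
  define n r where "n = p div 8" and "r = p mod 8"
  have pn: "p = r + 8 * n" by (simp add: n_def r_def)
  have "(\<Sum>a<p. h (move q a v)) = of_nat n * (\<Sum>j<8. h (move q j v)) + (\<Sum>j<r. h (move q j v))" for v
  proof -
    have "(\<Sum>a<p. h (move q a v)) = (\<Sum>a<8*n. h (move q a v)) + (\<Sum>j<r. h (move q (j + 8 * n) v))"
      using sum.atLeastLessThan_concat[of 0 "8*n" "8*n+r" "\<lambda>a. h (move q a v)"] sum.shift_bounds_nat_ivl[of "\<lambda>a. h (move q a v)" 0 "8*n" r]
      unfolding pn by (simp add: lessThan_atLeast0 add.commute)
    thus ?thesis by (simp only: mv sum8)
  qed
  hence "l2 ?I (\<lambda>v. \<Sum>a<p. h (move q a v)) = l2 ?I (\<lambda>v. of_nat n * (\<Sum>j<8. h (move q j v)) + (\<Sum>j<r. h (move q j v)))"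
    by simp
  also have "\<dots> \<le> real n * l2 ?I (\<lambda>v. \<Sum>j<8. h (move q j v)) + (\<Sum>j<r. l2 ?I (\<lambda>v. h (move q j v)))"
    using l2_add[of ?I "\<lambda>v. of_nat n * (\<Sum>j<8. h (move q j v))" "\<lambda>v. \<Sum>j<r. h (move q j v)"]
      l2_sum[of ?I "\<lambda>j v. h (move q j v)" "{..<r}"]
    by (simp add: l2_cmult)
  also have "\<dots> \<le> real n * (73/10 * l2 ?I h) + (\<Sum>j<r. l2 ?I h)"
    by (intro add_mono mult_left_mono move8_contract[OF q s0] sum_mono) (simp_all add: l2_bij[OF move_bij[OF q]])
  also have "\<dots> = (73/10 * real n + real r) * l2 ?I h" by (simp add: algebra_simps)
  also have "\<dots> \<le> (19/20 * real p) * l2 ?I h"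
  proof (rule mult_right_mono)
    have "r < 8" by (simp add: r_def)
    hence "real r \<le> 7" by simp
    moreover have "real p = real r + 8 * real n" using pn by simp
    moreover have "real p \<ge> 200" using p by simp
    ultimately show "73/10 * real n + real r \<le> 19/20 * real p" by linarith
  qed simp
  finally have "l2 ?I (\<lambda>v. \<Sum>a<p. h (move q a v)) \<le> 19/20 * real p * l2 ?I h" .
  moreover have "l2 ?I (\<lambda>v. (\<Sum>a<p. h (move q a v)) / of_nat p) = 1 / real p * l2 ?I (\<lambda>v. \<Sum>a<p. h (move q a v))"
    using l2_cmult[of ?I "1 / of_nat p" "\<lambda>v. \<Sum>a<p. h (move q a v)"] by (simp add: norm_divide)
  ultimately have "l2 ?I (\<lambda>v. (\<Sum>a<p. h (move q a v)) / of_nat p) \<le> 1 / real p * (19/20 * real p * l2 ?I h)"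
    by (simp only:) (rule mult_left_mono, simp_all)
  thus ?thesis using p by simp
qed

section \<open>The inner Cayley graph\<close>

text \<open>Lagrange's bound by synthetic division over the integers: dividing out a root modulo
  \<open>p\<close> leaves a quotient that still has a coefficient not divisible by \<open>p\<close>,
  since otherwise \<open>p\<close> would divide every coefficient of \<open>f\<close>.\<close>

lemma poly_roots_mod_prime:
  fixes f :: "int poly"
  assumes p: "prime p" and nz: "\<not> (\<forall>i. int p dvd coeff f i)"
  shows "card {x. x < p \<and> int p dvd poly f (int x)} \<le> degree f"
  using nz
proof (induction "degree f" arbitrary: f)
  case 0
  then obtain c where f: "f = [:c:]" by (metis degree_0_id)
  have "\<not> int p dvd c" using 0(2) unfolding f
    by (metis coeff_pCons_0 coeff_pCons_Suc coeff_0 dvd_0_right old.nat.exhaust)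
  thus ?case by (simp add: f)
next
  case (Suc n)
  show ?case
  proof (cases "{x. x < p \<and> int p dvd poly f (int x)} = {}")
    case False
    then obtain a where a: "a < p" "int p dvd poly f (int a)" by auto
    define g where "g = synthetic_div f (int a)"
    have fg: "f = [:- int a, 1:] * g + [:poly f (int a):]" by (simp only: g_def synthetic_div_correct')
    have dg: "degree g = n" using Suc(2) by (simp add: g_def degree_synthetic_div)
    have "\<not> (\<forall>i. int p dvd coeff g i)"
    proof
      assume all: "\<forall>i. int p dvd coeff g i"
      have "int p dvd coeff f i" for i
      proof -
        have "coeff f i = - int a * coeff g i + (case i of 0 \<Rightarrow> 0 | Suc j \<Rightarrow> coeff g j) + (case i of 0 \<Rightarrow> poly f (int a) | Suc j \<Rightarrow> 0)"
          by (subst fg) (simp add: coeff_pCons split: nat.splits)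
        moreover have "int p dvd (case i of 0 \<Rightarrow> 0 | Suc j \<Rightarrow> coeff g j)" "int p dvd (case i of 0 \<Rightarrow> poly f (int a) | Suc j \<Rightarrow> 0)"
          using all a by (auto split: nat.splits)
        ultimately show ?thesis using all by (metis dvd_add dvd_mult)
      qed
      thus False using Suc(3) by blast
    qed
    hence IH: "card {x. x < p \<and> int p dvd poly g (int x)} \<le> n" using Suc(1)[of g] dg by simp
    have "{x. x < p \<and> int p dvd poly f (int x)} \<subseteq> insert a {x. x < p \<and> int p dvd poly g (int x)}"
    proof
      fix x assume "x \<in> {x. x < p \<and> int p dvd poly f (int x)}"
      hence x: "x < p" "int p dvd poly f (int x)" by auto
      have "poly f (int x) = (int x - int a) * poly g (int x) + poly f (int a)" by (subst fg) (simp add: algebra_simps)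
      hence "int p dvd (int x - int a) * poly g (int x)" using x(2) a(2) by (metis dvd_add_left_iff)
      hence "int p dvd int x - int a \<or> int p dvd poly g (int x)" using p by (simp add: prime_dvd_mult_iff)
      moreover have "x = a" if "int p dvd int x - int a"
      proof -
        have "int x mod int p = int a mod int p" using that by (simp add: mod_eq_dvd_iff)
        thus ?thesis using x a by simp
      qed
      ultimately show "x \<in> insert a {x. x < p \<and> int p dvd poly g (int x)}" using x by auto
    qed
    hence "card {x. x < p \<and> int p dvd poly f (int x)} \<le> card (insert a {x. x < p \<and> int p dvd poly g (int x)})"
      by (intro card_mono) auto
    also have "\<dots> \<le> Suc n" using IH by (simp add: card_insert_if)
    finally show ?thesis using Suc(2) by simp
  qed (simp only: card.empty le0)
qed

lemma sum_roots_mod_prime: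
  assumes p: "prime p" and "i < m" "\<not> int p dvd c i"
  shows "card {x. x < p \<and> int p dvd (\<Sum>i<m. c i * int x ^ i)} \<le> m"
proof -
  define f where "f = (\<Sum>i<m. monom (c i) i)"
  have cf: "coeff f j = (if j < m then c j else 0)" for j
    by (simp add: f_def coeff_sum)
  have "degree f \<le> m" by (rule degree_le) (simp add: cf)
  moreover have "poly f x = (\<Sum>i<m. c i * x ^ i)" for x by (simp add: f_def poly_sum poly_monom)
  moreover have "\<not> (\<forall>i. int p dvd coeff f i)" using assms cf by metis
  ultimately show ?thesis using poly_roots_mod_prime[OF p, of f] by simp
qed

section \<open>Shifts of vectors modulo a prime and their characters\<close>

definition grp :: "nat \<Rightarrow> nat \<Rightarrow> (nat \<Rightarrow> nat) set" where
  "grp p m = PiE {..<m} (\<lambda>_. {..<p})"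

definition shift :: "nat \<Rightarrow> nat \<Rightarrow> nat \<Rightarrow> nat \<Rightarrow> (nat \<Rightarrow> nat) \<Rightarrow> (nat \<Rightarrow> nat)" where
  "shift p m c x y = (\<lambda>i\<in>{..<m}. (y i + c * x ^ i) mod p)"

lemma finite_grp [simp]: "finite (grp p m)" by (simp add: grp_def finite_PiE)

lemma card_grp [simp]: "card (grp p m) = p ^ m" by (simp add: grp_def card_PiE)

lemma shift_in: "p > 0 \<Longrightarrow> shift p m c x y \<in> grp p m" by (auto simp: shift_def grp_def)

lemma shift_bij: assumes "p > 0" shows "bij_betw (shift p m c x) (grp p m) (grp p m)"
proof -
  have inj: "inj_on (shift p m c x) (grp p m)"
  proof (rule inj_onI)
    fix y z assume yz: "y \<in> grp p m" "z \<in> grp p m" "shift p m c x y = shift p m c x z"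
    show "y = z"
    proof (rule PiE_ext[OF yz(1,2)[unfolded grp_def]])
      fix i assume i: "i \<in> {..<m}"
      have "(y i + c * x ^ i) mod p = (z i + c * x ^ i) mod p"
        using fun_cong[OF yz(3), of i] i by (simp add: shift_def)
      moreover have "y i < p" "z i < p" using yz i by (auto simp: grp_def PiE_def Pi_def)
      ultimately show "y i = z i" by (rule mod_add_left_cancel_nat)
    qed
  qed
  moreover have "shift p m c x ` grp p m = grp p m"
    by (rule endo_inj_surj) (use inj shift_in[OF assms] in auto)
  ultimately show ?thesis by (simp add: bij_betw_def)
qed

definition chr :: "nat \<Rightarrow> nat \<Rightarrow> (nat \<Rightarrow> nat) \<Rightarrow> (nat \<Rightarrow> nat) \<Rightarrow> complex" where
  "chr p m g y = ew p (\<Sum>i<m. int (g i) * int (y i))"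

lemma ew_sum: "ew n (\<Sum>i\<in>I. f i) = (\<Prod>i\<in>I. ew n (f i))"
  by (induction I rule: infinite_finite_induct) (simp_all add: ew_add)

lemma chr_orth:
  assumes p: "p > 0" and y: "y \<in> grp p m" "z \<in> grp p m"
  shows "(\<Sum>g\<in>grp p m. chr p m g y * cnj (chr p m g z)) = (if y = z then of_real (real p ^ m) else 0)"
proof -
  have "(\<Sum>g\<in>grp p m. chr p m g y * cnj (chr p m g z)) = (\<Sum>g\<in>grp p m. \<Prod>i<m. ew p (int (g i) * (int (y i) - int (z i))))"
    unfolding ew_sum[symmetric]
  proof (intro sum.cong refl)
    fix g
    have "(\<Sum>i<m. int (g i) * (int (y i) - int (z i))) = (\<Sum>i<m. int (g i) * int (y i)) + - (\<Sum>i<m. int (g i) * int (z i))"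
      by (simp add: right_diff_distrib sum_subtractf)
    thus "chr p m g y * cnj (chr p m g z) = ew p (\<Sum>i<m. int (g i) * (int (y i) - int (z i)))"
      by (simp only: chr_def cnj_ew ew_add)
  qed
  also have "\<dots> = (\<Prod>i<m. \<Sum>a<p. ew p (int a * (int (y i) - int (z i))))"
    unfolding grp_def by (rule prod_sum_PiE[symmetric]) auto
  also have "\<dots> = (\<Prod>i<m. if y i = z i then of_nat p else 0)"
  proof (intro prod.cong refl)
    fix i assume "i \<in> {..<m}"
    hence "y i < p" "z i < p" using y by (auto simp: grp_def PiE_def Pi_def)
    hence "int (y i) mod int p = int (y i)" "int (z i) mod int p = int (z i)" by simp_all
    hence "int (y i) mod int p = int (z i) mod int p \<longleftrightarrow> y i = z i" by (simp only: of_nat_eq_iff)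
    hence "int p dvd int (y i) - int (z i) \<longleftrightarrow> y i = z i" by (simp only: mod_eq_dvd_iff)
    thus "(\<Sum>a<p. ew p (int a * (int (y i) - int (z i)))) = (if y i = z i then of_nat p else 0)"
      by (simp only: sum_ew[OF p])
  qed
  also have "\<dots> = (if y = z then of_real (real p ^ m) else 0)"
  proof (cases "y = z")
    case False
    then obtain i where "i < m" "y i \<noteq> z i" using PiE_ext[OF y[unfolded grp_def]] by blast
    hence "(\<Prod>i<m. if y i = z i then of_nat p else 0::complex) = 0" by (intro prod_zero) auto
    thus ?thesis using False by simp
  qed simp
  finally show ?thesis .
qed

lemma chr_shift:
  assumes p: "p > 0"
  shows "chr p m g (shift p m c x y) = chr p m g y * ew p (int c * (\<Sum>i<m. int (g i) * int x ^ i))"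
proof -
  have "(\<Sum>i<m. int (g i) * int (shift p m c x y i)) mod int p = (\<Sum>i<m. int (g i) * int (y i + c * x ^ i)) mod int p"
  proof -
    have "(int (g i) * int (shift p m c x y i)) mod int p = (int (g i) * int (y i + c * x ^ i)) mod int p" if "i < m" for i
      using that by (simp only: shift_def restrict_apply lessThan_iff if_True zmod_int mod_mult_right_eq)
    hence "(\<Sum>i<m. (int (g i) * int (shift p m c x y i)) mod int p) = (\<Sum>i<m. (int (g i) * int (y i + c * x ^ i)) mod int p)"
      by (intro sum.cong refl) simp
    thus ?thesis
      using mod_sum_eq[of "\<lambda>i. int (g i) * int (shift p m c x y i)" "int p" "{..<m}"]
        mod_sum_eq[of "\<lambda>i. int (g i) * int (y i + c * x ^ i)" "int p" "{..<m}"] by (simp only:)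
  qed
  hence "chr p m g (shift p m c x y) = ew p (\<Sum>i<m. int (g i) * int (y i + c * x ^ i))"
    unfolding chr_def by (rule ew_cong[OF p])
  also have "(\<Sum>i<m. int (g i) * int (y i + c * x ^ i)) = (\<Sum>i<m. int (g i) * int (y i)) + int c * (\<Sum>i<m. int (g i) * int x ^ i)"
    unfolding sum_distrib_left sum.distrib[symmetric] by (intro sum.cong refl) (simp add: algebra_simps)
  finally show ?thesis by (simp add: ew_add chr_def)
qed

definition avgY :: "nat \<Rightarrow> nat \<Rightarrow> ((nat \<Rightarrow> nat) \<Rightarrow> complex) \<Rightarrow> (nat \<Rightarrow> nat) \<Rightarrow> complex" where
  "avgY p m h y = (\<Sum>c<p. \<Sum>x<p. h (shift p m c x y)) / of_nat (p * p)"

lemma sum_avgY: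
  assumes p: "p > 0" shows "(\<Sum>y\<in>grp p m. avgY p m h y) = (\<Sum>y\<in>grp p m. h y)"
proof -
  have "(\<Sum>y\<in>grp p m. avgY p m h y) = (\<Sum>c<p. \<Sum>x<p. \<Sum>y\<in>grp p m. h (shift p m c x y)) / of_nat (p * p)"
    unfolding avgY_def sum_divide_distrib[symmetric]
    by (subst sum.swap, intro arg_cong2[where f = "(/)"] sum.cong refl sum.swap)
  also have "\<dots> = (\<Sum>y\<in>grp p m. h y)"
    using p by (simp add: sum.reindex_bij_betw[OF shift_bij[OF p]])
  finally show ?thesis .
qed

text \<open>The characters diagonalize the average. At a nonzero character \<open>g\<close> the sum
  over \<open>c\<close> keeps only those \<open>x\<close> that are roots of the polynomial with
  coefficients \<open>g\<close>, so the eigenvalue is the share of roots among the \<open>p\<close>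
  values of \<open>x\<close>. The shifts thus form a small-bias family.\<close>

lemma avgY_contract:
  assumes p: "prime p"
  shows "l2 (grp p m) (\<lambda>y. avgY p m h y - mean (grp p m) h) \<le> real m / real p * l2 (grp p m) h"
proof -
  have p0: "p > 0" using p prime_gt_0_nat by blast
  let ?G = "grp p m"
  define ft where "ft h g = (\<Sum>y\<in>?G. h y * chr p m g y)" for h :: "(nat \<Rightarrow> nat) \<Rightarrow> complex" and g
  have pars: "(\<Sum>g\<in>?G. (cmod (ft h g))\<^sup>2) = real p ^ m * (l2 ?G h)\<^sup>2" for h
    unfolding ft_def l2_sq by (rule parseval_kernel) (use chr_orth[OF p0] in auto)
  define zero where "zero = (\<lambda>i\<in>{..<m}. 0::nat)"
  have zin: "zero \<in> ?G" using p0 by (auto simp: zero_def grp_def)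
  have chr0: "chr p m zero y = 1" "chr p m g zero = 1" for y g by (simp_all add: chr_def zero_def)
  have bound: "cmod (ft (\<lambda>y. avgY p m h y - mean ?G h) g) \<le> real m / real p * cmod (ft h g)" if g: "g \<in> ?G" for g
  proof (cases "g = zero")
    case True
    have "ft (\<lambda>y. avgY p m h y - mean ?G h) g = 0"
      using p0 by (simp add: True ft_def chr0 sum_subtractf sum_avgY mean_def)
    thus ?thesis by simp
  next
    case False
    define r where "r x = (\<Sum>i<m. int (g i) * int x ^ i)" for x :: nat
    have orth0: "(\<Sum>y\<in>?G. chr p m g y) = 0"
    proof -
      have sym: "chr p m a b = chr p m b a" for a b by (simp add: chr_def mult.commute)
      have "(\<Sum>a\<in>?G. chr p m a g) = 0" using chr_orth[OF p0 g zin] False by (simp add: chr0)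
      thus ?thesis by (simp only: sym[of g])
    qed
    have sh: "(\<Sum>y\<in>?G. h (shift p m c x y) * chr p m g y) = ew p (int c * - r x) * ft h g" for c x
    proof -
      have "(\<Sum>y\<in>?G. h (shift p m c x y) * chr p m g y)
          = (\<Sum>y\<in>?G. ew p (int c * - r x) * (h (shift p m c x y) * chr p m g (shift p m c x y)))"
        by (intro sum.cong refl) (simp add: chr_shift[OF p0] r_def[symmetric] ew_add[symmetric])
      also have "\<dots> = ew p (int c * - r x) * (\<Sum>y\<in>?G. h (shift p m c x y) * chr p m g (shift p m c x y))"
        by (simp add: sum_distrib_left)
      also have "(\<Sum>y\<in>?G. h (shift p m c x y) * chr p m g (shift p m c x y)) = ft h g"
        unfolding ft_def by (rule sum.reindex_bij_betw[OF shift_bij[OF p0]])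
      finally show ?thesis .
    qed
    have "ft (\<lambda>y. avgY p m h y - mean ?G h) g = ft (avgY p m h) g"
      using orth0 by (simp add: ft_def ring_distribs sum_subtractf sum_distrib_left[symmetric])
    also have "\<dots> = (\<Sum>y\<in>?G. \<Sum>c<p. \<Sum>x<p. h (shift p m c x y) * chr p m g y) / of_nat (p * p)"
      by (simp add: ft_def avgY_def sum_distrib_right sum_divide_distrib)
    also have "(\<Sum>y\<in>?G. \<Sum>c<p. \<Sum>x<p. h (shift p m c x y) * chr p m g y) = (\<Sum>c<p. \<Sum>x<p. \<Sum>y\<in>?G. h (shift p m c x y) * chr p m g y)"
      by (subst sum.swap, intro sum.cong refl sum.swap)
    also have "\<dots> = (\<Sum>x<p. \<Sum>c<p. ew p (int c * - r x)) * ft h g"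
      by (subst sum.swap) (simp add: sh sum_distrib_right)
    also have "(\<Sum>x<p. \<Sum>c<p. ew p (int c * - r x)) = (\<Sum>x<p. if int p dvd r x then of_nat p else 0)"
      by (subst sum_ew[OF p0]) simp
    also have "\<dots> = of_nat (p * card {x. x < p \<and> int p dvd r x})"
    proof -
      have "{x. x < p \<and> int p dvd r x} = {..<p} \<inter> {x. int p dvd r x}" by auto
      thus ?thesis by (simp add: sum.If_cases)
    qed
    finally have "cmod (ft (\<lambda>y. avgY p m h y - mean ?G h) g) = real (card {x. x < p \<and> int p dvd r x}) / real p * cmod (ft h g)"
      using p0 by (simp add: norm_mult norm_divide)
    also have "\<dots> \<le> real m / real p * cmod (ft h g)"
    proof (intro mult_right_mono divide_right_mono)
      obtain i where i: "i < m" "g i \<noteq> zero i" using False PiE_ext[OF g[unfolded grp_def] zin[unfolded grp_def]] by blast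
      moreover have "g i < p" using g i by (auto simp: grp_def PiE_def Pi_def)
      ultimately have "\<not> int p dvd int (g i)" by (auto simp: zero_def dest: dvd_imp_le)
      from sum_roots_mod_prime[OF p i(1), of "\<lambda>i. int (g i)"] this
      show "real (card {x. x < p \<and> int p dvd r x}) \<le> real m" by (simp add: r_def)
    qed auto
    finally show ?thesis .
  qed
  have "real p ^ m * (l2 ?G (\<lambda>y. avgY p m h y - mean ?G h))\<^sup>2 \<le> (\<Sum>g\<in>?G. (real m / real p * cmod (ft h g))\<^sup>2)"
    unfolding pars[symmetric] by (intro sum_mono power_mono bound) auto
  also have "\<dots> = real p ^ m * (real m / real p * l2 ?G h)\<^sup>2"
    unfolding power_mult_distrib sum_distrib_left[symmetric] pars by simp
  finally have "(l2 ?G (\<lambda>y. avgY p m h y - mean ?G h))\<^sup>2 \<le> (real m / real p * l2 ?G h)\<^sup>2"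
    using p0 by simp
  thus ?thesis by (rule l2_leI) simp
qed

section \<open>Operators of the wide walk\<close>

(* Otherwise sums of states are unfolded pointwise. *)
declare minus_apply [simp del] plus_fun_apply [simp del]

lemma l2_mono_sq: "(\<And>a. a \<in> A \<Longrightarrow> l2 B (f a) \<le> c * l2 D (g a)) \<Longrightarrow> (\<Sum>a\<in>A. (l2 B (f a))\<^sup>2) \<le> c\<^sup>2 * (\<Sum>a\<in>A. (l2 D (g a))\<^sup>2)"
  unfolding sum_distrib_left power_mult_distrib[symmetric] by (intro sum_mono power_mono) auto

lemma l2_mean_le:
  assumes "finite I" shows "real (card I) * (cmod (mean I x))\<^sup>2 \<le> (l2 I x)\<^sup>2"
  using l2_mean_decomp[OF assms, of x] by simp

lemma l2_const: "(l2 I (\<lambda>_. c))\<^sup>2 = real (card I) * (cmod c)\<^sup>2"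
  by (simp add: l2_sq)

lemma mean_add: "mean I (\<lambda>i. x i + y i) = mean I x + mean I y"
  by (simp add: mean_def sum.distrib add_divide_distrib)

lemma mean_const: "finite I \<Longrightarrow> I \<noteq> {} \<Longrightarrow> mean I (\<lambda>_. c) = c"
  by (simp add: mean_def)

text \<open>The numerical core of \<open>n2_AvFopAv\<close>. There \<open>a\<close> and
  \<open>d\<close> are the norms of the constant and the mean-zero part of the input,
  \<open>t\<close> is the norm of the constant part after the letters have acted, and
  \<open>Z\<close> is the total squared norm at that point. If \<open>d\<close> is a fair share of
  the input, the first average has already shrunk it; if not, the bias \<open>\<rho>\<close> forces
  mass out of the constant part, and the second average acts on it.\<close>

lemma gap_combine:
  fixes a d t Z \<rho> :: real
  assumes "0 \<le> a" "0 \<le> d" "0 \<le> \<rho>" "\<rho> < 1" "0 \<le> t" "t \<le> \<rho> * a + 19/20 * d" "t\<^sup>2 \<le> Z" "Z \<le> a\<^sup>2 + (19/20)\<^sup>2 * d\<^sup>2"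
  shows "t\<^sup>2 + (19/20)\<^sup>2 * (Z - t\<^sup>2) \<le> (1 - 39/800 * (1 - \<rho>)\<^sup>2) * (a\<^sup>2 + d\<^sup>2)"
proof -
  \<comment> \<open>The full gap is \<open>1 - (19/20)\<^sup>2 = 39/400\<close>. Half of it is given
    up, and the factor \<open>1 - \<rho>\<close> cancels the \<open>1 / (1 - \<rho>)\<close> from
    the AM-GM step in \<open>t2\<close>; the coefficient of \<open>d\<^sup>2\<close> then stays at
    \<open>761/800 = 1 - 39/800\<close>.\<close>
  define \<tau> where "\<tau> = 39/800 * (1 - \<rho>)"
  have \<tau>: "0 \<le> \<tau>" "\<tau> \<le> 39/400" using assms by (auto simp: \<tau>_def)
  have t2: "t\<^sup>2 \<le> \<rho> * a\<^sup>2 + ((19/20)\<^sup>2 + 1 / (1 - \<rho>)) * d\<^sup>2"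
  proof -
    define e where "e = 1 - \<rho>"
    have e: "e > 0" "\<rho> = 1 - e" using assms by (auto simp: e_def)
    have "t\<^sup>2 \<le> (\<rho> * a + 19/20 * d)\<^sup>2" using assms by (intro power_mono) auto
    also have "\<dots> = \<rho>\<^sup>2 * a\<^sup>2 + (19/20)\<^sup>2 * d\<^sup>2 + (19/20 * \<rho>) * (2 * a * d)" by (simp add: power2_eq_square algebra_simps)
    finally have 1: "t\<^sup>2 \<le> \<rho>\<^sup>2 * a\<^sup>2 + (19/20)\<^sup>2 * d\<^sup>2 + (19/20 * \<rho>) * (2 * a * d)" .
    have "(19/20 * \<rho>) * (2 * a * d) \<le> (19/20 * \<rho>) * (e * a\<^sup>2 + d\<^sup>2 / e)"
    proof (rule mult_left_mono)
      have "0 \<le> (e * a - d)\<^sup>2 / e" using e by simp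
      also have "(e * a - d)\<^sup>2 / e = e * a\<^sup>2 + d\<^sup>2 / e - 2 * a * d" using e by (simp add: power2_eq_square field_simps)
      finally show "2 * a * d \<le> e * a\<^sup>2 + d\<^sup>2 / e" by simp
    qed (use assms in simp)
    also have "\<dots> \<le> \<rho> * (e * a\<^sup>2) + 1 * (d\<^sup>2 / e)"
      unfolding distrib_left using assms(3,4) \<open>e > 0\<close>
      by (intro add_mono mult_right_mono) auto
    finally have 2: "(19/20 * \<rho>) * (2 * a * d) \<le> \<rho> * (e * a\<^sup>2) + 1 * (d\<^sup>2 / e)" .
    have "\<rho>\<^sup>2 * a\<^sup>2 + (19/20)\<^sup>2 * d\<^sup>2 + (\<rho> * (e * a\<^sup>2) + 1 * (d\<^sup>2 / e)) = \<rho> * a\<^sup>2 + ((19/20)\<^sup>2 + 1 / (1 - \<rho>)) * d\<^sup>2"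
      by (simp add: e_def power2_eq_square algebra_simps)
    with 1 2 show ?thesis by linarith
  qed
  have "t\<^sup>2 + (19/20)\<^sup>2 * (Z - t\<^sup>2) = Z - 39/400 * (Z - t\<^sup>2)" by (simp add: power2_eq_square field_simps)
  also have "\<dots> \<le> Z - \<tau> * (Z - t\<^sup>2)" using mult_right_mono[OF \<tau>(2), of "Z - t\<^sup>2"] assms by simp
  also have "\<dots> = (1 - \<tau>) * Z + \<tau> * t\<^sup>2" by (simp add: algebra_simps)
  also have "\<dots> \<le> (1 - \<tau>) * (a\<^sup>2 + (19/20)\<^sup>2 * d\<^sup>2) + \<tau> * (\<rho> * a\<^sup>2 + ((19/20)\<^sup>2 + 1 / (1 - \<rho>)) * d\<^sup>2)"
    using \<tau> assms t2 by (intro add_mono mult_left_mono) auto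
  also have "\<dots> = (1 - \<tau> * (1 - \<rho>)) * a\<^sup>2 + ((19/20)\<^sup>2 + \<tau> / (1 - \<rho>)) * d\<^sup>2" by (simp add: algebra_simps)
  also have "\<tau> / (1 - \<rho>) = 39/800"
    unfolding \<tau>_def using assms(4) by (subst nonzero_mult_div_cancel_right) auto
  also have "(1 - \<tau> * (1 - \<rho>)) * a\<^sup>2 + ((19/20)\<^sup>2 + 39/800) * d\<^sup>2 \<le> (1 - \<tau> * (1 - \<rho>)) * a\<^sup>2 + (1 - \<tau> * (1 - \<rho>)) * d\<^sup>2"
  proof (intro add_left_mono mult_right_mono)
    have "\<tau> * (1 - \<rho>) \<le> 39/800 * 1" unfolding \<tau>_def mult.assoc
      using assms by (intro mult_left_mono mult_le_one) auto
    thus "(19/20)\<^sup>2 + 39/800 \<le> 1 - \<tau> * (1 - \<rho>)" by (simp add: power2_eq_square)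
  qed simp
  also have "\<dots> = (1 - 39/800 * (1 - \<rho>)\<^sup>2) * (a\<^sup>2 + d\<^sup>2)"
  proof -
    have "\<tau> * (1 - \<rho>) = 39/800 * (1 - \<rho>)\<^sup>2" by (simp only: \<tau>_def power2_eq_square mult.assoc)
    thus ?thesis by (simp only: distrib_left)
  qed
  finally show ?thesis .
qed

type_synonym wstate = "nat \<Rightarrow> (nat \<Rightarrow> nat) \<Rightarrow> nat \<Rightarrow> complex"

text \<open>The letters enter through two inequalities for all vectors: each matrix is a
  contraction, and the plain average over the vertices has norm at most
  \<open>\<rho>\<close>.\<close>

locale opwalk =
  fixes q p m l :: nat and F :: "nat \<Rightarrow> nat \<Rightarrow> nat \<Rightarrow> complex" and \<rho> :: real
  assumes q: "q > 0" and p: "prime p" "p \<ge> 200" and \<rho>: "0 \<le> \<rho>" "\<rho> < 1"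
    and contr: "\<And>v x. v < q * q \<Longrightarrow> l2 {..<l} (\<lambda>i. \<Sum>j<l. F v i j * x j) \<le> l2 {..<l} x"
    and meanF: "\<And>x. l2 {..<l} (\<lambda>i. mean {..<q*q} (\<lambda>v. \<Sum>j<l. F v i j * x j)) \<le> \<rho> * l2 {..<l} x"
begin

abbreviation "V \<equiv> {..<q*q}"
abbreviation "G \<equiv> grp p m"
abbreviation "L \<equiv> {..<l}"

definition app :: "nat \<Rightarrow> (nat \<Rightarrow> complex) \<Rightarrow> nat \<Rightarrow> complex" where
  "app v x i = (\<Sum>j<l. F v i j * x j)"

lemma app_le: "v < q * q \<Longrightarrow> l2 L (app v x) \<le> l2 L x"
  unfolding app_def by (rule contr)

lemma app_add: "app v (\<lambda>j. x j + y j) i = app v x i + app v y i"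
  by (simp add: app_def ring_distribs sum.distrib)

lemma app_sum: "app v (\<lambda>j. \<Sum>k\<in>K. x k j) i = (\<Sum>k\<in>K. app v (x k) i)"
  unfolding app_def by (subst sum.swap) (simp add: sum_distrib_left)

lemma app_divide: "app v (\<lambda>j. x j / c) i = app v x i / c"
  by (simp add: app_def sum_divide_distrib)

lemma p0: "p > 0" using p by simp
lemma q2: "0 < real (q * q)" "V \<noteq> {}" using q by (auto simp: lessThan_empty_iff)
lemma G_ne: "G \<noteq> {}" using card_grp[of p m] p0 by (metis card.empty power_eq_0_iff neq0_conv)
lemma mv: "v < q * q \<Longrightarrow> move q a v < q * q" by (rule move_less[OF q])

section \<open>The outer walk with independent labels\<close>

definition n2 :: "(nat \<Rightarrow> nat \<Rightarrow> complex) \<Rightarrow> real" where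
  "n2 h = sqrt (\<Sum>v\<in>V. (l2 L (h v))\<^sup>2)"

lemma n2_sq: "(n2 h)\<^sup>2 = (\<Sum>v\<in>V. (l2 L (h v))\<^sup>2)" by (simp add: n2_def sum_nonneg)
lemma n2_nonneg [simp]: "0 \<le> n2 h" by (simp add: n2_def sum_nonneg)

lemma n2_sq': "(n2 h)\<^sup>2 = (\<Sum>i\<in>L. (l2 V (\<lambda>v. h v i))\<^sup>2)"
  by (simp add: n2_sq l2_sq) (rule sum.swap)

definition mu :: "(nat \<Rightarrow> nat \<Rightarrow> complex) \<Rightarrow> nat \<Rightarrow> complex" where
  "mu h i = mean V (\<lambda>v. h v i)"

lemma n2_decomp: "(n2 h)\<^sup>2 = real (q*q) * (l2 L (mu h))\<^sup>2 + (n2 (\<lambda>v i. h v i - mu h i))\<^sup>2"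
proof -
  have "(l2 V (\<lambda>v. h v i))\<^sup>2 = real (q*q) * (cmod (mu h i))\<^sup>2 + (l2 V (\<lambda>v. h v i - mu h i))\<^sup>2" for i
    using l2_mean_decomp[of V "\<lambda>v. h v i"] by (simp add: mu_def)
  thus ?thesis by (simp add: n2_sq' sum.distrib l2_sq[of L] sum_distrib_left)
qed

definition Av :: "(nat \<Rightarrow> nat \<Rightarrow> complex) \<Rightarrow> nat \<Rightarrow> nat \<Rightarrow> complex" where
  "Av h v i = (\<Sum>a<p. h (move q a v) i) / of_nat p"

definition Fop :: "(nat \<Rightarrow> nat \<Rightarrow> complex) \<Rightarrow> nat \<Rightarrow> nat \<Rightarrow> complex" where
  "Fop h v = app v (h v)"

lemma n2_Fop: "n2 (Fop h) \<le> n2 h"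
proof (rule power2_le_imp_le)
  show "(n2 (Fop h))\<^sup>2 \<le> (n2 h)\<^sup>2"
    unfolding n2_sq Fop_def by (intro sum_mono power_mono app_le) auto
qed simp

lemma mu_Av: "mu (Av h) = mu h"
proof
  fix i
  have "(\<Sum>v\<in>V. Av h v i) = (\<Sum>a<p. \<Sum>v\<in>V. h (move q a v) i) / of_nat p"
    unfolding Av_def sum_divide_distrib[symmetric] by (subst sum.swap) simp
  also have "\<dots> = (\<Sum>v\<in>V. h v i)"
    using p0 by (simp add: sum.reindex_bij_betw[OF move_bij[OF q], of "\<lambda>v. h v i"])
  finally show "mu (Av h) i = mu h i" by (simp add: mu_def mean_def)
qed

lemma Av_diff: "Av (\<lambda>v i. h v i - c i) v i = Av h v i - c i"
  using p0 by (simp add: Av_def sum_subtractf diff_divide_distrib)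

lemma n2_Av0: "n2 (Av (\<lambda>v i. h v i - mu h i)) \<le> 19/20 * n2 (\<lambda>v i. h v i - mu h i)"
proof (rule power2_le_imp_le)
  have "l2 V (\<lambda>v. Av (\<lambda>v i. h v i - mu h i) v i) \<le> 19/20 * l2 V (\<lambda>v. h v i - mu h i)" for i
  proof -
    have "(\<Sum>v\<in>V. h v i - mu h i) = 0"
      using q2 by (simp add: mu_def mean_def sum_subtractf)
    from move_p_contract[OF q p(2) this] show ?thesis by (simp add: Av_def)
  qed
  from l2_mono_sq[of L, OF this]
  show "(n2 (Av (\<lambda>v i. h v i - mu h i)))\<^sup>2 \<le> (19/20 * n2 (\<lambda>v i. h v i - mu h i))\<^sup>2"
    by (simp only: n2_sq' power_mult_distrib)
qed simp

lemma n2_Av_sq: "(n2 (Av h))\<^sup>2 \<le> real (q*q) * (l2 L (mu h))\<^sup>2 + (19/20)\<^sup>2 * (n2 (\<lambda>v i. h v i - mu h i))\<^sup>2"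
proof -
  have "(\<lambda>v i. Av h v i - mu (Av h) i) = Av (\<lambda>v i. h v i - mu h i)"
    by (simp add: fun_eq_iff Av_diff mu_Av)
  hence "(n2 (Av h))\<^sup>2 = real (q*q) * (l2 L (mu h))\<^sup>2 + (n2 (Av (\<lambda>v i. h v i - mu h i)))\<^sup>2"
    using n2_decomp[of "Av h"] by (simp add: mu_Av)
  also have "(n2 (Av (\<lambda>v i. h v i - mu h i)))\<^sup>2 \<le> (19/20 * n2 (\<lambda>v i. h v i - mu h i))\<^sup>2"
    by (intro power_mono n2_Av0) simp
  finally show ?thesis by (simp only: power_mult_distrib)
qed

lemma l2_mu_le: "sqrt (real (q*q)) * l2 L (mu h) \<le> n2 h"
proof (rule power2_le_imp_le)
  show "(sqrt (real (q*q)) * l2 L (mu h))\<^sup>2 \<le> (n2 h)\<^sup>2"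
    unfolding n2_decomp[of h] power_mult_distrib by (simp del: of_nat_mult)
qed simp

definition kap :: real where "kap = sqrt (1 - 39/800 * (1 - \<rho>)\<^sup>2)"

lemma kap: "0 \<le> kap" "kap\<^sup>2 = 1 - 39/800 * (1 - \<rho>)\<^sup>2"
proof -
  have "(1 - \<rho>)\<^sup>2 \<le> 1\<^sup>2" using \<rho> by (intro power_mono) auto
  thus "0 \<le> kap" "kap\<^sup>2 = 1 - 39/800 * (1 - \<rho>)\<^sup>2" by (simp_all add: kap_def)
qed

text \<open>The averaged input is a constant part plus a mean-zero part \<open>r\<close>. The
  letters scale the mean of the constant part by at most \<open>\<rho>\<close>, while
  \<open>r\<close>, already shrunk by \<open>19/20\<close>, can add at most its norm to the mean.
  These are the hypotheses of \<open>gap_combine\<close>.\<close>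

lemma n2_AvFopAv: "n2 (Av (Fop (Av h))) \<le> kap * n2 h"
proof (rule power2_le_imp_le)
  define N where "N = sqrt (real (q*q))"
  have N2: "real (q*q) = N\<^sup>2" by (simp add: N_def del: of_nat_mult)
  define w where "w = Av h"
  define r where "r v i = w v i - mu h i" for v i
  define d where "d = n2 (\<lambda>v i. h v i - mu h i)"
  define a where "a = N * l2 L (mu h)"
  define z where "z = Fop w"
  have r: "r = Av (\<lambda>v i. h v i - mu h i)" by (simp add: fun_eq_iff r_def w_def Av_diff)
  have nr: "n2 r \<le> 19/20 * d" unfolding r d_def by (rule n2_Av0)
  have nz: "(n2 z)\<^sup>2 \<le> a\<^sup>2 + (19/20)\<^sup>2 * d\<^sup>2"
  proof -
    have "(n2 z)\<^sup>2 \<le> (n2 w)\<^sup>2" unfolding z_def by (intro power_mono n2_Fop) simp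
    also have "\<dots> \<le> a\<^sup>2 + (19/20)\<^sup>2 * d\<^sup>2"
      unfolding w_def a_def d_def power_mult_distrib N2[symmetric] by (rule n2_Av_sq)
    finally show ?thesis .
  qed
  have muz: "mu z i = mean V (\<lambda>v. \<Sum>j<l. F v i j * mu h j) + mu (Fop r) i" for i
  proof -
    have "z v i = app v (mu h) i + Fop r v i" for v
      using app_add[of v "mu h" "r v" i] by (simp add: z_def Fop_def r_def)
    thus ?thesis by (simp add: mu_def mean_add app_def)
  qed
  have t: "N * l2 L (mu z) \<le> \<rho> * a + 19/20 * d"
  proof -
    have "l2 L (mu z) = l2 L (\<lambda>i. mean V (\<lambda>v. \<Sum>j<l. F v i j * mu h j) + mu (Fop r) i)"
      by (intro l2_cong) (simp only: muz)
    also have "\<dots> \<le> l2 L (\<lambda>i. mean V (\<lambda>v. \<Sum>j<l. F v i j * mu h j)) + l2 L (mu (Fop r))" by (rule l2_add)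
    also have "\<dots> \<le> \<rho> * l2 L (mu h) + l2 L (mu (Fop r))" using meanF by simp
    finally have "N * l2 L (mu z) \<le> N * (\<rho> * l2 L (mu h) + l2 L (mu (Fop r)))" by (intro mult_left_mono) (simp_all add: N_def)
    also have "\<dots> = \<rho> * a + N * l2 L (mu (Fop r))" by (simp add: a_def algebra_simps)
    also have "N * l2 L (mu (Fop r)) \<le> n2 (Fop r)" unfolding N_def by (rule l2_mu_le)
    also have "n2 (Fop r) \<le> n2 r" by (rule n2_Fop)
    finally show ?thesis using nr by simp
  qed
  have dz: "(n2 (\<lambda>v i. z v i - mu z i))\<^sup>2 = (n2 z)\<^sup>2 - (N * l2 L (mu z))\<^sup>2"
    using n2_decomp[of z] by (simp add: power_mult_distrib N2[symmetric])
  have "(n2 (Av z))\<^sup>2 \<le> (N * l2 L (mu z))\<^sup>2 + (19/20)\<^sup>2 * ((n2 z)\<^sup>2 - (N * l2 L (mu z))\<^sup>2)"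
    using n2_Av_sq[of z] unfolding dz power_mult_distrib N2 by simp
  also have "\<dots> \<le> (1 - 39/800 * (1 - \<rho>)\<^sup>2) * (a\<^sup>2 + d\<^sup>2)"
  proof (rule gap_combine)
    show "(N * l2 L (mu z))\<^sup>2 \<le> (n2 z)\<^sup>2"
      unfolding N_def by (intro power_mono l2_mu_le) simp
  qed (use nz t \<rho> in \<open>simp_all add: a_def d_def N_def\<close>)
  also have "a\<^sup>2 + d\<^sup>2 = (n2 h)\<^sup>2"
    using n2_decomp[of h] by (simp add: a_def d_def power_mult_distrib N2[symmetric])
  finally show "(n2 (Av (Fop (Av h))))\<^sup>2 \<le> (kap * n2 h)\<^sup>2"
    by (simp add: z_def w_def power_mult_distrib kap)
qed (simp add: kap)

definition AF :: "(nat \<Rightarrow> nat \<Rightarrow> complex) \<Rightarrow> nat \<Rightarrow> nat \<Rightarrow> complex" where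
  "AF h = Av (Fop h)"

text \<open>A single \<open>AF\<close> may preserve the norm of a mean-zero vector, namely if the
  letters turn it into a constant one. The gain is therefore counted per two letters, which is why a
  superstep has an even number of them.\<close>

lemma n2_AF2: "n2 (AF (AF h)) \<le> kap * n2 h"
proof -
  have "n2 (AF (AF h)) \<le> kap * n2 (Fop h)" unfolding AF_def by (rule n2_AvFopAv)
  also have "\<dots> \<le> kap * n2 h" by (intro mult_left_mono n2_Fop kap)
  finally show ?thesis .
qed

lemma n2_AF_pow: "n2 ((AF ^^ (2 * k)) h) \<le> kap ^ k * n2 h"
proof (induction k)
  case (Suc k)
  have "n2 ((AF ^^ (2 * Suc k)) h) \<le> kap * n2 ((AF ^^ (2 * k)) h)" using n2_AF2 by simp
  also have "\<dots> \<le> kap * (kap ^ k * n2 h)" by (intro mult_left_mono Suc kap)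
  finally show ?case by (simp add: mult.assoc)
qed simp

section \<open>States on pairs and the operators of a superstep\<close>

definition n3 :: "wstate \<Rightarrow> real" where
  "n3 \<psi> = sqrt (\<Sum>v\<in>V. \<Sum>y\<in>G. (l2 L (\<psi> v y))\<^sup>2)"

lemma n3_sq: "(n3 \<psi>)\<^sup>2 = (\<Sum>v\<in>V. \<Sum>y\<in>G. (l2 L (\<psi> v y))\<^sup>2)" by (simp add: n3_def sum_nonneg)
lemma n3_nonneg [simp]: "0 \<le> n3 \<psi>" by (simp add: n3_def sum_nonneg)

lemma n3_sq': "(n3 \<psi>)\<^sup>2 = (\<Sum>v\<in>V. \<Sum>i\<in>L. (l2 G (\<lambda>y. \<psi> v y i))\<^sup>2)"
  unfolding n3_sq by (intro sum.cong refl) (simp add: l2_sq sum.swap[of _ L G])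

lemma n3_l2: "n3 \<psi> = l2 (V \<times> G \<times> L) (\<lambda>(v, y, i). \<psi> v y i)"
  unfolding n3_def l2_sq unfolding l2_def L2_set_def
  by (simp only: sum.cartesian_product) (simp add: case_prod_beta)

lemma n3_add: "n3 (\<psi> + \<phi>) \<le> n3 \<psi> + n3 \<phi>"
proof -
  have "n3 (\<psi> + \<phi>) = l2 (V \<times> G \<times> L) (\<lambda>x. (case x of (v, y, i) \<Rightarrow> \<psi> v y i) + (case x of (v, y, i) \<Rightarrow> \<phi> v y i))"
    unfolding n3_l2 by (intro l2_cong) (auto simp: plus_fun_apply)
  also have "\<dots> \<le> n3 \<psi> + n3 \<phi>" unfolding n3_l2 by (rule l2_add)
  finally show ?thesis .
qed

text \<open>A state \<open>\<psi> v y\<close> is the vector that the rest of the word produces if the walk is at \<open>(v, y)\<close>. The letter of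
  a step is applied after those of all later steps; this is why the words list the walk backwards, and
  why no step of the walk has to be inverted.\<close>

definition U :: "nat \<Rightarrow> wstate \<Rightarrow> wstate" where
  "U c \<psi> v y = app (move q (y c) v) (\<psi> (move q (y c) v) y)"

definition Y :: "wstate \<Rightarrow> wstate" where
  "Y \<psi> v y i = avgY p m (\<lambda>y. \<psi> v y i) y"

definition E :: "wstate \<Rightarrow> nat \<Rightarrow> nat \<Rightarrow> complex" where
  "E \<psi> v i = mean G (\<lambda>y. \<psi> v y i)"

definition J :: "wstate \<Rightarrow> wstate" where
  "J \<psi> v y = E \<psi> v"

definition lam2 :: real where "lam2 = real m / real p"

lemma n3_U: "n3 (U c \<psi>) \<le> n3 \<psi>"
proof (rule power2_le_imp_le)
  have "(n3 (U c \<psi>))\<^sup>2 = (\<Sum>y\<in>G. \<Sum>v\<in>V. (l2 L (U c \<psi> v y))\<^sup>2)" unfolding n3_sq by (rule sum.swap)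
  also have "\<dots> \<le> (\<Sum>y\<in>G. \<Sum>v\<in>V. (l2 L (\<psi> (move q (y c) v) y))\<^sup>2)"
    unfolding U_def by (intro sum_mono power_mono app_le mv) auto
  also have "\<dots> = (\<Sum>y\<in>G. \<Sum>v\<in>V. (l2 L (\<psi> v y))\<^sup>2)"
    by (intro sum.cong refl sum.reindex_bij_betw[OF move_bij[OF q]])
  also have "\<dots> = (n3 \<psi>)\<^sup>2" unfolding n3_sq by (rule sum.swap)
  finally show "(n3 (U c \<psi>))\<^sup>2 \<le> (n3 \<psi>)\<^sup>2" .
qed simp

lemma n3_YJ: "n3 (Y \<psi> - J \<psi>) \<le> lam2 * n3 \<psi>"
proof (rule power2_le_imp_le)
  have "l2 G (\<lambda>y. (Y \<psi> - J \<psi>) v y i) \<le> lam2 * l2 G (\<lambda>y. \<psi> v y i)" for v i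
    using avgY_contract[OF p(1), of m "\<lambda>y. \<psi> v y i"] by (simp add: minus_apply Y_def J_def E_def lam2_def)
  hence "(\<Sum>v\<in>V. \<Sum>i\<in>L. (l2 G (\<lambda>y. (Y \<psi> - J \<psi>) v y i))\<^sup>2) \<le> (\<Sum>v\<in>V. lam2\<^sup>2 * (\<Sum>i\<in>L. (l2 G (\<lambda>y. \<psi> v y i))\<^sup>2))"
    by (intro sum_mono l2_mono_sq)
  thus "(n3 (Y \<psi> - J \<psi>))\<^sup>2 \<le> (lam2 * n3 \<psi>)\<^sup>2"
    by (simp only: n3_sq' power_mult_distrib sum_distrib_left)
qed (simp add: lam2_def)

lemma n3_J: "n3 (J \<psi>) \<le> n3 \<psi>"
proof (rule power2_le_imp_le)
  have "(l2 G (\<lambda>y. J \<psi> v y i))\<^sup>2 \<le> (l2 G (\<lambda>y. \<psi> v y i))\<^sup>2" for v i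
    using l2_mean_le[of G "\<lambda>y. \<psi> v y i"] by (simp add: J_def E_def l2_const)
  thus "(n3 (J \<psi>))\<^sup>2 \<le> (n3 \<psi>)\<^sup>2" unfolding n3_sq' by (intro sum_mono)
qed simp

lemma l2_avgY: "l2 G (avgY p m h) \<le> l2 G h"
proof -
  let ?f = "\<lambda>y. \<Sum>c<p. \<Sum>x<p. h (shift p m c x y)"
  have "avgY p m h = (\<lambda>y. complex_of_real (1 / real (p * p)) * ?f y)"
    by (simp add: fun_eq_iff avgY_def)
  hence 1: "l2 G (avgY p m h) = 1 / real (p * p) * l2 G ?f"
    by (simp only: l2_cmult norm_of_real) simp
  have "l2 G ?f \<le> (\<Sum>c<p. \<Sum>x<p. l2 G (\<lambda>y. h (shift p m c x y)))"
    by (rule order_trans[OF l2_sum sum_mono[OF l2_sum]])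
  also have "\<dots> = (\<Sum>c<p. \<Sum>x<p. l2 G h)"
    by (intro sum.cong refl l2_bij shift_bij p0)
  finally have "l2 G ?f \<le> real (p * p) * l2 G h" by simp
  hence "1 / real (p * p) * l2 G ?f \<le> 1 / real (p * p) * (real (p * p) * l2 G h)"
    by (rule mult_left_mono) simp
  also have "\<dots> = l2 G h" using p0 by simp
  finally show ?thesis unfolding 1 .
qed

lemma n3_Y: "n3 (Y \<psi>) \<le> n3 \<psi>"
proof (rule power2_le_imp_le)
  have "(l2 G (\<lambda>y. Y \<psi> v y i))\<^sup>2 \<le> (l2 G (\<lambda>y. \<psi> v y i))\<^sup>2" for v i
    using l2_avgY[of "\<lambda>y. \<psi> v y i"] by (intro power_mono) (simp_all add: Y_def)
  thus "(n3 (Y \<psi>))\<^sup>2 \<le> (n3 \<psi>)\<^sup>2" unfolding n3_sq' by (intro sum_mono)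
qed simp

lemma n3_J_n2: "n3 (J \<psi>) = sqrt (real (p ^ m)) * n2 (E \<psi>)"
  by (simp add: n3_def n2_def J_def sum_distrib_left[symmetric] real_sqrt_mult)

lemma Y_J: "Y (J \<psi>) = J \<psi>"
  using p0 by (simp add: fun_eq_iff Y_def J_def avgY_def)

lemma E_J: "E (J \<psi>) = E \<psi>"
  by (simp add: fun_eq_iff E_def J_def mean_const[OF finite_grp G_ne])

lemma E_Y: "E (Y \<psi>) = E \<psi>"
  by (simp add: fun_eq_iff E_def Y_def mean_def sum_avgY[OF p0])

lemma Y_diff: "Y (\<psi> - \<phi>) = Y \<psi> - Y \<phi>"
  by (simp add: fun_eq_iff minus_apply Y_def avgY_def sum_subtractf diff_divide_distrib)

lemma Y_add: "Y (\<psi> + \<phi>) = Y \<psi> + Y \<phi>"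
  by (simp add: fun_eq_iff plus_fun_apply Y_def avgY_def sum.distrib add_divide_distrib)

lemma U_add: "U c (\<psi> + \<phi>) = U c \<psi> + U c \<phi>"
  by (simp add: fun_eq_iff plus_fun_apply U_def plus_fun_def app_add)

text \<open>Coordinate \<open>c\<close> is still unread: the state ignores it. This is what makes
  the next label independent of everything that follows.\<close>

definition indep :: "nat \<Rightarrow> wstate \<Rightarrow> bool" where
  "indep c \<psi> \<longleftrightarrow> (\<forall>v y a. y \<in> G \<longrightarrow> a < p \<longrightarrow> \<psi> v (y(c := a)) = \<psi> v y)"

lemma upd_grp: "y \<in> G \<Longrightarrow> c < m \<Longrightarrow> a < p \<Longrightarrow> y(c := a) \<in> G"
  by (auto simp: grp_def PiE_def extensional_def)

lemma grp_less: "y \<in> G \<Longrightarrow> c < m \<Longrightarrow> y c < p"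
  by (auto simp: grp_def PiE_def Pi_def)

lemma indep_J: "indep c (J \<psi>)" by (simp add: indep_def J_def)

lemma indep_U: "indep c \<psi> \<Longrightarrow> c \<noteq> c' \<Longrightarrow> indep c (U c' \<psi>)"
  by (simp add: indep_def U_def)

text \<open>A shift adds to each coordinate an amount that does not depend on \<open>y\<close>, so
  it cannot carry coordinate \<open>c\<close> into another one.\<close>

lemma indep_Y: assumes "indep c \<psi>" "c < m" shows "indep c (Y \<psi>)"
  unfolding indep_def
proof (intro allI impI ext)
  fix v y a i assume y: "y \<in> G" and a: "a < p"
  have "\<psi> v (shift p m k x (y(c := a))) = \<psi> v (shift p m k x y)" for k x
  proof -
    have "shift p m k x (y(c := a)) = (shift p m k x y)(c := (a + k * x ^ c) mod p)"
      using assms(2) by (auto simp: shift_def fun_eq_iff)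
    thus ?thesis using assms(1) shift_in[OF p0] p0 by (simp add: indep_def)
  qed
  thus "Y \<psi> v (y(c := a)) i = Y \<psi> v y i" by (simp add: Y_def avgY_def)
qed

text \<open>Under the uniform distribution an unread coordinate may be replaced by an independent
  label. The witness is the involution that exchanges \<open>a\<close> with
  \<open>y c\<close>.\<close>

lemma sum_fresh:
  fixes h :: "nat \<Rightarrow> (nat \<Rightarrow> nat) \<Rightarrow> complex"
  assumes c: "c < m" and h: "\<And>a b y. y \<in> G \<Longrightarrow> b < p \<Longrightarrow> h a (y(c := b)) = h a y"
  shows "of_nat p * (\<Sum>y\<in>G. h (y c) y) = (\<Sum>a<p. \<Sum>y\<in>G. h a y)"
proof -
  have "of_nat p * (\<Sum>y\<in>G. h (y c) y) = (\<Sum>y\<in>G. \<Sum>a<p. h (y c) y)"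
    by (simp add: sum_distrib_left)
  also have "\<dots> = (\<Sum>(y, a)\<in>G \<times> {..<p}. h (y c) y)"
    by (rule sum.cartesian_product)
  also have "\<dots> = (\<Sum>(y, a)\<in>G \<times> {..<p}. h a y)"
    by (rule sum.reindex_bij_witness[of _ "\<lambda>(y, a). (y(c := a), y c)" "\<lambda>(y, a). (y(c := a), y c)"])
       (use c upd_grp grp_less h in auto)
  also have "\<dots> = (\<Sum>y\<in>G. \<Sum>a<p. h a y)"
    by (rule sum.cartesian_product[symmetric])
  also have "\<dots> = (\<Sum>a<p. \<Sum>y\<in>G. h a y)" by (rule sum.swap)
  finally show ?thesis .
qed

text \<open>After averaging over \<open>y\<close>, reading an unread coordinate is a step with a
  fresh random label; the walk on pairs then projects to \<open>AF\<close> on the vertices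
  alone.\<close>

lemma E_U: assumes "indep c \<psi>" "c < m" shows "E (U c \<psi>) = AF (E \<psi>)"
proof (intro ext)
  fix v i
  define h where "h a y = app (move q a v) (\<psi> (move q a v) y) i" for a y
  have "of_nat p * (\<Sum>y\<in>G. h (y c) y) = (\<Sum>a<p. \<Sum>y\<in>G. h a y)"
    by (rule sum_fresh[OF assms(2)]) (use assms(1) in \<open>simp add: h_def indep_def\<close>)
  hence "(\<Sum>y\<in>G. h (y c) y) = (\<Sum>a<p. \<Sum>y\<in>G. h a y) / of_nat p" using p0 by (simp add: field_simps)
  hence "E (U c \<psi>) v i = (\<Sum>a<p. (\<Sum>y\<in>G. h a y) / of_nat (p ^ m)) / of_nat p"
    by (simp add: E_def U_def mean_def h_def sum_divide_distrib[symmetric] mult.commute)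
  moreover have "(\<Sum>y\<in>G. h a y) / of_nat (p ^ m) = app (move q a v) (E \<psi> (move q a v)) i" for a
    by (simp add: h_def E_def[abs_def] mean_def app_divide app_sum)
  ultimately show "E (U c \<psi>) v i = AF (E \<psi>) v i" by (simp add: AF_def Av_def Fop_def)
qed

primrec Us :: "nat list \<Rightarrow> wstate \<Rightarrow> wstate" where
  "Us [] \<psi> = \<psi>"
| "Us (c # cs) \<psi> = U c (Us cs \<psi>)"

lemma n3_Us: "n3 (Us cs \<psi>) \<le> n3 \<psi>"
  by (induction cs) (auto intro: order_trans[OF n3_U])

lemma Us_add: "Us cs (\<psi> + \<phi>) = Us cs \<psi> + Us cs \<phi>"
  by (induction cs) (auto simp: U_add)

lemma indep_Us: "indep c \<psi> \<Longrightarrow> c \<notin> set cs \<Longrightarrow> indep c (Us cs \<psi>)"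
  by (induction cs) (auto intro: indep_U)

lemma E_Us:
  assumes "distinct cs" "\<forall>c\<in>set cs. c < m \<and> indep c \<psi>"
  shows "E (Us cs \<psi>) = (AF ^^ length cs) (E \<psi>)"
  using assms by (induction cs) (auto simp: E_U indep_Us)

end

section \<open>Supersteps and blocks\<close>

locale wide_walk = opwalk +
  fixes s b :: nat
  assumes s: "s > 0" and m: "m = s * b"
begin

definition M :: "nat \<Rightarrow> wstate \<Rightarrow> wstate" where
  "M k = Us [(k mod s) * b..<(k mod s) * b + b]"

text \<open>\<open>n\<close> supersteps from number \<open>k\<close> on, the earliest outermost.
  Their windows of coordinates are disjoint as long as \<open>k + n \<le> s\<close>.\<close>

primrec Q :: "nat \<Rightarrow> nat \<Rightarrow> wstate \<Rightarrow> wstate" where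
  "Q 0 k \<psi> = \<psi>"
| "Q (Suc n) k \<psi> = M k (Y (Q n (Suc k) \<psi>))"

lemma n3_M: "n3 (M k \<psi>) \<le> n3 \<psi>" unfolding M_def by (rule n3_Us)

lemma M_add: "M k (\<psi> + \<phi>) = M k \<psi> + M k \<phi>" unfolding M_def by (rule Us_add)

lemma Q_add: "Q n k (\<psi> + \<phi>) = Q n k \<psi> + Q n k \<phi>"
  by (induction n arbitrary: k) (simp_all add: M_add Y_add)

lemma n3_Q: "n3 (Q n k \<psi>) \<le> n3 \<psi>"
  by (induction n arbitrary: k) (auto intro: order_trans[OF n3_M] order_trans[OF n3_Y])

lemma Q_append: "Q (a + n) k \<psi> = Q a k (Q n (k + a) \<psi>)"
  by (induction a arbitrary: k) simp_all

lemma Q_period: "Q n (k + s) \<psi> = Q n k \<psi>"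
proof (induction n arbitrary: k)
  case (Suc n)
  show ?case using Suc[of "Suc k"] by (simp add: M_def)
qed simp

text \<open>Supersteps from \<open>k\<close> on read only coordinates from \<open>k * b\<close>
  upwards, so the lower ones stay unread. The bound \<open>k + n \<le> s\<close> excludes the
  wrap-around in \<open>M\<close>.\<close>

lemma indep_Q:
  assumes "k + n \<le> s" "\<forall>c<m. indep c \<psi>" "c < k * b" "c < m"
  shows "indep c (Q n k \<psi>)"
  using assms
proof (induction n arbitrary: k)
  case (Suc n)
  have "c < Suc k * b" using Suc.prems by simp
  hence "indep c (Y (Q n (Suc k) \<psi>))" using Suc by (intro indep_Y Suc.IH) auto
  moreover have "k mod s = k" using Suc.prems by simp
  ultimately show ?case using Suc.prems by (auto simp: M_def intro!: indep_Us)
qed simp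

text \<open>Each superstep reads coordinates that the later ones, which act first as operators, have
  not touched, so \<open>E_Us\<close> applies; the intermediate \<open>Y\<close> are invisible to
  \<open>E\<close>.\<close>

lemma E_Q:
  assumes "k + n \<le> s" "\<forall>c<m. indep c \<psi>"
  shows "E (Q n k \<psi>) = (AF ^^ (b * n)) (E \<psi>)"
  using assms
proof (induction n arbitrary: k)
  case (Suc n)
  have k: "k mod s = k" using Suc.prems by simp
  have "Suc k * b \<le> s * b" using Suc.prems by (intro mult_right_mono) auto
  hence le: "k * b + b \<le> m" by (simp add: m)
  have iv: "c < m \<and> indep c (Y (Q n (Suc k) \<psi>))" if "c < k * b + b" for c
    using that le Suc.prems by (intro conjI indep_Y indep_Q) auto
  have "E (Q (Suc n) k \<psi>) = (AF ^^ b) (E (Y (Q n (Suc k) \<psi>)))"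
    using E_Us[of "[k * b..<k * b + b]" "Y (Q n (Suc k) \<psi>)"] iv k by (simp add: M_def)
  also have "\<dots> = (AF ^^ (b * Suc n)) (E \<psi>)"
    using Suc by (simp add: E_Y funpow_add)
  finally show ?case .
qed simp

end

text \<open>By \<open>gap\<close>, the \<open>b\<close> random outer steps of a superstep contract
  at least as well as one shift does, so it does not matter which of the two provides the
  gain.\<close>

locale wide_walk_gap = wide_walk +
  fixes b' :: nat
  assumes b: "b = 2 * b'" and gap: "kap ^ b' \<le> lam2" and lam2_1: "lam2 \<le> 1"
begin

lemma lam2_0: "0 \<le> lam2" by (simp add: lam2_def)

text \<open>Between two full averages only \<open>E\<close> survives, and for it the supersteps are
  \<open>b * n\<close> genuine steps of the outer walk.\<close>

lemma n3_JQJ: assumes "k + n \<le> s" shows "n3 (J (Q n k (J \<psi>))) \<le> lam2 ^ n * n3 \<psi>"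
proof -
  have iv: "\<forall>c<m. indep c (J \<psi>)" using indep_J by blast
  have EQ: "E (Q n k (J \<psi>)) = (AF ^^ (2 * (b' * n))) (E \<psi>)"
  proof -
    have "b * n = 2 * (b' * n)" by (simp only: b mult.assoc)
    thus ?thesis using E_Q[OF assms iv] by (simp only: E_J)
  qed
  have "n2 ((AF ^^ (2 * (b' * n))) (E \<psi>)) \<le> kap ^ (b' * n) * n2 (E \<psi>)"
    by (rule n2_AF_pow)
  also have "\<dots> \<le> lam2 ^ n * n2 (E \<psi>)"
    unfolding power_mult by (intro mult_right_mono power_mono gap zero_le_power kap n2_nonneg)
  finally have "sqrt (real (p ^ m)) * n2 (E (Q n k (J \<psi>))) \<le> sqrt (real (p ^ m)) * (lam2 ^ n * n2 (E \<psi>))"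
    unfolding EQ by (rule mult_left_mono) simp
  hence "n3 (J (Q n k (J \<psi>))) \<le> lam2 ^ n * n3 (J \<psi>)"
    unfolding n3_J_n2 by (simp only: mult.left_commute)
  also have "\<dots> \<le> lam2 ^ n * n3 \<psi>"
    by (intro mult_left_mono n3_J zero_le_power lam2_0)
  finally show ?thesis .
qed

lemma n3_Y_split: "n3 (Y \<psi>) \<le> n3 (J \<psi>) + lam2 * n3 \<psi>"
proof -
  have "Y \<psi> = J \<psi> + (Y \<psi> - J \<psi>)" by (simp add: fun_eq_iff plus_fun_apply minus_apply)
  hence "n3 (Y \<psi>) \<le> n3 (J \<psi>) + n3 (Y \<psi> - J \<psi>)" using n3_add[of "J \<psi>" "Y \<psi> - J \<psi>"] by (simp only:)
  thus ?thesis using n3_YJ[of \<psi>] by linarith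
qed

text \<open>The leftmost \<open>Y\<close> is split. Its part \<open>J\<close> closes a stretch
  between two full averages, where \<open>n3_JQJ\<close> gives every factor; the part
  \<open>Y - J\<close> gains one \<open>lam2\<close> and leaves a shorter product. The factor
  \<open>real n + 2\<close> adds up these choices.\<close>

lemma n3_QJ: "k + Suc n \<le> s \<Longrightarrow> n3 (Q (Suc n) k (J \<psi>)) \<le> (real n + 2) * lam2 ^ n * n3 \<psi>"
proof (induction n arbitrary: k)
  case 0
  have "n3 (Q (Suc 0) k (J \<psi>)) \<le> n3 \<psi>" by (rule order_trans[OF n3_Q n3_J])
  also have "\<dots> \<le> (real 0 + 2) * lam2 ^ 0 * n3 \<psi>" by simp
  finally show ?case .
next
  case (Suc n)
  let ?X = "Q (Suc n) (Suc k) (J \<psi>)"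
  have "n3 (Q (Suc (Suc n)) k (J \<psi>)) \<le> n3 (Y ?X)"
    by (subst Q.simps(2)) (rule n3_M)
  also have "\<dots> \<le> n3 (J ?X) + lam2 * n3 ?X" by (rule n3_Y_split)
  also have "\<dots> \<le> lam2 ^ Suc n * n3 \<psi> + lam2 * ((real n + 2) * lam2 ^ n * n3 \<psi>)"
  proof (intro add_mono mult_left_mono lam2_0)
    show "n3 (J ?X) \<le> lam2 ^ Suc n * n3 \<psi>" by (rule n3_JQJ) (use Suc.prems in simp)
    show "n3 ?X \<le> (real n + 2) * lam2 ^ n * n3 \<psi>" by (rule Suc.IH) (use Suc.prems in simp)
  qed
  also have "\<dots> = (real (Suc n) + 2) * lam2 ^ Suc n * n3 \<psi>" by (simp add: algebra_simps)
  finally show ?case .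
qed

text \<open>The splitting from the right end. The summand \<open>J \<psi>\<close> is covered by
  \<open>n3_QJ\<close>. Since \<open>Y\<close> fixes \<open>J \<psi>\<close>, the last
  \<open>Y\<close> acts on the other summand as \<open>Y - J\<close>, gains \<open>lam2\<close>, and
  the product gets shorter. Summing the linear factors gives the square.\<close>

lemma n3_Q_le: "k + Suc n \<le> s \<Longrightarrow> n3 (Q (Suc n) k \<psi>) \<le> (real n + 2)\<^sup>2 * lam2 ^ n * n3 \<psi>"
proof (induction n arbitrary: \<psi>)
  case 0
  have "n3 \<psi> \<le> (real 0 + 2)\<^sup>2 * lam2 ^ 0 * n3 \<psi>" by simp
  with n3_Q[of "Suc 0" k \<psi>] show ?case by (rule order_trans)
next
  case (Suc n)
  let ?r = "M (k + Suc n) (Y (\<psi> - J \<psi>))"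
  have "Y (\<psi> - J \<psi>) = Y \<psi> - J \<psi>" by (simp add: Y_diff Y_J)
  hence "n3 (Y (\<psi> - J \<psi>)) \<le> lam2 * n3 \<psi>" using n3_YJ[of \<psi>] by (simp only:)
  with n3_M have r: "n3 ?r \<le> lam2 * n3 \<psi>" by (rule order_trans)
  have "\<psi> = J \<psi> + (\<psi> - J \<psi>)" by (simp add: fun_eq_iff plus_fun_apply minus_apply)
  hence "Q (Suc (Suc n)) k \<psi> = Q (Suc (Suc n)) k (J \<psi> + (\<psi> - J \<psi>))" by (rule arg_cong)
  also have "\<dots> = Q (Suc (Suc n)) k (J \<psi>) + Q (Suc (Suc n)) k (\<psi> - J \<psi>)" by (rule Q_add)
  also have "Q (Suc (Suc n)) k (\<psi> - J \<psi>) = Q (Suc n) k ?r"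
    using Q_append[of "Suc n" "Suc 0" k "\<psi> - J \<psi>"]
    by (simp only: Q.simps(1) Q.simps(2)[of 0 "Suc (k + n)"] add_Suc_right add_0_right)
  finally have "n3 (Q (Suc (Suc n)) k \<psi>) \<le> n3 (Q (Suc (Suc n)) k (J \<psi>)) + n3 (Q (Suc n) k ?r)"
    by (simp only: n3_add)
  also have "\<dots> \<le> (real (Suc n) + 2) * lam2 ^ Suc n * n3 \<psi> + (real n + 2)\<^sup>2 * lam2 ^ n * n3 ?r"
  proof (rule add_mono)
    show "n3 (Q (Suc (Suc n)) k (J \<psi>)) \<le> (real (Suc n) + 2) * lam2 ^ Suc n * n3 \<psi>"
      by (rule n3_QJ) (rule Suc.prems)
    show "n3 (Q (Suc n) k ?r) \<le> (real n + 2)\<^sup>2 * lam2 ^ n * n3 ?r"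
      by (rule Suc.IH) (use Suc.prems in simp)
  qed
  also have "\<dots> \<le> (real (Suc n) + 2) * lam2 ^ Suc n * n3 \<psi> + (real n + 2)\<^sup>2 * lam2 ^ n * (lam2 * n3 \<psi>)"
    by (intro add_left_mono mult_left_mono r mult_nonneg_nonneg zero_le_power lam2_0) auto
  also have "\<dots> = ((real n + 3) + (real n + 2)\<^sup>2) * (lam2 ^ Suc n * n3 \<psi>)" by (simp add: algebra_simps)
  also have "\<dots> \<le> (real n + 3)\<^sup>2 * (lam2 ^ Suc n * n3 \<psi>)"
    by (intro mult_right_mono mult_nonneg_nonneg zero_le_power lam2_0) (simp_all add: power2_eq_square algebra_simps)
  finally show ?case by (simp add: mult.assoc add.commute)
qed

text \<open>Coordinates are reused after \<open>s\<close> supersteps, so no independence is claimed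
  across blocks and their norm bounds are multiplied. Each block loses one \<open>lam2\<close> and
  the polynomial factor, a share that shrinks with growing \<open>s\<close>.\<close>

lemma n3_blocks: "n3 (Q (s * k) 0 \<psi>) \<le> ((real s + 1)\<^sup>2 * lam2 ^ (s - 1)) ^ k * n3 \<psi>"
proof (induction k)
  case (Suc k)
  have per: "Q n (0 + s) \<psi>' = Q n 0 \<psi>'" for n \<psi>' by (rule Q_period)
  have step: "Q (s * Suc k) 0 \<psi> = Q s 0 (Q (s * k) 0 \<psi>)"
    using Q_append[of s "s * k" 0 \<psi>] unfolding per by (simp only: mult_Suc_right)
  have "n3 (Q (s * Suc k) 0 \<psi>) \<le> (real s + 1)\<^sup>2 * lam2 ^ (s - 1) * n3 (Q (s * k) 0 \<psi>)"
  proof -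
    obtain n where n: "Suc n = s" using s gr0_implies_Suc by metis
    have eq: "real s + 1 = real n + 2" "s - 1 = n" using n by auto
    have "n3 (Q (Suc n) 0 (Q (s * k) 0 \<psi>)) \<le> (real n + 2)\<^sup>2 * lam2 ^ n * n3 (Q (s * k) 0 \<psi>)"
      by (rule n3_Q_le) (simp only: n add_0_left order_refl)
    thus ?thesis by (simp only: n eq step)
  qed
  also have "\<dots> \<le> (real s + 1)\<^sup>2 * lam2 ^ (s - 1) * (((real s + 1)\<^sup>2 * lam2 ^ (s - 1)) ^ k * n3 \<psi>)"
    by (rule mult_left_mono[OF Suc]) (simp add: lam2_0)
  finally show ?case by (simp only: power_Suc mult.assoc)
qed simp

end

section \<open>From operators to words\<close>

lemma sum_split:
  fixes f :: "nat \<Rightarrow> 'a :: comm_monoid_add"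
  assumes "a > 0"
  shows "(\<Sum>v<a*b. f v) = (\<Sum>x<a. \<Sum>y<b. f (x + a * y))"
proof -
  have less: "x + a * y < a * b" if "x < a" "y < b" for x y
  proof -
    have "x + a * y < a + a * y" "a * Suc y \<le> a * b" using that by (simp, intro mult_le_mono2) simp
    thus ?thesis by simp
  qed
  have "(\<Sum>v<a*b. f v) = (\<Sum>(x,y)\<in>{..<a}\<times>{..<b}. f (x + a * y))"
    by (rule sum.reindex_bij_witness[of _ "\<lambda>(x,y). x + a * y" "\<lambda>v. (v mod a, v div a)"])
       (use assms less in \<open>auto simp: less_mult_imp_div_less mult.commute\<close>)
  thus ?thesis by (simp add: sum.cartesian_product)
qed

definition digit :: "nat \<Rightarrow> nat \<Rightarrow> nat \<Rightarrow> nat" where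
  "digit p r i = (r div p ^ i) mod p"

definition digits :: "nat \<Rightarrow> nat \<Rightarrow> nat \<Rightarrow> (nat \<Rightarrow> nat)" where
  "digits p m r = (\<lambda>i\<in>{..<m}. digit p r i)"

lemma digits_inj:
  assumes "p > 0" "r < p ^ m" "r' < p ^ m" "\<And>i. i < m \<Longrightarrow> digit p r i = digit p r' i"
  shows "r = r'"
  using assms(2-)
proof (induction m arbitrary: r r')
  case (Suc m)
  have 0: "r mod p = r' mod p" using Suc.prems(3)[of 0] by (simp add: digit_def)
  have "r div p = r' div p"
  proof (rule Suc.IH)
    show "r div p < p ^ m" "r' div p < p ^ m"
      using Suc.prems assms(1) by (simp_all add: less_mult_imp_div_less mult.commute)
    show "digit p (r div p) i = digit p (r' div p) i" if "i < m" for i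
      using Suc.prems(3)[of "Suc i"] that by (simp add: digit_def div_mult2_eq)
  qed
  with 0 show ?case by (metis div_mult_mod_eq)
qed simp

lemma digits_bij: assumes "p > 0" shows "bij_betw (digits p m) {..<p ^ m} (grp p m)"
proof -
  have sub: "digits p m ` {..<p ^ m} \<subseteq> grp p m"
    using assms by (auto simp: digits_def grp_def digit_def split: if_splits)
  have inj: "inj_on (digits p m) {..<p ^ m}"
  proof (rule inj_onI)
    fix r r' assume r: "r \<in> {..<p ^ m}" "r' \<in> {..<p ^ m}" "digits p m r = digits p m r'"
    have "digit p r i = digit p r' i" if "i < m" for i
      using fun_cong[OF r(3), of i] that by (simp add: digits_def)
    thus "r = r'" using digits_inj[OF assms] r by auto
  qed
  have "digits p m ` {..<p ^ m} = grp p m"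
    by (rule card_subset_eq[OF finite_grp sub]) (simp add: card_image[OF inj])
  with inj show ?thesis by (simp add: bij_betw_def)
qed

primrec visited :: "nat \<Rightarrow> nat list \<Rightarrow> nat \<Rightarrow> nat list" where
  "visited q [] v = []"
| "visited q (a # as) v = move q a v # visited q as (move q a v)"

lemma length_visited [simp]: "length (visited q as v) = length as"
  by (induction as arbitrary: v) auto

text \<open>The walk by position: the program recomputes it from the start for every letter.\<close>

primrec vtx :: "nat \<Rightarrow> (nat \<Rightarrow> nat) \<Rightarrow> nat \<Rightarrow> nat \<Rightarrow> nat" where
  "vtx q a v 0 = v"
| "vtx q a v (Suc i) = move q (a i) (vtx q a v i)"

lemma vtx_shift: "vtx q a v (Suc i) = vtx q (\<lambda>j. a (Suc j)) (move q (a 0) v) i"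
  by (induction i) auto

lemma visited_nth:
  "i < length as \<Longrightarrow> visited q as v ! i = vtx q (\<lambda>j. as ! j) v (Suc i)"
proof (induction as arbitrary: v i)
  case (Cons a as)
  show ?case
  proof (cases i)
    case (Suc j)
    have "visited q (a # as) v ! i = visited q as (move q a v) ! j" by (simp add: Suc)
    also have "\<dots> = vtx q (\<lambda>j. as ! j) (move q a v) (Suc j)"
      by (rule Cons.IH) (use Cons.prems Suc in simp)
    also have "\<dots> = vtx q (\<lambda>j. (a # as) ! j) v (Suc i)"
      unfolding Suc vtx_shift[of q "\<lambda>j. (a # as) ! j" v "Suc j"] by (simp only: nth_Cons_Suc nth_Cons_0)
    finally show ?thesis .
  qed simp
qed simp

lemma vtx_cong: "(\<And>j. j < i \<Longrightarrow> a j = a' j) \<Longrightarrow> vtx q a v i = vtx q a' v i"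
  by (induction i) auto

lemma vtx_less: "q > 0 \<Longrightarrow> v < q * q \<Longrightarrow> vtx q a v i < q * q"
  by (induction i) (auto intro: move_less)

lemma concat_blocks:
  assumes "b > 0"
  shows "concat (map (\<lambda>j. map (f j) [0..<b]) [0..<n]) = map (\<lambda>i. f (i div b) (i mod b)) [0..<n * b]"
proof (induction n)
  case (Suc n)
  have 1: "[0..<Suc n * b] = [0..<n * b] @ [n * b..<n * b + b]"
  proof -
    have "Suc n * b = n * b + b" by simp
    thus ?thesis using upt_add_eq_append[of 0 "n * b" b] by (metis le0)
  qed
  have 2: "map (\<lambda>i. f (i div b) (i mod b)) [n * b..<n * b + b] = map (f n) [0..<b]"
  proof (rule nth_equalityI)
    fix i assume "i < length (map (\<lambda>i. f (i div b) (i mod b)) [n * b..<n * b + b])"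
    hence "i < b" by simp
    thus "map (\<lambda>i. f (i div b) (i mod b)) [n * b..<n * b + b] ! i = map (f n) [0..<b] ! i"
      using assms by simp
  qed simp
  have "concat (map (\<lambda>j. map (f j) [0..<b]) [0..<Suc n]) = concat (map (\<lambda>j. map (f j) [0..<b]) [0..<n]) @ map (f n) [0..<b]"
    by simp
  thus ?case unfolding 1 map_append 2 Suc.IH .
qed simp

text \<open>The vector \<open>y\<close> after \<open>j\<close> shifts, which are given by pairs of consecutive digits of \<open>r\<close>.\<close>

definition genrow :: "nat \<Rightarrow> (nat \<Rightarrow> nat) \<Rightarrow> nat \<Rightarrow> nat \<Rightarrow> nat \<Rightarrow> nat" where
  "genrow p y r j c = (y c + (\<Sum>i<j. digit p r (2 * i) * digit p r (2 * i + 1) ^ c)) mod p"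

lemma genrow_0: "y \<in> grp p m \<Longrightarrow> c < m \<Longrightarrow> genrow p y r 0 c = y c"
  by (auto simp: genrow_def grp_def PiE_def Pi_def)

text \<open>Performing the first shift and dropping its two digits from \<open>r\<close> agrees with
  keeping it as the first summand; the outer reduction mod \<open>p\<close> absorbs the inner
  one.\<close>

lemma genrow_Suc:
  assumes "c < m"
  shows "genrow p (shift p m (r mod p) ((r div p) mod p) y) (r div (p * p)) j c = genrow p y r (Suc j) c"
proof -
  have d: "digit p (r div (p * p)) e = digit p r (e + 2)" for e
  proof -
    have "p * p * p ^ e = p ^ (e + 2)" by simp
    thus ?thesis by (simp only: digit_def div_mult2_eq[symmetric])
  qed
  have "(\<Sum>i<Suc j. digit p r (2 * i) * digit p r (2 * i + 1) ^ c)
     = digit p r 0 * digit p r 1 ^ c + (\<Sum>i<j. digit p r (2 * Suc i) * digit p r (2 * Suc i + 1) ^ c)"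
    by (subst sum.lessThan_Suc_shift) simp
  moreover have "shift p m (r mod p) ((r div p) mod p) y c = (y c + digit p r 0 * digit p r 1 ^ c) mod p"
    using assms by (simp add: shift_def digit_def)
  moreover have "2 * i + 2 = 2 * Suc i" "2 * i + 1 + 2 = 2 * Suc i + 1" for i by simp_all
  ultimately show ?thesis
    by (simp only: genrow_def d mod_add_left_eq add.assoc)
qed

context wide_walk
begin

primrec runl :: "nat list \<Rightarrow> nat \<Rightarrow> (nat \<Rightarrow> complex) \<Rightarrow> nat \<Rightarrow> complex" where
  "runl [] v u = u"
| "runl (a # as) v u = app (move q a v) (runl as (move q a v) u)"

text \<open>Every superstep consumes the two lowest base-\<open>p\<close> digits of
  \<open>r\<close>: the factor \<open>c\<close> of the shift, then the node
  \<open>x\<close>.\<close>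

primrec labs :: "nat \<Rightarrow> nat \<Rightarrow> (nat \<Rightarrow> nat) \<Rightarrow> nat \<Rightarrow> nat list" where
  "labs 0 k y r = []"
| "labs (Suc n) k y r = map y [(k mod s) * b..<(k mod s) * b + b] @
     labs n (Suc k) (shift p m (r mod p) ((r div p) mod p) y) (r div (p * p))"

lemma runl_visited: "runl as v u = foldr app (visited q as v) u"
  by (induction as arbitrary: v) auto

lemma runl_Us: "runl (map y cs @ as y) v u = Us cs (\<lambda>v y. runl (as y) v u) v y"
  by (induction cs arbitrary: v) (auto simp: U_def)

lemma U_sum: "U c (\<lambda>v y i. \<Sum>t\<in>T. \<psi> t v y i) = (\<lambda>v y i. \<Sum>t\<in>T. U c (\<psi> t) v y i)"
  by (simp add: fun_eq_iff U_def app_sum)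

lemma U_div: "U c (\<lambda>v y i. \<psi> v y i / d) = (\<lambda>v y i. U c \<psi> v y i / d)"
  by (simp add: fun_eq_iff U_def app_divide)

lemma Us_sum: "Us cs (\<lambda>v y i. \<Sum>t\<in>T. \<psi> t v y i) = (\<lambda>v y i. \<Sum>t\<in>T. Us cs (\<psi> t) v y i)"
proof (induction cs)
  case (Cons c cs)
  show ?case unfolding Us.simps Cons U_sum ..
qed simp

lemma Us_div: "Us cs (\<lambda>v y i. \<psi> v y i / d) = (\<lambda>v y i. Us cs \<psi> v y i / d)"
proof (induction cs)
  case (Cons c cs)
  show ?case unfolding Us.simps Cons U_div ..
qed simp

lemma sum_digits2:
  fixes f :: "nat \<Rightarrow> nat \<Rightarrow> nat \<Rightarrow> complex"
  shows "(\<Sum>r<p ^ (2 * Suc n). f (r mod p) ((r div p) mod p) (r div (p * p))) = (\<Sum>c<p. \<Sum>x<p. \<Sum>r<p ^ (2 * n). f c x r)"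
proof -
  have "p ^ (2 * Suc n) = p * (p * p ^ (2 * n))" by simp
  hence "(\<Sum>r<p ^ (2 * Suc n). f (r mod p) ((r div p) mod p) (r div (p * p)))
    = (\<Sum>c<p. \<Sum>x<p. \<Sum>r<p ^ (2 * n). f ((c + p * (x + p * r)) mod p) ((c + p * (x + p * r)) div p mod p) ((c + p * (x + p * r)) div (p * p)))"
    by (simp only: sum_split[OF p0])
  also have "\<dots> = (\<Sum>c<p. \<Sum>x<p. \<Sum>r<p ^ (2 * n). f c x r)"
    using p0 by (intro sum.cong refl) (simp add: div_mult2_eq)
  finally show ?thesis .
qed

text \<open>As \<open>r\<close> runs below \<open>p ^ (2 * n)\<close>, its digit pairs run through
  all independent choices of shifts, and averaging over one pair is one application of
  \<open>Y\<close>.\<close>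

lemma avg_runl:
  "(\<Sum>r<p ^ (2 * n). runl (labs n k y r) v u i) / of_nat (p ^ (2 * n)) = Q n k (\<lambda>_ _. u) v y i"
proof (induction n arbitrary: k y v i)
  case (Suc n)
  define cs where "cs = [(k mod s) * b..<(k mod s) * b + b]"
  define g where "g c x r v y = runl (labs n (Suc k) (shift p m c x y) r) v u" for c x r v y
  have 1: "(\<Sum>r<p ^ (2 * Suc n). runl (labs (Suc n) k y r) v u i)
      = (\<Sum>r<p ^ (2 * Suc n). Us cs (g (r mod p) ((r div p) mod p) (r div (p * p))) v y i)"
    unfolding labs.simps cs_def[symmetric] g_def
    by (intro sum.cong refl fun_cong[OF runl_Us])
  have 2: "\<dots> = (\<Sum>c<p. \<Sum>x<p. \<Sum>r<p ^ (2 * n). Us cs (g c x r) v y i)" by (rule sum_digits2)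
  have 3: "(\<Sum>c<p. \<Sum>x<p. \<Sum>r<p ^ (2 * n). Us cs (g c x r) v y i) / of_nat (p ^ (2 * Suc n))
    = Us cs (\<lambda>v y i. (\<Sum>c<p. \<Sum>x<p. \<Sum>r<p ^ (2 * n). g c x r v y i) / of_nat (p ^ (2 * Suc n))) v y i"
    by (simp only: Us_sum Us_div)
  have 4: "(\<lambda>v y i. (\<Sum>c<p. \<Sum>x<p. \<Sum>r<p ^ (2 * n). g c x r v y i) / of_nat (p ^ (2 * Suc n))) = Y (Q n (Suc k) (\<lambda>_ _. u))"
  proof (intro ext)
    fix v y i
    have "(\<Sum>c<p. \<Sum>x<p. \<Sum>r<p ^ (2 * n). g c x r v y i) / of_nat (p ^ (2 * Suc n))
        = (\<Sum>c<p. \<Sum>x<p. (\<Sum>r<p ^ (2 * n). g c x r v y i) / of_nat (p ^ (2 * n))) / of_nat (p * p)"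
      by (simp add: sum_divide_distrib[symmetric] mult_ac)
    also have "\<dots> = (\<Sum>c<p. \<Sum>x<p. Q n (Suc k) (\<lambda>_ _. u) v (shift p m c x y) i) / of_nat (p * p)"
      unfolding g_def Suc.IH ..
    finally show "(\<Sum>c<p. \<Sum>x<p. \<Sum>r<p ^ (2 * n). g c x r v y i) / of_nat (p ^ (2 * Suc n)) = Y (Q n (Suc k) (\<lambda>_ _. u)) v y i"
      by (simp only: Y_def avgY_def)
  qed
  show ?case unfolding Q.simps M_def cs_def[symmetric] 1 2 3 4 ..
qed simp

lemma l2_sum_n3: "l2 L (\<lambda>i. \<Sum>v\<in>V. \<Sum>y\<in>G. \<psi> v y i) \<le> sqrt (real (q * q) * real (p ^ m)) * n3 \<psi>"
proof (rule power2_le_imp_le)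
  have "(cmod (\<Sum>v\<in>V. \<Sum>y\<in>G. \<psi> v y i))\<^sup>2 \<le> (real (q * q) * real (p ^ m)) * (\<Sum>v\<in>V. \<Sum>y\<in>G. (cmod (\<psi> v y i))\<^sup>2)" for i
  proof -
    have "cmod (\<Sum>x\<in>V \<times> G. (case x of (v, y) \<Rightarrow> \<psi> v y i)) \<le> sqrt (card (V \<times> G)) * l2 (V \<times> G) (\<lambda>(v, y). \<psi> v y i)"
      by (rule sum_sqrt_card)
    hence "(cmod (\<Sum>v\<in>V. \<Sum>y\<in>G. \<psi> v y i))\<^sup>2 \<le> (sqrt (card (V \<times> G)) * l2 (V \<times> G) (\<lambda>(v, y). \<psi> v y i))\<^sup>2"
      unfolding sum.cartesian_product by (rule power_mono) simp
    also have "\<dots> = (real (q * q) * real (p ^ m)) * (\<Sum>v\<in>V. \<Sum>y\<in>G. (cmod (\<psi> v y i))\<^sup>2)"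
      unfolding power_mult_distrib l2_sq sum.cartesian_product by (simp add: case_prod_beta)
    finally show ?thesis .
  qed
  hence "(\<Sum>i\<in>L. (cmod (\<Sum>v\<in>V. \<Sum>y\<in>G. \<psi> v y i))\<^sup>2) \<le> (\<Sum>i\<in>L. (real (q * q) * real (p ^ m)) * (\<Sum>v\<in>V. \<Sum>y\<in>G. (cmod (\<psi> v y i))\<^sup>2))"
    by (rule sum_mono)
  also have "\<dots> = (sqrt (real (q * q) * real (p ^ m)) * n3 \<psi>)\<^sup>2"
  proof -
    have "(\<Sum>i\<in>L. \<Sum>v\<in>V. \<Sum>y\<in>G. (cmod (\<psi> v y i))\<^sup>2) = (n3 \<psi>)\<^sup>2"
      unfolding n3_sq' l2_sq by (rule sum.swap)
    thus ?thesis unfolding power_mult_distrib sum_distrib_left[symmetric] by simp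
  qed
  finally show "(l2 L (\<lambda>i. \<Sum>v\<in>V. \<Sum>y\<in>G. \<psi> v y i))\<^sup>2 \<le> (sqrt (real (q * q) * real (p ^ m)) * n3 \<psi>)\<^sup>2"
    unfolding l2_sq .
qed simp

lemma n3_const: "n3 (\<lambda>_ _. u) = sqrt (real (q * q) * real (p ^ m)) * l2 L u"
  by (simp add: n3_def real_sqrt_mult mult.assoc)

text \<open>A closed form in place of the recursion: a single label is computed from its position,
  without storing the shifted vectors.\<close>

lemma labs_genrow:
  assumes "y \<in> G"
  shows "labs n k y r = concat (map (\<lambda>j. map (\<lambda>i. genrow p y r j (((k + j) mod s) * b + i)) [0..<b]) [0..<n])"
  using assms
proof (induction n arbitrary: k y r)
  case (Suc n)
  have lt: "((k + j) mod s) * b + i < m" if "i < b" for i j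
  proof -
    have "((k + j) mod s) * b + i < Suc ((k + j) mod s) * b" using that by simp
    also have "\<dots> \<le> s * b" using s by (intro mult_right_mono) (simp_all add: Suc_leI)
    finally show ?thesis by (simp only: m)
  qed
  have 1: "map y [(k mod s) * b..<(k mod s) * b + b] = map (\<lambda>i. genrow p y r 0 (((k + 0) mod s) * b + i)) [0..<b]"
  proof (rule nth_equalityI)
    fix i assume "i < length (map y [(k mod s) * b..<(k mod s) * b + b])"
    hence "i < b" by simp
    thus "map y [(k mod s) * b..<(k mod s) * b + b] ! i = map (\<lambda>i. genrow p y r 0 (((k + 0) mod s) * b + i)) [0..<b] ! i"
      using lt[of i 0] Suc.prems by (simp add: genrow_0)
  qed simp
  have 2: "labs n (Suc k) (shift p m (r mod p) ((r div p) mod p) y) (r div (p * p))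
     = concat (map (\<lambda>j. map (\<lambda>i. genrow p y r (Suc j) (((k + Suc j) mod s) * b + i)) [0..<b]) [0..<n])"
    unfolding Suc.IH[OF shift_in[OF p0]]
  proof (intro arg_cong[where f = concat] map_cong refl)
    fix j i assume "i \<in> set [0..<b]"
    thus "genrow p (shift p m (r mod p) (r div p mod p) y) (r div (p * p)) j ((Suc k + j) mod s * b + i)
       = genrow p y r (Suc j) ((k + Suc j) mod s * b + i)"
      using lt[of i "Suc j"] by (simp add: genrow_Suc)
  qed
  have 3: "[0..<Suc n] = 0 # map Suc [0..<n]" by (simp add: upt_conv_Cons map_Suc_upt del: upt_Suc)
  show ?case unfolding labs.simps 1 2 3 by (simp add: comp_def)
qed simp

definition lab :: "(nat \<Rightarrow> nat) \<Rightarrow> nat \<Rightarrow> nat \<Rightarrow> nat" where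
  "lab y r i = genrow p y r (i div b) (((i div b) mod s) * b + i mod b)"

lemma labs_eq:
  assumes "y \<in> G" "b > 0"
  shows "labs n 0 y r = map (lab y r) [0..<n * b]"
  unfolding labs_genrow[OF assms(1)] lab_def
  using concat_blocks[OF assms(2), of "\<lambda>j i. genrow p y r j ((j mod s) * b + i)" n] by simp

end

context wide_walk_gap
begin

text \<open>Cauchy-Schwarz over the start pairs costs \<open>sqrt R\<close>, and the state that is
  constantly \<open>u\<close> has \<open>sqrt R\<close> times the norm of \<open>u\<close>. The
  weight \<open>1 / R\<close> of the uniform average cancels both.\<close>

lemma word_avg:
  "l2 L (\<lambda>i. (\<Sum>v\<in>V. \<Sum>y\<in>G. \<Sum>r<p ^ (2 * (s * k)). runl (labs (s * k) 0 y r) v u i) / of_nat (q * q * p ^ m * p ^ (2 * (s * k))))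
    \<le> ((real s + 1)\<^sup>2 * lam2 ^ (s - 1)) ^ k * l2 L u"
proof -
  define R where "R = real (q * q) * real (p ^ m)"
  have R: "R > 0" using p0 q by (simp add: R_def)
  define \<psi> where "\<psi> = Q (s * k) 0 (\<lambda>_ _. u)"
  have "(\<Sum>v\<in>V. \<Sum>y\<in>G. \<Sum>r<p ^ (2 * (s * k)). runl (labs (s * k) 0 y r) v u i) / of_nat (q * q * p ^ m * p ^ (2 * (s * k)))
     = of_real (1 / R) * (\<Sum>v\<in>V. \<Sum>y\<in>G. \<psi> v y i)" for i
    unfolding \<psi>_def avg_runl[symmetric] R_def sum_divide_distrib[symmetric] by simp
  hence "l2 L (\<lambda>i. (\<Sum>v\<in>V. \<Sum>y\<in>G. \<Sum>r<p ^ (2 * (s * k)). runl (labs (s * k) 0 y r) v u i) / of_nat (q * q * p ^ m * p ^ (2 * (s * k))))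
     = l2 L (\<lambda>i. of_real (1 / R) * (\<Sum>v\<in>V. \<Sum>y\<in>G. \<psi> v y i))"
    by (rule l2_cong)
  also have "\<dots> = 1 / R * l2 L (\<lambda>i. \<Sum>v\<in>V. \<Sum>y\<in>G. \<psi> v y i)"
    unfolding l2_cmult norm_of_real using R by simp
  also have "\<dots> \<le> 1 / R * (sqrt R * n3 \<psi>)"
    unfolding R_def by (rule mult_left_mono[OF l2_sum_n3]) simp
  also have "\<dots> \<le> 1 / R * (sqrt R * (((real s + 1)\<^sup>2 * lam2 ^ (s - 1)) ^ k * (sqrt R * l2 L u)))"
  proof (intro mult_left_mono)
    show "n3 \<psi> \<le> ((real s + 1)\<^sup>2 * lam2 ^ (s - 1)) ^ k * (sqrt R * l2 L u)"
      unfolding \<psi>_def R_def n3_const[symmetric] by (rule n3_blocks)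
  qed (use R in auto)
  also have "\<dots> = (1 / R * (sqrt R * sqrt R)) * (((real s + 1)\<^sup>2 * lam2 ^ (s - 1)) ^ k * l2 L u)"
    by (simp only: mult_ac)
  also have "\<dots> = ((real s + 1)\<^sup>2 * lam2 ^ (s - 1)) ^ k * l2 L u"
  proof -
    have "1 / R * (sqrt R * sqrt R) = 1" using R by simp
    thus ?thesis by (simp only: mult_1_left)
  qed
  finally show ?thesis .
qed

end

section \<open>Bounded programs\<close>

datatype ex = V nat | N nat | Add ex ex | Sub ex ex | Ite ex ex ex
  | Let ex ex | Call ex ex ex ex | Rec ex ex ex

text \<open>Variables are numbered from the outermost binder inwards; the step of \<open>Rec\<close> binds the loop index and the
  accumulator, and \<open>Call\<close> starts a new frame with three variables. Loop counts are cut off at \<open>Z\<close>, which is kept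
  in cell 2 and is a power of the input size, so that every program runs in polynomial time.\<close>

primrec ev :: "nat \<Rightarrow> ex \<Rightarrow> nat list \<Rightarrow> nat" where
  "ev Z (V i) xs = (if i < length xs then xs ! i else 0)"
| "ev Z (N n) xs = n"
| "ev Z (Add a b) xs = ev Z a xs + ev Z b xs"
| "ev Z (Sub a b) xs = ev Z a xs - ev Z b xs"
| "ev Z (Ite c a b) xs = (if ev Z c xs \<noteq> 0 then ev Z a xs else ev Z b xs)"
| "ev Z (Let e b) xs = ev Z b (xs @ [ev Z e xs])"
| "ev Z (Call a b c f) xs = ev Z f [ev Z a xs, ev Z b xs, ev Z c xs]"
| "ev Z (Rec n z f) xs = rec_nat (ev Z z xs) (\<lambda>i acc. ev Z f (xs @ [i, acc])) (min (ev Z n xs) Z)"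

abbreviation "cell i \<equiv> Cell (Const i)"
abbreviation "set_cell i a \<equiv> Store (Const i) a"

text \<open>\<open>en\<close> lists the cells of the variables; \<open>r\<close> is the first free
  cell and receives the value. In a loop the cells \<open>r\<close>, \<open>r + 1\<close>,
  \<open>r + 2\<close> hold the bound, the accumulator and the index, and the double truncated
  subtraction is the minimum with the cutoff in cell 2.\<close>

primrec compile :: "ex \<Rightarrow> nat list \<Rightarrow> nat \<Rightarrow> com" where
  "compile (V i) en r = set_cell r (if i < length en then cell (en ! i) else Const 0)"
| "compile (N n) en r = set_cell r (Const n)"
| "compile (Add a b) en r = Seq (compile a en r) (Seq (compile b en (r + 1)) (set_cell r (Plus (cell r) (cell (r + 1)))))"
| "compile (Sub a b) en r = Seq (compile a en r) (Seq (compile b en (r + 1)) (set_cell r (Minus (cell r) (cell (r + 1)))))"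
| "compile (Ite c a b) en r = Seq (compile c en r) (If (cell r) (compile a en r) (compile b en r))"
| "compile (Let e b) en r = Seq (compile e en r) (Seq (compile b (en @ [r]) (r + 1)) (set_cell r (cell (r + 1))))"
| "compile (Call a b c f) en r = Seq (compile a en r) (Seq (compile b en (r + 1)) (Seq (compile c en (r + 2))
     (Seq (compile f [r, r + 1, r + 2] (r + 3)) (set_cell r (cell (r + 3))))))"
| "compile (Rec n z f) en r = Seq (compile n en r) (Seq (compile z en (r + 1))
     (Seq (set_cell r (Minus (cell r) (Minus (cell r) (cell 2)))) (Seq (set_cell (r + 2) (Const 0))
     (Seq (While (Minus (cell r) (cell (r + 2)))
        (Seq (compile f (en @ [r + 2, r + 1]) (r + 3)) (Seq (set_cell (r + 1) (cell (r + 3)))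
           (set_cell (r + 2) (Plus (cell (r + 2)) (Const 1))))))
      (set_cell r (cell (r + 1)))))))"

primrec cst :: "ex \<Rightarrow> nat" where
  "cst (V i) = 1"
| "cst (N n) = 1"
| "cst (Add a b) = cst a + cst b + 1"
| "cst (Sub a b) = cst a + cst b + 1"
| "cst (Ite c a b) = cst c + cst a + cst b + 1"
| "cst (Let e b) = cst e + cst b + 1"
| "cst (Call a b c f) = cst a + cst b + cst c + cst f + 1"
| "cst (Rec n z f) = cst n + cst z + cst f + 7"

text \<open>Loops are added up whether nested or not, so that one exponent dominates all
  subprograms; only polynomiality matters.\<close>

primrec dep :: "ex \<Rightarrow> nat" where
  "dep (V i) = 0"
| "dep (N n) = 0"
| "dep (Add a b) = dep a + dep b"
| "dep (Sub a b) = dep a + dep b"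
| "dep (Ite c a b) = dep c + dep a + dep b"
| "dep (Let e b) = dep e + dep b"
| "dep (Call a b c f) = dep a + dep b + dep c + dep f"
| "dep (Rec n z f) = dep n + dep z + dep f + 1"

definition bd :: "nat \<Rightarrow> ex \<Rightarrow> nat" where "bd Z e = cst e * (Z + 1) ^ dep e"

lemma bd_scale: "dep e \<le> d \<Longrightarrow> bd Z e \<le> cst e * (Z + 1) ^ d"
  unfolding bd_def by (intro mult_le_mono2 power_increasing) auto

definition computes :: "nat \<Rightarrow> ex \<Rightarrow> nat list \<Rightarrow> nat \<Rightarrow> bool" where
  "computes Z e en r \<longleftrightarrow> (\<forall>m out. m 2 = Z \<longrightarrow> (\<exists>T m'. exec (compile e en r) (m, out) T (m', out) \<and> T \<le> bd Z e \<and>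
     m' r = ev Z e (map m en) \<and> (\<forall>a<r. m' a = m a)))"

lemma computesE:
  assumes "computes Z e en r" "m 2 = Z"
  obtains T m' where "exec (compile e en r) (m, out) T (m', out)" "T \<le> bd Z e" "m' r = ev Z e (map m en)" "\<And>a. a < r \<Longrightarrow> m' a = m a"
  using assms unfolding computes_def by blast

lemma exec_set: "m' = m(i := aval m a) \<Longrightarrow> exec (set_cell i a) (m, out) 1 (m', out)"
  using exec.Store[of "Const i" a m out] by simp

lemma map_agree: "\<forall>a\<in>set en. a < r \<Longrightarrow> (\<And>a. a < r \<Longrightarrow> m' a = m a) \<Longrightarrow> map m' en = map m en"
  by auto

text \<open>The output after \<open>i\<close> rounds is a function \<open>out\<close> of
  \<open>i\<close>, so the rule serves both the silent loops of compiled expressions, with constant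
  \<open>out\<close>, and the loop that writes the words.\<close>

lemma exec_count:
  assumes body: "\<And>i m. i < n \<Longrightarrow> P i m \<Longrightarrow> m x = i \<Longrightarrow> m b = n \<Longrightarrow>
      \<exists>T m'. exec p (m, out i) T (m', out (Suc i)) \<and> T \<le> B \<and> P (Suc i) m' \<and> m' x = Suc i \<and> m' b = n"
    and "P i m" "m x = i" "m b = n" "i \<le> n"
  shows "\<exists>T m'. exec (While (Minus (cell b) (cell x)) p) (m, out i) T (m', out n) \<and> T \<le> (n - i) * (B + 1) + 1 \<and> P n m'"
  using assms(2-)
proof (induction "n - i" arbitrary: i m)
  case 0
  hence "i = n" by simp
  moreover have "exec (While (Minus (cell b) (cell x)) p) (m, out i) 1 (m, out i)"
    by (rule exec.WhileFalse) (use 0 \<open>i = n\<close> in simp)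
  ultimately show ?case using 0 by auto
next
  case (Suc k)
  have i: "i < n" using Suc by simp
  from body[OF i Suc.prems(1-3)] obtain T m' where 1: "exec p (m, out i) T (m', out (Suc i))" "T \<le> B" "P (Suc i) m'" "m' x = Suc i" "m' b = n" by blast
  have "k = n - Suc i" "Suc i \<le> n" using Suc.hyps(2) i by simp_all
  from Suc.hyps(1)[OF this(1) 1(3-5) this(2)] obtain T' m'' where 2: "exec (While (Minus (cell b) (cell x)) p) (m', out (Suc i)) T' (m'', out n)"
    "T' \<le> (n - Suc i) * (B + 1) + 1" "P n m''" by blast
  have "exec (While (Minus (cell b) (cell x)) p) (m, out i) (Suc (T + T')) (m'', out n)"
    by (rule exec.WhileTrue[OF _ 1(1) 2(1)]) (use Suc i in simp)
  moreover have "Suc (T + T') \<le> (n - i) * (B + 1) + 1"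
  proof -
    have "n - i = Suc (n - Suc i)" using i by simp
    thus ?thesis using 1(2) 2(2) by simp
  qed
  ultimately show ?case using 2(3) by blast
qed

lemma compile_binary:
  assumes en: "\<forall>a\<in>set en. a < r" "2 < r" and a: "computes Z a en r" and b: "computes Z b en (r + 1)"
    and opx: "\<And>m. aval m opx = g (m r) (m (r + 1))" and m: "m 2 = Z"
  shows "\<exists>T m'. exec (Seq (compile a en r) (Seq (compile b en (r + 1)) (set_cell r opx))) (m, out) T (m', out) \<and>
    T \<le> (cst a + cst b + 1) * (Z + 1) ^ (dep a + dep b) \<and>
    m' r = g (ev Z a (map m en)) (ev Z b (map m en)) \<and> (\<forall>a<r. m' a = m a)"
proof -
  obtain T1 m1 where 1: "exec (compile a en r) (m, out) T1 (m1, out)" "T1 \<le> bd Z a" "m1 r = ev Z a (map m en)" "\<And>a. a < r \<Longrightarrow> m1 a = m a"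
    by (rule computesE[where m = m and out = out, OF a m]) blast
  have "m1 2 = Z" using en m 1(4) by auto
  note m1 = this
  obtain T2 m2 where 2: "exec (compile b en (r + 1)) (m1, out) T2 (m2, out)" "T2 \<le> bd Z b" "m2 (r + 1) = ev Z b (map m1 en)" "\<And>a. a < r + 1 \<Longrightarrow> m2 a = m1 a"
    by (rule computesE[where m = m1 and out = out, OF b m1]) blast
  define m3 where "m3 = m2(r := g (m2 r) (m2 (r + 1)))"
  have "exec (Seq (compile a en r) (Seq (compile b en (r + 1)) (set_cell r opx))) (m, out) (T1 + (T2 + 1)) (m3, out)"
    by (rule exec.Seq[OF 1(1) exec.Seq[OF 2(1) exec_set]]) (simp only: m3_def opx)
  moreover have "T1 + (T2 + 1) \<le> (cst a + cst b + 1) * (Z + 1) ^ (dep a + dep b)"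
  proof -
    have "T1 \<le> cst a * (Z + 1) ^ (dep a + dep b)" "T2 \<le> cst b * (Z + 1) ^ (dep a + dep b)"
      using order_trans[OF 1(2) bd_scale] order_trans[OF 2(2) bd_scale] by simp_all
    moreover have "1 \<le> (Z + 1) ^ (dep a + dep b)" by simp
    ultimately show ?thesis unfolding add_mult_distrib by linarith
  qed
  moreover have "m3 r = g (ev Z a (map m en)) (ev Z b (map m en))" "\<forall>a<r. m3 a = m a"
    using 1 2 map_agree[OF en(1) 1(4)] by (auto simp: m3_def)
  ultimately show ?thesis by blast
qed

text \<open>Induction with \<open>en\<close> and \<open>r\<close> arbitrary, because subexpressions
  run in larger frames. A subprogram leaves the cells below its own \<open>r\<close> alone, so
  variables, earlier values and the cutoff in cell 2 survive.\<close>

lemma compile_correct: "\<forall>a\<in>set en. a < r \<Longrightarrow> 2 < r \<Longrightarrow> computes Z e en r"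
proof (induction e arbitrary: en r)
  case (V i)
  show ?case unfolding computes_def
    by (auto intro!: exI[of _ "Suc 0"] exec_set[unfolded One_nat_def] simp: bd_def)
next
  case (N n)
  show ?case unfolding computes_def
    by (auto intro!: exI[of _ "Suc 0"] exec_set[unfolded One_nat_def] simp: bd_def)
next
  case (Add a b)
  have "computes Z a en r" by (rule Add.IH(1)[OF Add.prems])
  moreover have "computes Z b en (r + 1)" by (rule Add.IH(2)) (use Add.prems in auto)
  ultimately show ?case unfolding computes_def[of Z "Add a b"] compile.simps bd_def cst.simps dep.simps ev.simps
    using Add.prems by (intro allI impI compile_binary[where g = "(+)"]) simp_all
next
  case (Sub a b)
  have "computes Z a en r" by (rule Sub.IH(1)[OF Sub.prems])
  moreover have "computes Z b en (r + 1)" by (rule Sub.IH(2)) (use Sub.prems in auto)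
  ultimately show ?case unfolding computes_def[of Z "Sub a b"] compile.simps bd_def cst.simps dep.simps ev.simps
    using Sub.prems by (intro allI impI compile_binary[where g = "(-)"]) simp_all
next
  case (Ite c a b)
  show ?case unfolding computes_def
  proof (intro allI impI)
    fix m :: "nat \<Rightarrow> nat" and out assume m: "m 2 = Z"
    obtain T1 m1 where 1: "exec (compile c en r) (m, out) T1 (m1, out)" "T1 \<le> bd Z c" "m1 r = ev Z c (map m en)" "\<And>a. a < r \<Longrightarrow> m1 a = m a"
      by (rule computesE[where m = m and out = out, OF Ite.IH(1)[OF Ite.prems] m]) blast
    have m1: "m1 2 = Z" using Ite.prems m 1(4) by auto
    let ?e = "if ev Z c (map m en) \<noteq> 0 then a else b"
    have cc: "computes Z ?e en r" using Ite.IH(2,3)[OF Ite.prems] by simp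
    obtain T2 m2 where 2: "exec (compile ?e en r) (m1, out) T2 (m2, out)" "T2 \<le> bd Z ?e" "m2 r = ev Z ?e (map m1 en)" "\<And>a. a < r \<Longrightarrow> m2 a = m1 a"
      by (rule computesE[where m = m1 and out = out, OF cc m1]) blast
    have "exec (If (cell r) (compile a en r) (compile b en r)) (m1, out) (Suc T2) (m2, out)"
    proof (cases "ev Z c (map m en) \<noteq> 0")
      case True
      thus ?thesis using 1(3) 2(1) by (intro exec.IfTrue) auto
    next
      case False
      thus ?thesis using 1(3) 2(1) by (intro exec.IfFalse) auto
    qed
    with 1(1) have "exec (compile (Ite c a b) en r) (m, out) (T1 + Suc T2) (m2, out)"
      unfolding compile.simps by (rule exec.Seq)
    moreover have "T1 + Suc T2 \<le> bd Z (Ite c a b)"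
    proof -
      have "T1 \<le> cst c * (Z + 1) ^ dep (Ite c a b)" "T2 \<le> cst ?e * (Z + 1) ^ dep (Ite c a b)"
        using order_trans[OF 1(2) bd_scale] order_trans[OF 2(2) bd_scale] by simp_all
      moreover have "cst ?e * (Z + 1) ^ dep (Ite c a b) \<le> (cst a + cst b) * (Z + 1) ^ dep (Ite c a b)"
        by (intro mult_le_mono1) simp
      moreover have "1 \<le> (Z + 1) ^ dep (Ite c a b)" by simp
      ultimately show ?thesis unfolding bd_def cst.simps add_mult_distrib by linarith
    qed
    moreover have "m2 r = ev Z (Ite c a b) (map m en)" "\<forall>a<r. m2 a = m a"
      using 1 2 map_agree[OF Ite.prems(1) 1(4)] by auto
    ultimately show "\<exists>T m'. exec (compile (Ite c a b) en r) (m, out) T (m', out) \<and> T \<le> bd Z (Ite c a b) \<and> m' r = ev Z (Ite c a b) (map m en) \<and> (\<forall>a<r. m' a = m a)"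
      by blast
  qed
next
  case (Let e b)
  show ?case unfolding computes_def
  proof (intro allI impI)
    fix m :: "nat \<Rightarrow> nat" and out assume m: "m 2 = Z"
    obtain T1 m1 where 1: "exec (compile e en r) (m, out) T1 (m1, out)" "T1 \<le> bd Z e" "m1 r = ev Z e (map m en)" "\<And>a. a < r \<Longrightarrow> m1 a = m a"
      by (rule computesE[where m = m and out = out, OF Let.IH(1)[OF Let.prems] m]) blast
    have h: "\<forall>a\<in>set (en @ [r]). a < r + 1" "2 < r + 1" "m1 2 = Z" using Let.prems m 1(4) by auto
    obtain T2 m2 where 2: "exec (compile b (en @ [r]) (r + 1)) (m1, out) T2 (m2, out)" "T2 \<le> bd Z b" "m2 (r + 1) = ev Z b (map m1 (en @ [r]))" "\<And>a. a < r + 1 \<Longrightarrow> m2 a = m1 a"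
      by (rule computesE[where m = m1 and out = out, OF Let.IH(2)[OF h(1,2)] h(3)]) blast
    define m3 where "m3 = m2(r := m2 (r + 1))"
    have "exec (compile (Let e b) en r) (m, out) (T1 + (T2 + 1)) (m3, out)"
      unfolding compile.simps by (rule exec.Seq[OF 1(1) exec.Seq[OF 2(1) exec_set]]) (simp add: m3_def)
    moreover have "T1 + (T2 + 1) \<le> bd Z (Let e b)"
    proof -
      have "T1 \<le> cst e * (Z + 1) ^ dep (Let e b)" "T2 \<le> cst b * (Z + 1) ^ dep (Let e b)"
        using order_trans[OF 1(2) bd_scale] order_trans[OF 2(2) bd_scale] by simp_all
      moreover have "1 \<le> (Z + 1) ^ dep (Let e b)" by simp
      ultimately show ?thesis unfolding bd_def cst.simps add_mult_distrib by linarith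
    qed
    moreover have "m3 r = ev Z (Let e b) (map m en)" "\<forall>a<r. m3 a = m a"
      using 1 2 map_agree[OF Let.prems(1) 1(4)] by (auto simp: m3_def)
    ultimately show "\<exists>T m'. exec (compile (Let e b) en r) (m, out) T (m', out) \<and> T \<le> bd Z (Let e b) \<and> m' r = ev Z (Let e b) (map m en) \<and> (\<forall>a<r. m' a = m a)"
      by blast
  qed
next
  case (Call a b c f)
  show ?case unfolding computes_def
  proof (intro allI impI)
    fix m :: "nat \<Rightarrow> nat" and out assume m: "m 2 = Z"
    obtain T1 m1 where 1: "exec (compile a en r) (m, out) T1 (m1, out)" "T1 \<le> bd Z a" "m1 r = ev Z a (map m en)" "\<And>a. a < r \<Longrightarrow> m1 a = m a"
      by (rule computesE[where m = m and out = out, OF Call.IH(1)[OF Call.prems] m]) blast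
    have h: "\<forall>a\<in>set en. a < r + 1" "2 < r + 1" "m1 2 = Z" using Call.prems m 1(4) by auto
    obtain T2 m2 where 2: "exec (compile b en (r + 1)) (m1, out) T2 (m2, out)" "T2 \<le> bd Z b" "m2 (r + 1) = ev Z b (map m1 en)" "\<And>a. a < r + 1 \<Longrightarrow> m2 a = m1 a"
      by (rule computesE[where m = m1 and out = out, OF Call.IH(2)[OF h(1,2)] h(3)]) blast
    have h: "\<forall>a\<in>set en. a < r + 2" "2 < r + 2" "m2 2 = Z" using Call.prems m 1(4) 2(4) by auto
    obtain T3 m3 where 3: "exec (compile c en (r + 2)) (m2, out) T3 (m3, out)" "T3 \<le> bd Z c" "m3 (r + 2) = ev Z c (map m2 en)" "\<And>a. a < r + 2 \<Longrightarrow> m3 a = m2 a"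
      by (rule computesE[where m = m2 and out = out, OF Call.IH(3)[OF h(1,2)] h(3)]) blast
    have h: "\<forall>a\<in>set [r, r + 1, r + 2]. a < r + 3" "2 < r + 3" "m3 2 = Z" using Call.prems m 1(4) 2(4) 3(4) by auto
    obtain T4 m4 where 4: "exec (compile f [r, r + 1, r + 2] (r + 3)) (m3, out) T4 (m4, out)" "T4 \<le> bd Z f" "m4 (r + 3) = ev Z f (map m3 [r, r + 1, r + 2])" "\<And>a. a < r + 3 \<Longrightarrow> m4 a = m3 a"
      by (rule computesE[where m = m3 and out = out, OF Call.IH(4)[OF h(1,2)] h(3)]) blast
    define m5 where "m5 = m4(r := m4 (r + 3))"
    have "exec (compile (Call a b c f) en r) (m, out) (T1 + (T2 + (T3 + (T4 + 1)))) (m5, out)"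
      unfolding compile.simps by (rule exec.Seq[OF 1(1) exec.Seq[OF 2(1) exec.Seq[OF 3(1) exec.Seq[OF 4(1) exec_set]]]]) (simp add: m5_def)
    moreover have "T1 + (T2 + (T3 + (T4 + 1))) \<le> bd Z (Call a b c f)"
    proof -
      have "T1 \<le> cst a * (Z + 1) ^ dep (Call a b c f)" "T2 \<le> cst b * (Z + 1) ^ dep (Call a b c f)"
        "T3 \<le> cst c * (Z + 1) ^ dep (Call a b c f)" "T4 \<le> cst f * (Z + 1) ^ dep (Call a b c f)"
        using order_trans[OF 1(2) bd_scale] order_trans[OF 2(2) bd_scale] order_trans[OF 3(2) bd_scale] order_trans[OF 4(2) bd_scale] by simp_all
      moreover have "1 \<le> (Z + 1) ^ dep (Call a b c f)" by simp
      ultimately show ?thesis unfolding bd_def cst.simps add_mult_distrib by linarith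
    qed
    moreover have "m5 r = ev Z (Call a b c f) (map m en)"
    proof -
      have me: "map m1 en = map m en" "map m2 en = map m en"
        using 1(4) 2(4) Call.prems by auto
      have "m3 r = m1 r" "m3 (r + 1) = m2 (r + 1)" using 2(4) 3(4) by simp_all
      hence "m3 r = ev Z a (map m en)" "m3 (r + 1) = ev Z b (map m en)" "m3 (r + 2) = ev Z c (map m en)"
        unfolding 1(3) 2(3) 3(3) me by (simp_all only:)
      thus ?thesis using 4(3) by (simp add: m5_def)
    qed
    moreover have "\<forall>a<r. m5 a = m a" using 1 2 3 4 by (auto simp: m5_def)
    ultimately show "\<exists>T m'. exec (compile (Call a b c f) en r) (m, out) T (m', out) \<and> T \<le> bd Z (Call a b c f) \<and> m' r = ev Z (Call a b c f) (map m en) \<and> (\<forall>a<r. m' a = m a)"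
      by blast
  qed
next
  case (Rec n z f)
  show ?case unfolding computes_def
  proof (intro allI impI)
    fix m :: "nat \<Rightarrow> nat" and out assume m: "m 2 = Z"
    define k where "k = min (ev Z n (map m en)) Z"
    obtain T1 m1 where 1: "exec (compile n en r) (m, out) T1 (m1, out)" "T1 \<le> bd Z n" "m1 r = ev Z n (map m en)" "\<And>a. a < r \<Longrightarrow> m1 a = m a"
      by (rule computesE[where m = m and out = out, OF Rec.IH(1)[OF Rec.prems] m]) blast
    have h: "\<forall>a\<in>set en. a < r + 1" "2 < r + 1" "m1 2 = Z" using Rec.prems m 1(4) by auto
    obtain T2 m2 where 2: "exec (compile z en (r + 1)) (m1, out) T2 (m2, out)" "T2 \<le> bd Z z" "m2 (r + 1) = ev Z z (map m1 en)" "\<And>a. a < r + 1 \<Longrightarrow> m2 a = m1 a"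
      by (rule computesE[where m = m1 and out = out, OF Rec.IH(2)[OF h(1,2)] h(3)]) blast
    define m3 where "m3 = m2(r := k, r + 2 := 0)"
    have s3: "exec (set_cell r (Minus (cell r) (Minus (cell r) (cell 2)))) (m2, out) 1 (m2(r := k), out)"
    proof (rule exec_set)
      have "m2 r = ev Z n (map m en)" "m2 2 = Z" using 1(3,4) 2(4) m Rec.prems(2) by simp_all
      moreover have "a - (a - Z) = min a Z" for a by simp
      ultimately show "m2(r := k) = m2(r := aval m2 (Minus (cell r) (Minus (cell r) (cell 2))))"
        by (simp only: k_def aval.simps)
    qed
    have s4: "exec (set_cell (r + 2) (Const 0)) (m2(r := k), out) 1 (m3, out)"
      by (rule exec_set) (simp add: m3_def)
    define g where "g i = rec_nat (ev Z z (map m en)) (\<lambda>i acc. ev Z f (map m en @ [i, acc])) i" for i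
    define P where "P i m' \<longleftrightarrow> m' (r + 1) = g i \<and> (\<forall>a<r. m' a = m a)" for i m'
    let ?body = "Seq (compile f (en @ [r + 2, r + 1]) (r + 3)) (Seq (set_cell (r + 1) (cell (r + 3))) (set_cell (r + 2) (Plus (cell (r + 2)) (Const 1))))"
    have me: "map m1 en = map m en" using 1(4) Rec.prems by auto
    have "\<exists>T m'. exec (While (Minus (cell r) (cell (r + 2))) ?body) (m3, out) T (m', out) \<and> T \<le> (k - 0) * ((bd Z f + 2) + 1) + 1 \<and> P k m'"
    proof (rule exec_count[where out = "\<lambda>_. out" and P = P])
      fix i m' assume i: "i < k" "P i m'" "m' (r + 2) = i" "m' r = k"
      have h: "\<forall>a\<in>set (en @ [r + 2, r + 1]). a < r + 3" "2 < r + 3" "m' 2 = Z" using Rec.prems m i by (auto simp: P_def)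
      obtain T4 m4 where 4: "exec (compile f (en @ [r + 2, r + 1]) (r + 3)) (m', out) T4 (m4, out)" "T4 \<le> bd Z f"
        "m4 (r + 3) = ev Z f (map m' (en @ [r + 2, r + 1]))" "\<And>a. a < r + 3 \<Longrightarrow> m4 a = m' a"
        by (rule computesE[where m = m' and out = out, OF Rec.IH(3)[OF h(1,2)] h(3)]) blast
      define m5 where "m5 = m4(r + 1 := m4 (r + 3), r + 2 := i + 1)"
      have "exec ?body (m', out) (T4 + (1 + 1)) (m5, out)"
        by (rule exec.Seq[OF 4(1) exec.Seq[OF exec_set[OF refl] exec_set]]) (use 4(4) i in \<open>simp add: m5_def\<close>)
      moreover have "P (Suc i) m5"
      proof -
        have mm: "map m' en = map m en" using i Rec.prems by (auto simp: P_def)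
        have "m' (r + 1) = g i" using i by (simp add: P_def)
        hence "map m' (en @ [r + 2, r + 1]) = map m en @ [i, g i]"
          by (simp only: map_append list.map mm i(3))
        hence "m4 (r + 3) = g (Suc i)" by (simp only: 4(3)) (simp add: g_def)
        thus ?thesis using 4(4) i(2) by (simp add: P_def m5_def)
      qed
      moreover have "m5 (r + 2) = Suc i" "m5 r = k" using 4 i by (auto simp: m5_def)
      ultimately show "\<exists>T m'a. exec ?body (m', out) T (m'a, out) \<and> T \<le> bd Z f + 2 \<and> P (Suc i) m'a \<and> m'a (r + 2) = Suc i \<and> m'a r = k"
        using 4(2) by (intro exI[of _ "T4 + (1 + 1)"] exI[of _ m5]) auto
    next
      show "P 0 m3" using 1 2 me by (auto simp: P_def m3_def g_def)
    qed (auto simp: m3_def)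
    then obtain T5 m5 where 5: "exec (While (Minus (cell r) (cell (r + 2))) ?body) (m3, out) T5 (m5, out)" "T5 \<le> (k - 0) * ((bd Z f + 2) + 1) + 1" "P k m5" by blast
    have T5: "T5 \<le> k * (bd Z f + 3) + 1" using 5(2) by (simp add: numeral_eq_Suc)
    define m6 where "m6 = m5(r := m5 (r + 1))"
    have "exec (compile (Rec n z f) en r) (m, out) (T1 + (T2 + (1 + (1 + (T5 + 1))))) (m6, out)"
      unfolding compile.simps by (rule exec.Seq[OF 1(1) exec.Seq[OF 2(1) exec.Seq[OF s3 exec.Seq[OF s4 exec.Seq[OF 5(1) exec_set]]]]]) (simp add: m6_def)
    moreover have "T1 + (T2 + (1 + (1 + (T5 + 1)))) \<le> bd Z (Rec n z f)"
    proof -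
      let ?D = "(Z + 1) ^ dep (Rec n z f)"
      have "T1 \<le> cst n * ?D" "T2 \<le> cst z * ?D"
        by (rule order_trans[OF 1(2) bd_scale], simp, rule order_trans[OF 2(2) bd_scale], simp)
      moreover have "k * (bd Z f + 3) \<le> (cst f + 3) * ?D"
      proof -
        have "k \<le> Z + 1" by (simp add: k_def)
        have "bd Z f \<le> cst f * (Z + 1) ^ (dep n + dep z + dep f)" by (rule bd_scale) simp
        moreover have "3 \<le> 3 * (Z + 1) ^ (dep n + dep z + dep f)" by simp
        ultimately have "bd Z f + 3 \<le> (cst f + 3) * (Z + 1) ^ (dep n + dep z + dep f)" unfolding add_mult_distrib by linarith
        hence "k * (bd Z f + 3) \<le> (Z + 1) * ((cst f + 3) * (Z + 1) ^ (dep n + dep z + dep f))"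
          using \<open>k \<le> Z + 1\<close> by (rule mult_le_mono[rotated])
        thus ?thesis by (simp add: algebra_simps)
      qed
      moreover have "1 \<le> ?D" by (intro one_le_power) simp
      ultimately show ?thesis using T5 unfolding bd_def cst.simps add_mult_distrib by linarith
    qed
    moreover have "m6 r = ev Z (Rec n z f) (map m en)" "\<forall>a<r. m6 a = m a"
      using 5(3) by (auto simp: P_def m6_def g_def k_def)
    ultimately show "\<exists>T m'. exec (compile (Rec n z f) en r) (m, out) T (m', out) \<and> T \<le> bd Z (Rec n z f) \<and> m' r = ev Z (Rec n z f) (map m en) \<and> (\<forall>a<r. m' a = m a)"
      by blast
  qed
qed

section \<open>The cutoff and the output loop\<close>

definition mul_ex :: ex where "mul_ex = Rec (V 0) (N 0) (Add (V 4) (V 1))"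

text \<open>The machine has no multiplication, so \<open>b\<close> is added \<open>a\<close> times.
  Only the first factor is a loop count and has to respect the cutoff.\<close>

lemma ev_mul: "a \<le> Z \<Longrightarrow> ev Z mul_ex [a, b, c] = a * b"
proof -
  assume "a \<le> Z"
  moreover have "rec_nat 0 (\<lambda>i acc. acc + b) a = a * b" by (induction a) auto
  ultimately show ?thesis by (simp add: mul_ex_def min_absorb1)
qed

definition sq_com :: com where
  "sq_com = Seq (compile mul_ex [2, 2, 2] 3) (set_cell 2 (cell 3))"

primrec cutoff_com :: "nat \<Rightarrow> com" where
  "cutoff_com 0 = set_cell 2 (Plus (cell 0) (cell 1))"
| "cutoff_com (Suc k) = Seq (cutoff_com k) sq_com"

text \<open>Each squaring runs under the previous cutoff \<open>z\<close>, which suffices because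
  its loop makes exactly \<open>z\<close> rounds. One squaring costs at most
  \<open>12 * (z + 1) + 1\<close> steps, within the allowance of 20.\<close>

lemma cutoff_exec:
  assumes "x + y > 0" and that: "m 0 = x" "m 1 = y"
  shows "\<exists>T m'. exec (cutoff_com k) (m, out) T (m', out) \<and> T \<le> (20 * k + 1) * ((x + y) ^ 2 ^ k + 1) ^ 2 \<and>
     m' 0 = x \<and> m' 1 = y \<and> m' 2 = (x + y) ^ 2 ^ k"
proof (induction k)
  case 0
  define m' where "m' = m(2 := x + y)"
  have "exec (cutoff_com 0) (m, out) 1 (m', out)"
    unfolding cutoff_com.simps by (rule exec_set) (use that in \<open>simp add: m'_def\<close>)
  moreover have "m' 0 = x" "m' 1 = y" "m' 2 = (x + y) ^ 2 ^ 0" using that by (simp_all add: m'_def)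
  moreover have "1 \<le> (20 * 0 + 1) * ((x + y) ^ 2 ^ 0 + 1) ^ 2" by simp
  ultimately show ?case by blast
next
  case (Suc k)
  define z where "z = (x + y) ^ 2 ^ k"
  then obtain T1 m1 where 1: "exec (cutoff_com k) (m, out) T1 (m1, out)" "T1 \<le> (20 * k + 1) * (z + 1) ^ 2"
     "m1 0 = x" "m1 1 = y" "m1 2 = z" using Suc by blast
  have cc: "computes z mul_ex [2, 2, 2] 3" by (rule compile_correct) auto
  obtain T2 m2 where 2: "exec (compile mul_ex [2, 2, 2] 3) (m1, out) T2 (m2, out)" "T2 \<le> bd z mul_ex" "m2 3 = ev z mul_ex (map m1 [2,2,2])" "\<And>a. a < 3 \<Longrightarrow> m2 a = m1 a"
    by (rule computesE[where m = m1 and out = out, OF cc 1(5)]) blast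
  define m3 where "m3 = m2(2 := m2 3)"
  have "exec (cutoff_com (Suc k)) (m, out) (T1 + (T2 + 1)) (m3, out)"
    unfolding cutoff_com.simps sq_com_def by (rule exec.Seq[OF 1(1) exec.Seq[OF 2(1) exec_set]]) (simp add: m3_def)
  moreover have "m3 2 = (x + y) ^ 2 ^ Suc k"
    using 1 2 by (simp add: m3_def ev_mul z_def power_mult_distrib[symmetric] power2_eq_square[symmetric] power_mult[symmetric] mult.commute)
  moreover have "T1 + (T2 + 1) \<le> (20 * Suc k + 1) * ((x + y) ^ 2 ^ Suc k + 1) ^ 2"
  proof -
    have "z \<le> (x + y) ^ 2 ^ Suc k" unfolding z_def by (rule power_increasing) (use assms in auto)
    hence le: "(z + 1) ^ 2 \<le> ((x + y) ^ 2 ^ Suc k + 1) ^ 2" by (intro power_mono) auto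
    have "bd z mul_ex = 12 * (z + 1)" by (simp add: bd_def mul_ex_def)
    also have "z + 1 \<le> (z + 1) ^ 2" by (simp add: power2_eq_square)
    finally have "T2 \<le> 12 * (z + 1) ^ 2" using 2(2) by simp
    moreover have "1 \<le> (z + 1) ^ 2" by simp
    ultimately have "T1 + (T2 + 1) \<le> (20 * Suc k + 1) * (z + 1) ^ 2"
      using 1(2) unfolding add_mult_distrib mult_Suc_right by linarith
    also have "\<dots> \<le> (20 * Suc k + 1) * ((x + y) ^ 2 ^ Suc k + 1) ^ 2" using le by (rule mult_le_mono2)
    finally show ?thesis .
  qed
  moreover have "m3 0 = x" "m3 1 = y" using 1 2 by (auto simp: m3_def)
  ultimately show ?case by blast
qed

text \<open>Cells 0 to 2 keep the inputs and the cutoff, cell 3 the number of entries and cell 4 the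
  position; each entry is computed afresh from its position.\<close>

definition main_com :: "nat \<Rightarrow> ex \<Rightarrow> ex \<Rightarrow> ex \<Rightarrow> com" where
  "main_com k te ne we = Seq (cutoff_com k) (Seq (compile te [0, 1] 3) (Seq (Emit (cell 3))
     (Seq (compile ne [0, 1] 3) (Seq (set_cell 4 (Const 0))
     (While (Minus (cell 3) (cell 4)) (Seq (compile we [0, 1, 4] 5) (Seq (Emit (cell 5)) (set_cell 4 (Plus (cell 4) (Const 1))))))))))"

text \<open>The output loop is not clipped by the cutoff, so its number of rounds has to be bounded
  by hypothesis \<open>n\<close>.\<close>

theorem main_com_runs:
  fixes x y k :: nat
  defines "Z \<equiv> (x + y) ^ 2 ^ k"
  assumes "x + y > 0" and n: "ev Z ne [x, y] \<le> Z"
  shows "\<exists>T. runs (main_com k te ne we) x y T (ev Z te [x, y] # map (\<lambda>i. ev Z we [x, y, i]) [0..<ev Z ne [x, y]]) \<and>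
     T \<le> (20 * k + cst te + cst ne + cst we + 10) * (Z + 1) ^ (dep te + dep ne + dep we + 2)"
proof -
  let ?t = "ev Z te [x, y]" and ?n = "ev Z ne [x, y]"
  let ?f = "\<lambda>i. ev Z we [x, y, i]"
  define m :: "nat \<Rightarrow> nat" where "m = (\<lambda>_. 0)(0 := x, 1 := y)"
  obtain T1 m1 where 1: "exec (cutoff_com k) (m, []) T1 (m1, [])" "T1 \<le> (20 * k + 1) * (Z + 1) ^ 2" "m1 0 = x" "m1 1 = y" "m1 2 = Z"
    using cutoff_exec[OF assms(2), of m k "[]"] by (auto simp: m_def Z_def)
  have cc: "computes Z te [0,1] 3" by (rule compile_correct) auto
  obtain T2 m2 where 2: "exec (compile te [0,1] 3) (m1, []) T2 (m2, [])" "T2 \<le> bd Z te" "m2 3 = ev Z te (map m1 [0,1])" "\<And>a. a < 3 \<Longrightarrow> m2 a = m1 a"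
    by (rule computesE[where m = m1 and out = "[]", OF cc 1(5)]) blast
  have m2: "m2 2 = Z" using 1 2 by simp
  have 3: "exec (Emit (cell 3)) (m2, []) 1 (m2, [?t])"
    using exec.Emit[of "cell 3" m2 "[]"] 1 2 by simp
  have cd: "computes Z ne [0,1] 3" by (rule compile_correct) auto
  obtain T4 m4 where 4: "exec (compile ne [0,1] 3) (m2, [?t]) T4 (m4, [?t])" "T4 \<le> bd Z ne" "m4 3 = ev Z ne (map m2 [0,1])" "\<And>a. a < 3 \<Longrightarrow> m4 a = m2 a"
    by (rule computesE[where m = m2 and out = "[?t]", OF cd m2]) blast
  define m5 where "m5 = m4(4 := 0)"
  have 5: "exec (set_cell 4 (Const 0)) (m4, [?t]) 1 (m5, [?t])" by (rule exec_set) (simp add: m5_def)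
  define P where "P i m' \<longleftrightarrow> m' 0 = x \<and> m' 1 = y \<and> m' 2 = Z" for i :: nat and m' :: "nat \<Rightarrow> nat"
  define out where "out i = ?t # map ?f [0..<i]" for i
  let ?body = "Seq (compile we [0, 1, 4] 5) (Seq (Emit (cell 5)) (set_cell 4 (Plus (cell 4) (Const 1))))"
  have "\<exists>T m'. exec (While (Minus (cell 3) (cell 4)) ?body) (m5, out 0) T (m', out ?n) \<and> T \<le> (?n - 0) * ((bd Z we + 2) + 1) + 1 \<and> P ?n m'"
  proof (rule exec_count[where P = P])
    fix i m' assume i: "i < ?n" "P i m'" "m' 4 = i" "m' 3 = ?n"
    have cc: "computes Z we [0,1,4] 5" by (rule compile_correct) auto
    have "m' 2 = Z" using i by (simp add: P_def)
    note mm = this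
    obtain T6 m6 where 6: "exec (compile we [0,1,4] 5) (m', out i) T6 (m6, out i)" "T6 \<le> bd Z we" "m6 5 = ev Z we (map m' [0,1,4])" "\<And>a. a < 5 \<Longrightarrow> m6 a = m' a"
      by (rule computesE[where m = m' and out = "out i", OF cc mm]) blast
    have 7: "exec (Emit (cell 5)) (m6, out i) 1 (m6, out (Suc i))"
      using exec.Emit[of "cell 5" m6 "out i"] 6(3) i by (simp add: out_def P_def)
    have 8: "exec (set_cell 4 (Plus (cell 4) (Const 1))) (m6, out (Suc i)) 1 (m6(4 := i + 1), out (Suc i))"
      by (rule exec_set) (use 6(4) i in simp)
    have "exec ?body (m', out i) (T6 + (1 + 1)) (m6(4 := i + 1), out (Suc i))"
      by (rule exec.Seq[OF 6(1) exec.Seq[OF 7 8]])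
    thus "\<exists>T m'a. exec ?body (m', out i) T (m'a, out (Suc i)) \<and> T \<le> bd Z we + 2 \<and> P (Suc i) m'a \<and> m'a 4 = Suc i \<and> m'a 3 = ?n"
      using 6 i by (intro exI[of _ "T6 + (1 + 1)"] exI[of _ "m6(4 := i + 1)"]) (auto simp: P_def)
  next
    show "P 0 m5" using 1 2 4 by (simp add: P_def m5_def)
    show "m5 3 = ?n" using 1 2 4 by (simp add: m5_def)
  qed (auto simp: m5_def)
  then obtain T6 m6 where 60: "exec (While (Minus (cell 3) (cell 4)) ?body) (m5, out 0) T6 (m6, out ?n)" "T6 \<le> (?n - 0) * ((bd Z we + 2) + 1) + 1"
    by blast
  have "out 0 = [?t]" by (simp add: out_def)
  with 60(1) have 61: "exec (While (Minus (cell 3) (cell 4)) ?body) (m5, [?t]) T6 (m6, out ?n)" by (simp only:)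
  have 62: "T6 \<le> ?n * (bd Z we + 3) + 1" using 60(2) by (simp add: numeral_eq_Suc)
  have "exec (main_com k te ne we) (m, []) (T1 + (T2 + (1 + (T4 + (1 + T6))))) (m6, out ?n)"
    unfolding main_com_def by (rule exec.Seq[OF 1(1) exec.Seq[OF 2(1) exec.Seq[OF 3 exec.Seq[OF 4(1) exec.Seq[OF 5 61]]]]])
  moreover have "T1 + (T2 + (1 + (T4 + (1 + T6)))) \<le> (20 * k + cst te + cst ne + cst we + 10) * (Z + 1) ^ (dep te + dep ne + dep we + 2)"
  proof -
    let ?D = "(Z + 1) ^ (dep te + dep ne + dep we + 2)"
    have "T1 \<le> (20 * k + 1) * ?D"
      by (rule order_trans[OF 1(2)], intro mult_le_mono2 power_increasing) auto
    moreover have "T2 \<le> cst te * ?D" "T4 \<le> cst ne * ?D"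
      by (rule order_trans[OF 2(2) bd_scale], simp, rule order_trans[OF 4(2) bd_scale], simp)
    moreover have "?n * (bd Z we + 3) \<le> (cst we + 3) * ?D"
    proof -
      have "bd Z we \<le> cst we * (Z + 1) ^ (dep te + dep ne + dep we + 1)" by (rule bd_scale) simp
      moreover have "3 * 1 \<le> 3 * (Z + 1) ^ (dep te + dep ne + dep we + 1)"
        by (intro mult_le_mono2 one_le_power) simp
      ultimately have "bd Z we + 3 \<le> (cst we + 3) * (Z + 1) ^ (dep te + dep ne + dep we + 1)" unfolding add_mult_distrib by linarith
      moreover have "?n \<le> Z + 1" using n by simp
      ultimately have "?n * (bd Z we + 3) \<le> (Z + 1) * ((cst we + 3) * (Z + 1) ^ (dep te + dep ne + dep we + 1))"
        by (intro mult_le_mono)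
      thus ?thesis by (simp add: algebra_simps)
    qed
    moreover have "1 \<le> ?D" by (intro one_le_power) simp
    ultimately show ?thesis using 62 unfolding add_mult_distrib by linarith
  qed
  ultimately show ?thesis unfolding runs_def m_def out_def by blast
qed

section \<open>Programs for the parameters and the letters\<close>

text \<open>Bounded search in the form of a loop without early exit: the least argument at which
  \<open>P\<close> fails, or \<open>n\<close> if there is none below \<open>n\<close>.\<close>

definition cnt :: "(nat \<Rightarrow> bool) \<Rightarrow> nat \<Rightarrow> nat" where
  "cnt P n = rec_nat 0 (\<lambda>i acc. if P acc then Suc acc else acc) n"

lemma cnt_le: "cnt P n \<le> n"
  by (induction n) (auto simp: cnt_def)

lemma cnt_below: "k < cnt P n \<Longrightarrow> P k"
proof (induction n)
  case (Suc n)
  thus ?case by (cases "P (cnt P n)") (auto simp: cnt_def less_Suc_eq)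
qed (simp add: cnt_def)

text \<open>If \<open>P\<close> still held at the final value, the counter would have advanced in
  every round and equal \<open>n\<close>, passing the failure at \<open>k\<close>.\<close>

lemma cnt_not:
  assumes "\<not> P k" "k \<le> n" shows "\<not> P (cnt P n)"
proof
  assume P: "P (cnt P n)"
  have "P (cnt P i) \<Longrightarrow> cnt P i = i" for i
  proof (induction i)
    case (Suc i)
    show ?case
    proof (cases "P (cnt P i)")
      case True
      thus ?thesis using Suc by (simp add: cnt_def)
    next
      case False
      hence "cnt P (Suc i) = cnt P i" by (simp add: cnt_def)
      thus ?thesis using Suc False by simp
    qed
  qed (simp add: cnt_def)
  with P have "cnt P n = n" by blast
  moreover have "k \<noteq> n" using assms P \<open>cnt P n = n\<close> by auto
  ultimately show False using cnt_below[of k P n] assms by auto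
qed

lemma cnt_eqI:
  assumes "\<not> P k" "k \<le> n" "\<And>j. j < k \<Longrightarrow> P j" shows "cnt P n = k"
proof (rule linorder_cases[of "cnt P n" k])
  assume "cnt P n < k"
  with assms(3)[OF this] cnt_not[of P, OF assms(1,2)] show ?thesis by blast
next
  assume "k < cnt P n"
  with cnt_below[of k P, OF this] assms(1) show ?thesis by blast
qed

lemma cnt_div: assumes "y > 0" shows "cnt (\<lambda>k. (k + 1) * y \<le> x) x = x div (y::nat)"
proof (rule cnt_eqI)
  show "\<not> (x div y + 1) * y \<le> x" using dividend_less_div_times[OF assms, of x] by simp
  show "(j + 1) * y \<le> x" if "j < x div y" for j
  proof -
    have "(j + 1) * y \<le> x div y * y" using that by (intro mult_le_mono1) simp
    also have "\<dots> \<le> x" by simp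
    finally show ?thesis .
  qed
qed simp

lemma ev_rec:
  assumes "ev Z n xs = k" "k \<le> Z" "ev Z z xs = h 0" "\<And>i. i < k \<Longrightarrow> ev Z f (xs @ [i, h i]) = h (Suc i)"
  shows "ev Z (Rec n z f) xs = h k"
proof -
  have "i \<le> k \<Longrightarrow> rec_nat (ev Z z xs) (\<lambda>i acc. ev Z f (xs @ [i, acc])) i = h i" for i
    by (induction i) (use assms in auto)
  thus ?thesis using assms by (simp add: min_absorb1)
qed

abbreviation "mulx a b \<equiv> Call a b (N 0) mul_ex"

definition pow_ex :: ex where "pow_ex = Rec (V 1) (N 1) (mulx (V 0) (V 4))"
abbreviation "powx a b \<equiv> Call a b (N 0) pow_ex"

text \<open>Every round adds the accumulator \<open>p\<close> times, so only \<open>p\<close> and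
  \<open>e\<close> are loop counts and the power itself may exceed the cutoff.\<close>

lemma ev_pow: "p \<le> Z \<Longrightarrow> e \<le> Z \<Longrightarrow> ev Z pow_ex [p, e, c] = p ^ e"
  unfolding pow_ex_def by (rule ev_rec[where h = "\<lambda>i. p ^ i"]) (auto simp: ev_mul)

definition mod_ex :: ex where "mod_ex = Rec (V 0) (V 0) (Ite (Sub (V 1) (V 4)) (V 4) (Sub (V 4) (V 1)))"
abbreviation "modx a b \<equiv> Call a b (N 0) mod_ex"

text \<open>Repeated subtraction that stalls at the remainder. As \<open>y > 0\<close>,
  \<open>x\<close> rounds are enough, and the dividend is the number that has to respect the
  cutoff.\<close>

lemma ev_mod:
  assumes "x \<le> Z" "y > 0" shows "ev Z mod_ex [x, y, c] = x mod y"
proof -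
  define h where "h i = (if i \<le> x div y then x - i * y else x mod y)" for i
  have "ev Z mod_ex [x, y, c] = h x" unfolding mod_ex_def
  proof (rule ev_rec[where h = h])
    fix i assume "i < x"
    have d: "x = x div y * y + x mod y" by simp
    have lt: "x mod y < y" using assms by simp
    consider "i < x div y" | "i = x div y" | "i > x div y" by linarith
    thus "ev Z (Ite (Sub (V 1) (V 4)) (V 4) (Sub (V 4) (V 1))) ([x, y, c] @ [i, h i]) = h (Suc i)"
    proof cases
      case 1
      have "Suc i * y \<le> x div y * y" using 1 by (intro mult_le_mono1) simp
      hence "Suc i * y \<le> x" using d by linarith
      hence "y \<le> x - i * y" by simp
      thus ?thesis using 1 by (simp add: h_def)
    next
      case 2
      have "x - x div y * y = x mod y" using d by linarith
      thus ?thesis using 2 lt by (simp add: h_def)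
    next
      case 3
      thus ?thesis using lt by (simp add: h_def)
    qed
  qed (use assms in \<open>auto simp: h_def\<close>)
  also have "h x = x mod y"
  proof (cases "x \<le> x div y")
    case True
    hence "x div y = x" by (simp add: le_antisym)
    moreover have "x - x div y * y = x mod y" by (rule minus_div_mult_eq_mod)
    ultimately show ?thesis by (simp add: h_def)
  qed (simp add: h_def)
  finally show ?thesis .
qed

lemma ev_modx: "ev Z a xs \<le> Z \<Longrightarrow> ev Z b xs > 0 \<Longrightarrow> ev Z (modx a b) xs = ev Z a xs mod ev Z b xs"
  by (simp add: ev_mod)

abbreviation "leq_ex a b \<equiv> Sub (Add b (N 1)) a"

lemma ev_cnt:
  assumes "ev Z n xs = k" "k \<le> Z" "length xs = 3" "\<And>i acc. acc \<le> k \<Longrightarrow> ev Z c (xs @ [i, acc]) \<noteq> 0 \<longleftrightarrow> P acc"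
  shows "ev Z (Rec n (N 0) (Ite c (Add (V 4) (N 1)) (V 4))) xs = cnt P k"
proof (rule ev_rec[OF assms(1,2), where h = "cnt P"])
  fix i assume "i < k"
  hence "cnt P i \<le> k" using cnt_le[of P i] by simp
  from assms(4)[OF this, of i]
  show "ev Z (Ite c (Add (V 4) (N 1)) (V 4)) (xs @ [i, cnt P i]) = cnt P (Suc i)"
    using assms(3) by (auto simp: nth_append cnt_def)
qed (simp add: cnt_def)

definition div_ex :: ex where
  "div_ex = Rec (V 0) (N 0) (Ite (leq_ex (mulx (V 1) (Add (V 4) (N 1))) (V 0)) (Add (V 4) (N 1)) (V 4))"
abbreviation "divx a b \<equiv> Call a b (N 0) div_ex"

lemma ev_div:
  assumes "x \<le> Z" "y > 0" "y \<le> Z" shows "ev Z div_ex [x, y, c] = x div y"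
proof -
  have "ev Z div_ex [x, y, c] = cnt (\<lambda>k. (k + 1) * y \<le> x) x"
    unfolding div_ex_def by (rule ev_cnt) (use assms in \<open>auto simp: ev_mul mult.commute\<close>)
  thus ?thesis using cnt_div[OF assms(2)] by simp
qed

definition digit_ex :: ex where
  "digit_ex = modx (divx (V 1) (powx (V 0) (V 2))) (V 0)"

lemma ev_digit:
  assumes "p > 0" "p \<le> Z" "r \<le> Z" "i \<le> Z" "p ^ i \<le> Z"
  shows "ev Z digit_ex [p, r, i] = digit p r i"
proof -
  have "r div p ^ i \<le> Z" using assms(3) div_le_dividend order_trans by blast
  thus ?thesis using assms by (simp add: digit_ex_def digit_def ev_mod ev_div ev_pow)
qed

text \<open>The bit length, that is, the least \<open>k\<close> with \<open>x < 2 ^ k\<close>. It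
  replaces the logarithm.\<close>

definition blen :: "nat \<Rightarrow> nat" where "blen x = cnt (\<lambda>k. 2 ^ k \<le> x) x"

definition blen_ex :: ex where
  "blen_ex = Rec (V 0) (N 0) (Ite (leq_ex (powx (N 2) (V 4)) (V 0)) (Add (V 4) (N 1)) (V 4))"

lemma ev_blen:
  assumes "x \<le> Z" "2 \<le> Z" shows "ev Z blen_ex [x, b, c] = blen x"
  unfolding blen_def blen_ex_def by (rule ev_cnt) (use assms in \<open>auto simp: ev_pow\<close>)

lemma blen_less: "x < 2 ^ blen x"
  unfolding blen_def using cnt_not[of "\<lambda>k. 2 ^ k \<le> x" x x] by (simp add: not_le del: One_nat_def)

lemma blen_ge: assumes "k < blen x" shows "2 ^ k \<le> x"
  using cnt_below[of k] assms unfolding blen_def by blast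

lemma blen_le: "blen x \<le> x" unfolding blen_def by (rule cnt_le)

definition prime_ex :: ex where
  "prime_ex = Rec (V 0) (Ite (Sub (V 0) (N 1)) (N 1) (N 0))
     (Ite (Sub (N 2) (V 3)) (V 4) (Ite (modx (V 0) (V 3)) (V 4) (N 0)))"

lemma ev_prime:
  assumes "c \<le> Z" shows "ev Z prime_ex [c, x, y] = (if prime c then 1 else 0)"
proof -
  define h where "h i = (if c \<ge> 2 \<and> (\<forall>d. 2 \<le> d \<longrightarrow> d < i \<longrightarrow> \<not> d dvd c) then 1 else 0 :: nat)" for i
  have "ev Z prime_ex [c, x, y] = h c" unfolding prime_ex_def
  proof (rule ev_rec[where h = h])
    fix i assume "i < c"
    show "ev Z (Ite (Sub (N 2) (V 3)) (V 4) (Ite (modx (V 0) (V 3)) (V 4) (N 0))) ([c, x, y] @ [i, h i]) = h (Suc i)"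
    proof (cases "i < 2")
      case True
      thus ?thesis by (auto simp: h_def)
    next
      case False
      hence "ev Z mod_ex [c, i, 0] = c mod i" using assms by (intro ev_mod) auto
      moreover have "h (Suc i) = (if i dvd c then 0 else h i)"
      proof (cases "i dvd c")
        case True
        hence "\<not> (\<forall>d. 2 \<le> d \<longrightarrow> d < Suc i \<longrightarrow> \<not> d dvd c)" using False by (intro notI) (drule spec[of _ i], simp)
        hence "h (Suc i) = 0" by (simp only: h_def) simp
        thus ?thesis using True by simp
      qed (auto simp: h_def less_Suc_eq)
      ultimately show ?thesis using False by (simp add: mod_eq_0_iff_dvd)
    qed
  qed (use assms in \<open>auto simp: h_def\<close>)
  also have "h c = (if prime c then 1 else 0)"
  proof -
    have "prime c \<longleftrightarrow> c \<ge> 2 \<and> (\<forall>d. 2 \<le> d \<longrightarrow> d < c \<longrightarrow> \<not> d dvd c)"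
    proof
      assume "prime c"
      thus "c \<ge> 2 \<and> (\<forall>d. 2 \<le> d \<longrightarrow> d < c \<longrightarrow> \<not> d dvd c)"
        using prime_ge_2_nat by (auto simp: prime_nat_iff)
    next
      assume a: "c \<ge> 2 \<and> (\<forall>d. 2 \<le> d \<longrightarrow> d < c \<longrightarrow> \<not> d dvd c)"
      show "prime c" unfolding prime_nat_iff
      proof (intro conjI allI impI)
        fix d assume d: "d dvd c"
        hence "d \<le> c" using a by (auto dest: dvd_imp_le)
        moreover have "d \<noteq> 0" by (rule notI) (use a d in simp)
        moreover have "\<not> (2 \<le> d \<and> d < c)" using a d by blast
        ultimately show "d = 1 \<or> d = c" by linarith
      qed (use a in simp)
    qed
    thus ?thesis by (simp add: h_def)
  qed
  finally show ?thesis .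
qed

text \<open>The largest prime between \<open>p0\<close> and \<open>u\<close>, with \<open>p0\<close>
  as default. It is applied to a bit length, which keeps trial division cheap; that it tends to
  infinity with \<open>u\<close> follows from the infinitude of primes.\<close>

definition pr :: "nat \<Rightarrow> nat \<Rightarrow> nat" where
  "pr p0 u = rec_nat p0 (\<lambda>i acc. if prime i \<and> p0 \<le> i then i else acc) (u + 1)"

lemma pr_props:
  "prime p0 \<Longrightarrow> prime (pr p0 u) \<and> p0 \<le> pr p0 u \<and> (pr p0 u = p0 \<or> pr p0 u \<le> u) \<and> (\<forall>x\<le>u. prime x \<longrightarrow> p0 \<le> x \<longrightarrow> x \<le> pr p0 u)"
proof (induction u)
  case 0
  thus ?case by (auto simp: pr_def)
next
  case (Suc u)
  have "pr p0 (Suc u) = (if prime (Suc u) \<and> p0 \<le> Suc u then Suc u else pr p0 u)" by (simp add: pr_def)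
  thus ?case using Suc by (auto simp: le_Suc_eq)
qed

definition pr_ex :: "nat \<Rightarrow> ex" where
  "pr_ex p0 = Rec (Add (V 0) (N 1)) (N p0) (Ite (Call (V 3) (N 0) (N 0) prime_ex) (Ite (leq_ex (N p0) (V 3)) (V 3) (V 4)) (V 4))"

lemma ev_pr:
  assumes "u + 1 \<le> Z" shows "ev Z (pr_ex p0) [u, x, y] = pr p0 u"
  unfolding pr_ex_def pr_def using assms by (intro ev_rec) (auto simp: ev_prime)

text \<open>The square root rounded up, so that a square grid of this side has at least
  \<open>x\<close> vertices.\<close>

definition side :: "nat \<Rightarrow> nat" where "side x = cnt (\<lambda>k. k * k < x) x"

definition side_ex :: ex where
  "side_ex = Rec (V 0) (N 0) (Ite (Sub (V 0) (mulx (V 4) (V 4))) (Add (V 4) (N 1)) (V 4))"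

lemma ev_side:
  assumes "x \<le> Z" shows "ev Z side_ex [x, b, c] = side x"
  unfolding side_def side_ex_def by (rule ev_cnt) (use assms in \<open>auto simp: ev_mul\<close>)

lemma side_sq: "x \<le> side x * side x"
proof -
  have "\<not> x * x < x" by (cases x) auto
  from cnt_not[of "\<lambda>k. k * k < x", OF this order_refl] show ?thesis by (simp add: side_def not_less)
qed

lemma side_less: assumes "x > 0" shows "(side x - 1) * (side x - 1) < x" "side x > 0"
proof -
  show "side x > 0" using side_sq[of x] assms by (cases "side x") auto
  thus "(side x - 1) * (side x - 1) < x" unfolding side_def using cnt_below[of "cnt (\<lambda>k. k * k < x) x - 1" "\<lambda>k. k * k < x" x] by simp
qed

text \<open>The least number of blocks that reaches \<open>L\<close> if each gains
  \<open>p ^ w\<close>.\<close>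

definition reps :: "nat \<Rightarrow> nat \<Rightarrow> nat \<Rightarrow> nat" where "reps p w L = cnt (\<lambda>k. p ^ (w * k) < L) L"

definition reps_ex :: ex where
  "reps_ex = Rec (V 2) (N 0) (Ite (Sub (V 2) (powx (V 0) (mulx (V 1) (V 4)))) (Add (V 4) (N 1)) (V 4))"

lemma ev_reps:
  assumes "L \<le> Z" "w \<le> Z" "p \<le> Z" "w * L \<le> Z" shows "ev Z reps_ex [p, w, L] = reps p w L"
proof -
  have "acc \<le> L \<Longrightarrow> w * acc \<le> Z" for acc using assms(4) mult_le_mono2 order_trans by blast
  thus ?thesis unfolding reps_def reps_ex_def
    by (intro ev_cnt) (use assms in \<open>auto simp: ev_mul ev_pow\<close>)
qed

lemma reps_ge: assumes "p \<ge> 2" "w > 0" shows "L \<le> p ^ (w * reps p w L)"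
proof -
  \<comment> \<open>The search is given \<open>L\<close> rounds, and here they are seen to
    suffice.\<close>
  have "L < 2 ^ L" by (rule less_exp)
  also have "\<dots> \<le> p ^ L" using assms by (intro power_mono) auto
  also have "\<dots> \<le> p ^ (w * L)" using assms by (intro power_increasing) auto
  finally have "\<not> p ^ (w * L) < L" by simp
  from cnt_not[of "\<lambda>k. p ^ (w * k) < L", OF this order_refl] show ?thesis by (simp add: reps_def not_less)
qed

lemma reps_less: assumes "k < reps p w L" shows "p ^ (w * k) < L"
  using cnt_below[of k] assms unfolding reps_def by blast

definition move_ex :: ex where
  "move_ex = Let (modx (V 2) (V 0)) (Let (divx (V 2) (V 0)) (Let (modx (V 1) (N 8)) (Let (modx (V 5) (N 2))
     (Let (Ite (modx (divx (V 5) (N 2)) (N 2)) (Sub (V 0) (N 1)) (N 1))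
      (Ite (Sub (N 4) (V 5))
         (Add (modx (Add (V 3) (mulx (V 7) (Add (Add (V 4) (V 4)) (V 6)))) (V 0)) (mulx (V 0) (V 4)))
         (Add (V 3) (mulx (V 0) (modx (Add (V 4) (mulx (V 7) (Add (Add (V 3) (V 3)) (V 6)))) (V 0)))))))))"

text \<open>A reduction takes as many rounds as its dividend, so the unreduced coordinate has to
  stay below the cutoff. It is at most \<open>q * (2 * q) + q * q\<close>, whence the factor
  3.\<close>

lemma ev_move:
  assumes q: "q > 0" "v < q * q" and Z: "8 \<le> Z" "a \<le> Z" "3 * (q * q) \<le> Z"
  shows "ev Z move_ex [q, a, v] = move q a v"
proof -
  define x y j e c where "x = v mod q" and "y = v div q" and "j = a mod 8" and "e = j mod 2"
    and "c = (if (j div 2) mod 2 = 0 then 1 else q - 1)"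
  have lt: "x < q" "y < q" using q by (auto simp: x_def y_def less_mult_imp_div_less)
  have e: "e \<le> 1" by (auto simp: e_def)
  have c: "c \<le> q" using q by (auto simp: c_def)
  have qq: "q \<le> q * q" using q by simp
  have b: "z + c * (2 * z' + e) \<le> Z" if "z < q" "z' < q" for z z'
  proof -
    have "c * (2 * z' + e) \<le> q * (2 * q)" using c that e by (intro mult_le_mono) auto
    moreover have "z \<le> q * q" using that qq by linarith
    moreover have "q * (2 * q) + q * q = 3 * (q * q)" by simp
    ultimately show ?thesis using Z by linarith
  qed
  have b1: "x + c * (y + y + e) \<le> Z" "y + c * (x + x + e) \<le> Z" using b[OF lt] b[OF lt(2,1)] by (simp_all add: mult_2)
  have qZ: "q \<le> Z" using qq Z(3) by linarith
  have bs: "v \<le> Z" "c \<le> Z" "j \<le> Z" "j div 2 \<le> Z" "2 \<le> Z" using q Z qZ c by (auto simp: j_def)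
  have c_ev: "ev Z (Ite (modx (divx (V 5) (N 2)) (N 2)) (Sub (V 0) (N 1)) (N 1)) [q, a, v, x, y, j, e] = c"
    using bs by (simp add: ev_div ev_mod c_def)
  have f_ev: "ev Z (Ite (Sub (N 4) (V 5))
         (Add (modx (Add (V 3) (mulx (V 7) (Add (Add (V 4) (V 4)) (V 6)))) (V 0)) (mulx (V 0) (V 4)))
         (Add (V 3) (mulx (V 0) (modx (Add (V 4) (mulx (V 7) (Add (Add (V 3) (V 3)) (V 6)))) (V 0))))) [q, a, v, x, y, j, e, c]
     = (if j < 4 then (x + c * (y + y + e)) mod q + q * y else x + q * ((y + c * (x + x + e)) mod q))"
    using bs b1 qZ q by (simp add: ev_mul ev_mod)
  have "ev Z (modx (V 2) (V 0)) [q, a, v] = x" "ev Z (divx (V 2) (V 0)) [q, a, v, x] = y"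
    "ev Z (modx (V 1) (N 8)) [q, a, v, x, y] = j" "ev Z (modx (V 5) (N 2)) [q, a, v, x, y, j] = e"
    using bs qZ q Z by (simp_all add: ev_mod ev_div x_def y_def j_def e_def)
  hence "ev Z move_ex [q, a, v] = (if j < 4 then (x + c * (y + y + e)) mod q + q * y else x + q * ((y + c * (x + x + e)) mod q))"
    unfolding move_ex_def by (simp only: ev.simps(6) append.simps c_ev f_ev)
  thus ?thesis by (simp add: move_def Let_def x_def y_def j_def e_def c_def mult_2)
qed


text \<open>\<open>genrow\<close> at the coordinate read in step \<open>i\<close>, with
  \<open>y\<close> given by the number whose base-\<open>p\<close> digits are its entries.\<close>

definition labf :: "nat \<Rightarrow> nat \<Rightarrow> nat \<Rightarrow> nat \<Rightarrow> nat \<Rightarrow> nat \<Rightarrow> nat" where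
  "labf p s b y r i = (let k = i div b; c = (k mod s) * b + i mod b in
     (digit p y c + (\<Sum>j<k. digit p r (2 * j) * digit p r (2 * j + 1) ^ c)) mod p)"

text \<open>The index \<open>w\<close> of a word is a mixed-radix number: start vertex, then
  \<open>y\<close>, then \<open>r\<close>. Entry \<open>i\<close> belongs to the vertex after
  \<open>t - i\<close> steps, because words list the walk backwards; these counts run from
  \<open>t\<close> down to 1, so the start vertex contributes no letter.\<close>

definition letter :: "nat \<Rightarrow> nat \<Rightarrow> nat \<Rightarrow> nat \<Rightarrow> nat \<Rightarrow> nat \<Rightarrow> nat \<Rightarrow> nat \<Rightarrow> nat" where
  "letter n q p s b t w i = (let J = w div (q * q); P = p ^ (s * b) in
     vtx q (labf p s b (J mod P) (J div P)) (w mod (q * q)) (t - i) mod n)"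

text \<open>Variables 3 to 9 of the following programs are \<open>p\<close>, \<open>ell\<close>, \<open>s\<close>, \<open>b\<close>, \<open>q\<close>, \<open>kk\<close>, \<open>t\<close> (see \<open>par_ex\<close>), variables 10
  to 17 are those bound in \<open>letter_ex\<close>.\<close>

definition lab_ex :: ex where
  "lab_ex = modx (Rec (V 20) (Call (V 3) (V 16) (V 21) digit_ex)
     (Add (V 23) (mulx (Call (V 3) (V 17) (Add (V 22) (V 22)) digit_ex)
        (powx (Call (V 3) (V 17) (Add (Add (V 22) (V 22)) (N 1)) digit_ex) (V 21))))) (V 3)"

definition step_ex :: ex where
  "step_ex = Let (divx (V 18) (V 6)) (Let (Add (mulx (modx (V 20) (V 5)) (V 6)) (modx (V 18) (V 6)))
     (Call (V 7) lab_ex (V 19) move_ex))"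

definition letter_ex :: ex where
  "letter_ex = Let (divx (V 2) (V 9)) (Let (modx (V 2) (V 9)) (Let (mulx (V 7) (V 7))
    (Let (modx (V 10) (V 12)) (Let (divx (V 10) (V 12)) (Let (powx (V 3) (mulx (V 5) (V 6)))
    (Let (modx (V 14) (V 15)) (Let (divx (V 14) (V 15))
      (modx (Rec (Sub (V 9) (V 11)) (V 13) step_ex) (V 0)))))))))"

text \<open>Mostly range checks. The number of output entries bounds every loop count: each is a
  factor of it, an exponent of such a factor, or is estimated against it.\<close>

lemma ev_letter:
  fixes n L p ell s b q kk K Z idx :: nat
  defines "K \<equiv> s * kk"
  defines "t \<equiv> K * b"
  defines "P \<equiv> p ^ (s * b)" and "R \<equiv> p ^ (2 * K)"
  assumes pos: "p \<ge> 8" "s > 0" "b > 0" "q > 0" "kk > 0" "n > 0"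
    and Z: "8 \<le> Z" "q * q * (P * R) * t \<le> Z" and idx: "idx < q * q * (P * R) * t"
  shows "ev Z letter_ex [n, L, idx, p, ell, s, b, q, kk, t] = letter n q p s b t (idx div t) (idx mod t)"
proof -
  have K: "K > 0" and t: "t > 0" using pos by (auto simp: K_def t_def)
  have P: "P > 0" and R: "R > 0" using pos by (auto simp: P_def R_def)
  define tot where "tot = q * q * (P * R)"
  have qq: "q * q > 0" using pos by simp
  have tot: "tot > 0" using qq P R by (simp add: tot_def)
  have totZ: "tot \<le> Z" using Z(2) t unfolding tot_def[symmetric] by (metis le_trans mult_le_mono2 nat_mult_1_right One_nat_def Suc_leI)
  have tZ: "t \<le> Z" using Z(2) tot unfolding tot_def[symmetric] by (metis le_trans mult_le_mono1 nat_mult_1 One_nat_def Suc_leI)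
  have PR: "P * R \<le> tot" unfolding tot_def using qq by simp
  have Pt: "P \<le> P * R" "R \<le> P * R" using P R by simp_all
  have PZ: "P \<le> Z" "R \<le> Z" using Pt PR totZ by linarith+
  have pP: "p \<le> P" unfolding P_def using self_le_power[of p "s * b"] pos by simp
  have pZ: "p \<le> Z" using pP PZ by simp
  have q3: "3 * (q * q) \<le> Z"
  proof -
    have "3 \<le> P * R" using pP pos Pt by linarith
    hence "3 * (q * q) \<le> tot" unfolding tot_def by (metis mult.commute mult_le_mono1)
    thus ?thesis using totZ by simp
  qed
  have qqZ: "q * q \<le> Z" using q3 by linarith
  have qZ: "q \<le> Z" using qqZ pos(4) by (metis le_trans le_square)
  have lexp: "x \<le> p ^ x" for x
  proof -
    have "x \<le> 2 ^ x" using less_exp[of x] by simp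
    also have "(2::nat) ^ x \<le> p ^ x" using pos by (intro power_mono) auto
    finally show ?thesis .
  qed
  have sbP: "s * b \<le> P" unfolding P_def by (rule lexp)
  have KR: "2 * K \<le> R" unfolding R_def by (rule lexp)
  have sZ: "s \<le> Z" "b \<le> Z" "s * b \<le> Z"
    using sbP PZ pos(2,3) by (metis le_trans nat_le_linear mult_le_mono2 nat_mult_1_right Suc_leI One_nat_def,
      metis le_trans mult_le_mono1 nat_mult_1 Suc_leI One_nat_def, linarith)
  define w i where "w = idx div t" and "i = idx mod t"
  have w: "w < tot" using idx t unfolding w_def tot_def by (simp add: less_mult_imp_div_less)
  have wZ: "w \<le> Z" using w totZ by simp
  define v0 J where "v0 = w mod (q * q)" and "J = w div (q * q)"
  have v0: "v0 < q * q" using qq by (simp add: v0_def)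
  have J: "J < P * R" using w qq unfolding J_def tot_def by (simp add: less_mult_imp_div_less mult.commute)
  have JZ: "J \<le> Z" using J PR totZ by linarith
  define y r where "y = J mod P" and "r = J div P"
  have y: "y < P" using P by (simp add: y_def)
  have r: "r < R" using J unfolding r_def by (simp add: less_mult_imp_div_less mult.commute)
  have idxZ: "idx \<le> Z" using idx Z by simp
  define en where "en = [n, L, idx, p, ell, s, b, q, kk, t, w, i, q * q, v0, J, P, y, r]"
  have lab: "ev Z lab_ex (en @ [j, acc, j div b, (j div b mod s) * b + j mod b]) = labf p s b y r j" if "j < t" for j acc
  proof -
    define k c where "k = j div b" and "c = (k mod s) * b + j mod b"
    have k: "k < K" using that unfolding k_def t_def by (simp add: less_mult_imp_div_less)
    have c: "c < s * b"
    proof -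
      have "c < Suc (k mod s) * b" using pos by (simp add: c_def)
      also have "\<dots> \<le> s * b" using pos by (intro mult_le_mono1) (simp add: Suc_leI)
      finally show ?thesis .
    qed
    have cZ: "c \<le> Z" using c sZ by linarith
    have pc: "p ^ c \<le> P" unfolding P_def using c pos by (intro power_increasing) auto
    have pk: "p ^ (2 * j') \<le> Z" "p ^ (2 * j' + 1) \<le> Z" "2 * j' + 1 \<le> Z" "digit p r j'' < p" if "j' < k" for j' j''
    proof -
      have "p ^ (2 * j') \<le> R" "p ^ (2 * j' + 1) \<le> R" unfolding R_def using that k pos by (intro power_increasing; simp)+
      thus "p ^ (2 * j') \<le> Z" "p ^ (2 * j' + 1) \<le> Z" using PZ by linarith+
      show "2 * j' + 1 \<le> Z" using that k KR PZ by linarith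
      show "digit p r j'' < p" using pos by (simp add: digit_def)
    qed
    define S where "S k = digit p y c + (\<Sum>j'<k. digit p r (2 * j') * digit p r (2 * j' + 1) ^ c)" for k
    have e1: "ev Z (Rec (V 20) (Call (V 3) (V 16) (V 21) digit_ex)
     (Add (V 23) (mulx (Call (V 3) (V 17) (Add (V 22) (V 22)) digit_ex)
        (powx (Call (V 3) (V 17) (Add (Add (V 22) (V 22)) (N 1)) digit_ex) (V 21))))) (en @ [j, acc, k, c]) = S k"
    proof (rule ev_rec[where h = S])
      show "k \<le> Z" using k KR PZ by linarith
      show "ev Z (Call (V 3) (V 16) (V 21) digit_ex) (en @ [j, acc, k, c]) = S 0"
        using pos pZ PZ y cZ pc by (simp add: en_def S_def ev_digit)
      fix j' assume j': "j' < k"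
      have "digit p r (2 * j') \<le> Z" "digit p r (2 * j' + 1) \<le> Z" "2 * j' \<le> Z" "r \<le> Z"
        using pk[OF j'] pZ r PZ by (meson le_trans less_imp_le_nat le_add1)+
      moreover have "0 < p" using pos by simp
      moreover have "ev Z digit_ex [p, r, j' + j'] = digit p r (2 * j')" "ev Z digit_ex [p, r, j' + j' + 1] = digit p r (2 * j' + 1)"
        using ev_digit[of p Z r "2 * j'"] ev_digit[of p Z r "2 * j' + 1"] calculation pZ pk[OF j'] by (simp_all only: mult_2)
      ultimately show "ev Z (Add (V 23) (mulx (Call (V 3) (V 17) (Add (V 22) (V 22)) digit_ex)
        (powx (Call (V 3) (V 17) (Add (Add (V 22) (V 22)) (N 1)) digit_ex) (V 21)))) ((en @ [j, acc, k, c]) @ [j', S j']) = S (Suc j')"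
        using cZ by (simp add: en_def S_def ev_mul ev_pow)
    qed (simp add: en_def)
    \<comment> \<open>The label is reduced only once, after the summation, so the whole sum must
      respect the cutoff. It has at most \<open>K\<close> shift terms of size \<open>p * P\<close>,
      and \<open>p\<^sup>2 \<le> R\<close> because \<open>K > 0\<close>.\<close>
    have SZ: "S k \<le> Z"
    proof -
      have d: "digit p r x \<le> p" for x using pos by (simp add: digit_def less_imp_le_nat)
      have "digit p r (2 * j') * digit p r (2 * j' + 1) ^ c \<le> p * P" for j'
      proof (rule mult_le_mono[OF d])
        have "digit p r (2 * j' + 1) ^ c \<le> p ^ c" by (intro power_mono d) simp
        thus "digit p r (2 * j' + 1) ^ c \<le> P" using pc by linarith
      qed
      hence "(\<Sum>j'<k. digit p r (2 * j') * digit p r (2 * j' + 1) ^ c) \<le> (\<Sum>j'<k. p * P)" by (intro sum_mono)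
      also have "\<dots> \<le> K * (p * P)" using k by simp
      finally have "S k \<le> p + K * (p * P)" using d[of c] pos unfolding S_def
        by (smt (verit) add_mono digit_def mod_less_divisor less_imp_le_nat zero_less_numeral order_less_le_trans)
      also have "\<dots> \<le> 2 * (K * (p * P))" using K P by (simp add: Suc_leI)
      also have "\<dots> \<le> p * (K * (p * P))" using pos by (intro mult_le_mono1) simp
      also have "\<dots> = (P * (p ^ 2)) * K" by (simp add: power2_eq_square)
      also have "\<dots> \<le> (q * q * (P * R)) * t"
      proof (rule mult_le_mono)
        have "p ^ 2 \<le> R" unfolding R_def using K pos by (intro power_increasing) auto
        hence "P * p ^ 2 \<le> P * R" by simp
        thus "P * p\<^sup>2 \<le> q * q * (P * R)" using PR unfolding tot_def by linarith
        show "K \<le> t" unfolding t_def using pos by simp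
      qed
      finally show ?thesis using Z by linarith
    qed
    have "ev Z lab_ex (en @ [j, acc, k, c]) = S k mod p"
    proof -
      have v3: "ev Z (V 3) (en @ [j, acc, k, c]) = p" by (simp add: en_def)
      have pp: "0 < p" using pos by simp
      show ?thesis unfolding lab_ex_def by (subst ev_modx) (simp_all only: e1 v3 SZ pp)
    qed
    thus ?thesis by (simp add: S_def labf_def k_def c_def Let_def)
  qed
  have step: "ev Z step_ex (en @ [j, vtx q (labf p s b y r) v0 j]) = vtx q (labf p s b y r) v0 (Suc j)" if "j < t" for j
  proof -
    define acc where "acc = vtx q (labf p s b y r) v0 j"
    have acc: "acc < q * q" unfolding acc_def by (rule vtx_less[OF pos(4) v0])
    have jZ: "j \<le> Z" "j div b \<le> Z" using that tZ by (auto intro: order_trans[OF div_le_dividend])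
    have l: "labf p s b y r j \<le> Z"
    proof -
      have "labf p s b y r j < p" using pos by (simp add: labf_def Let_def)
      thus ?thesis using pZ by linarith
    qed
    have ms: "j div b mod s \<le> Z" using jZ by (meson le_trans mod_less_eq_dividend)
    have e1: "ev Z (divx (V 18) (V 6)) (en @ [j, acc]) = j div b"
      using pos jZ sZ by (simp add: en_def ev_div)
    have e2: "ev Z (Add (mulx (modx (V 20) (V 5)) (V 6)) (modx (V 18) (V 6))) (en @ [j, acc, j div b]) = (j div b mod s) * b + j mod b"
      using pos jZ sZ ms by (simp add: en_def ev_mod ev_mul)
    have e3: "ev Z (V 7) (en @ [j, acc, j div b, (j div b mod s) * b + j mod b]) = q" 
      "ev Z (V 19) (en @ [j, acc, j div b, (j div b mod s) * b + j mod b]) = acc" by (simp_all add: en_def)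
    have "ev Z step_ex (en @ [j, acc]) = ev Z move_ex [q, labf p s b y r j, acc]"
      unfolding step_ex_def using e1 e2 lab[OF that, of acc] by (simp only: ev.simps(6,7) append_assoc append.simps e3)
    also have "\<dots> = move q (labf p s b y r j) acc"
      by (rule ev_move[OF pos(4) acc Z(1) l q3])
    finally show ?thesis by (simp add: acc_def)
  qed
  have e0: "ev Z (divx (V 2) (V 9)) [n, L, idx, p, ell, s, b, q, kk, t] = w"
    "ev Z (modx (V 2) (V 9)) [n, L, idx, p, ell, s, b, q, kk, t, w] = i"
    "ev Z (mulx (V 7) (V 7)) [n, L, idx, p, ell, s, b, q, kk, t, w, i] = q * q"
    "ev Z (modx (V 10) (V 12)) [n, L, idx, p, ell, s, b, q, kk, t, w, i, q * q] = v0"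
    "ev Z (divx (V 10) (V 12)) [n, L, idx, p, ell, s, b, q, kk, t, w, i, q * q, v0] = J"
    "ev Z (powx (V 3) (mulx (V 5) (V 6))) [n, L, idx, p, ell, s, b, q, kk, t, w, i, q * q, v0, J] = P"
    "ev Z (modx (V 14) (V 15)) [n, L, idx, p, ell, s, b, q, kk, t, w, i, q * q, v0, J, P] = y"
    "ev Z (divx (V 14) (V 15)) [n, L, idx, p, ell, s, b, q, kk, t, w, i, q * q, v0, J, P, y] = r"
    using idxZ t tZ qZ wZ qq qqZ sZ pZ JZ P PZ
    by (simp_all add: ev_div ev_mod ev_mul ev_pow w_def i_def v0_def J_def y_def r_def P_def[symmetric])
  have rec: "ev Z (Rec (Sub (V 9) (V 11)) (V 13) step_ex) en = vtx q (labf p s b y r) v0 (t - i)"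
  proof (rule ev_rec[where h = "vtx q (labf p s b y r) v0"])
    show "ev Z (Sub (V 9) (V 11)) en = t - i" by (simp add: en_def)
    show "t - i \<le> Z" using tZ by simp
    show "ev Z (V 13) en = vtx q (labf p s b y r) v0 0" by (simp add: en_def)
    show "ev Z step_ex (en @ [j, vtx q (labf p s b y r) v0 j]) = vtx q (labf p s b y r) v0 (Suc j)" if "j < t - i" for j
      using that by (intro step) simp
  qed
  have "ev Z (modx (Rec (Sub (V 9) (V 11)) (V 13) step_ex) (V 0)) en = vtx q (labf p s b y r) v0 (t - i) mod n"
  proof -
    have "vtx q (labf p s b y r) v0 (t - i) \<le> Z" using vtx_less[OF pos(4) v0, of _ "t - i"] qqZ by (meson le_trans less_imp_le_nat)
    moreover have "ev Z (V 0) en = n" by (simp add: en_def)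
    ultimately show ?thesis using pos(6) by (subst ev_modx) (simp_all only: rec)
  qed
  hence "ev Z letter_ex [n, L, idx, p, ell, s, b, q, kk, t] = vtx q (labf p s b y r) v0 (t - i) mod n"
    unfolding letter_ex_def by (simp only: ev.simps(6) append.simps e0 en_def)
  thus ?thesis by (simp add: letter_def Let_def w_def i_def v0_def J_def y_def r_def P_def)
qed

text \<open>The choice of parameters: \<open>p\<close> is a prime near or below the logarithm of
  \<open>1 / \<lambda>\<close>, up to the threshold \<open>p0\<close>; \<open>ell\<close> and
  \<open>s\<close> are its bit length and the bit length of that; \<open>b = 2 * ell\<^sup>2\<close>
  makes \<open>b\<close> outer steps contract below \<open>1 / p\<close>; \<open>kk\<close> blocks
  reach the target.\<close>

definition par_ex :: "nat \<Rightarrow> nat \<Rightarrow> ex \<Rightarrow> ex" where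
  "par_ex p0 K0 body = Let (Call (Call (V 1) (N 0) (N 0) blen_ex) (N 0) (N 0) (pr_ex p0))
    (Let (Call (V 3) (N 0) (N 0) blen_ex) (Let (Call (V 4) (N 0) (N 0) blen_ex)
    (Let (mulx (V 4) (Add (V 4) (V 4))) (Let (Call (mulx (N K0) (V 0)) (N 0) (N 0) side_ex)
    (Let (Call (V 3) (Sub (V 5) (N 2)) (V 1) reps_ex) (Let (mulx (mulx (V 5) (V 8)) (V 6)) body))))))"

lemma ev_par:
  fixes p0 K0 n L :: nat
  defines "p \<equiv> pr p0 (blen L)"
  defines "ell \<equiv> blen p"
  defines "s \<equiv> blen ell"
  defines "b \<equiv> ell * (ell + ell)"
  defines "q \<equiv> side (K0 * n)"
  defines "kk \<equiv> reps p (s - 2) L"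
  defines "t \<equiv> s * kk * b"
  assumes Z: "L + 2 \<le> Z" "p \<le> Z" "K0 \<le> Z" "K0 * n \<le> Z" "s * L \<le> Z"
  shows "ev Z (par_ex p0 K0 body) [n, L, idx] = ev Z body [n, L, idx, p, ell, s, b, q, kk, t]"
proof -
  have l: "ell \<le> Z" "s \<le> Z" using Z(2) blen_le[of p] blen_le[of ell] by (auto simp: ell_def s_def)
  have "kk \<le> L" unfolding kk_def reps_def by (rule cnt_le)
  hence "s * kk \<le> s * L" by simp
  hence sk: "s * kk \<le> Z" using Z by linarith
  have "(s - 2) * L \<le> s * L" by (intro mult_le_mono1) simp
  hence sl: "(s - 2) * L \<le> Z" using Z by linarith
  have bl: "blen L + 1 \<le> Z" using Z blen_le[of L] by linarith
  have "ev Z (Call (Call (V 1) (N 0) (N 0) blen_ex) (N 0) (N 0) (pr_ex p0)) [n, L, idx] = p"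
    "ev Z (Call (V 3) (N 0) (N 0) blen_ex) [n, L, idx, p] = ell"
    "ev Z (Call (V 4) (N 0) (N 0) blen_ex) [n, L, idx, p, ell] = s"
    "ev Z (mulx (V 4) (Add (V 4) (V 4))) [n, L, idx, p, ell, s] = b"
    "ev Z (Call (mulx (N K0) (V 0)) (N 0) (N 0) side_ex) [n, L, idx, p, ell, s, b] = q"
    "ev Z (Call (V 3) (Sub (V 5) (N 2)) (V 1) reps_ex) [n, L, idx, p, ell, s, b, q] = kk"
    "ev Z (mulx (mulx (V 5) (V 8)) (V 6)) [n, L, idx, p, ell, s, b, q, kk] = t"
    using l sk sl bl Z
    by (simp_all add: ev_blen ev_pr ev_mul ev_side ev_reps p_def[symmetric] ell_def[symmetric] s_def[symmetric] b_def q_def kk_def t_def)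
  thus ?thesis unfolding par_ex_def by (simp only: ev.simps(6) append.simps)
qed

definition count_ex :: ex where
  "count_ex = mulx (mulx (mulx (V 7) (V 7)) (mulx (powx (V 3) (mulx (V 5) (V 6))) (powx (V 3) (mulx (N 2) (mulx (V 5) (V 8)))))) (V 9)"

lemma ev_count:
  assumes "q \<le> Z" "q * q \<le> Z" "p \<le> Z" "s \<le> Z" "s * b \<le> Z" "2 \<le> Z" "2 * (s * kk) \<le> Z" "p ^ (s * b) \<le> Z"
    "q * q * (p ^ (s * b) * p ^ (2 * (s * kk))) \<le> Z"
  shows "ev Z count_ex [n, L, idx, p, ell, s, b, q, kk, t] = q * q * (p ^ (s * b) * p ^ (2 * (s * kk))) * t"
  unfolding count_ex_def using assms by (simp add: ev_mul ev_pow)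

section \<open>Amplification\<close>

hide_const (open) ex.V ex.N ex.Add ex.Sub ex.Ite ex.Let ex.Call ex.Rec

section \<open>Matrices as operators and the averages of word matrices\<close>

definition mapp :: "nat \<Rightarrow> complex mat \<Rightarrow> (nat \<Rightarrow> complex) \<Rightarrow> nat \<Rightarrow> complex" where
  "mapp l A x i = (\<Sum>j<l. A $$ (i, j) * x j)"

lemma vec_norm2_l2: "vec_norm2 v = l2 {..<dim_vec v} (\<lambda>i. v $ i)"
  by (simp add: vec_norm2_def l2_def)

lemma vec_norm2_mult:
  assumes "A \<in> carrier_mat l l" "v \<in> carrier_vec l"
  shows "vec_norm2 (A *\<^sub>v v) = l2 {..<l} (mapp l A (\<lambda>j. v $ j))"
proof -
  have "(A *\<^sub>v v) $ i = mapp l A (\<lambda>j. v $ j) i" if "i < l" for i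
    using assms that by (simp add: mapp_def scalar_prod_def lessThan_atLeast0)
  moreover have d: "dim_vec (A *\<^sub>v v) = l" using assms by simp
  ultimately show ?thesis unfolding vec_norm2_l2 d by (intro l2_cong) (simp only: lessThan_iff)
qed

lemma l2_mapp_le: "l2 {..<l} (mapp l A x) \<le> (\<Sum>j<l. l2 {..<l} (\<lambda>i. A $$ (i, j))) * l2 {..<l} x"
proof -
  have "l2 {..<l} (mapp l A x) = l2 {..<l} (\<lambda>i. \<Sum>j<l. x j * A $$ (i, j))"
    by (rule l2_cong) (simp add: mapp_def mult.commute)
  also have "\<dots> \<le> (\<Sum>j<l. l2 {..<l} (\<lambda>i. x j * A $$ (i, j)))" by (rule l2_sum)
  also have "\<dots> \<le> (\<Sum>j<l. l2 {..<l} x * l2 {..<l} (\<lambda>i. A $$ (i, j)))"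
  proof (intro sum_mono)
    fix j assume "j \<in> {..<l}"
    hence "cmod (x j) \<le> l2 {..<l} x" unfolding l2_def using member_le_L2_set[of "{..<l}" j "\<lambda>i. cmod (x i)"] by simp
    thus "l2 {..<l} (\<lambda>i. x j * A $$ (i, j)) \<le> l2 {..<l} x * l2 {..<l} (\<lambda>i. A $$ (i, j))"
      unfolding l2_cmult by (rule mult_right_mono) simp
  qed
  finally show ?thesis by (simp add: sum_distrib_left mult.commute)
qed

text \<open>A real supremum is informative only for a bounded set, so the crude bound by column
  norms in \<open>l2_mapp_le\<close> is needed before scaling to the unit ball. The same bound
  settles vectors of norm 0, which cannot be scaled.\<close>

lemma op_norm_bound:
  assumes A: "A \<in> carrier_mat l l" and c: "op_norm A \<le> c"
  shows "l2 {..<l} (mapp l A x) \<le> c * l2 {..<l} x"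
proof -
  let ?U = "{v \<in> carrier_vec (dim_col A). vec_norm2 v \<le> 1}"
  have le: "vec_norm2 (A *\<^sub>v v) \<le> c" if v: "v \<in> ?U" for v
  proof -
    have "bdd_above ((\<lambda>v. vec_norm2 (A *\<^sub>v v)) ` ?U)"
    proof (rule bdd_aboveI2)
      fix v assume "v \<in> ?U"
      hence v: "v \<in> carrier_vec l" "l2 {..<l} (\<lambda>j. v $ j) \<le> 1" using A by (auto simp: vec_norm2_l2)
      have "vec_norm2 (A *\<^sub>v v) \<le> (\<Sum>j<l. l2 {..<l} (\<lambda>i. A $$ (i, j))) * l2 {..<l} (\<lambda>j. v $ j)"
        unfolding vec_norm2_mult[OF A v(1)] by (rule l2_mapp_le)
      also have "\<dots> \<le> (\<Sum>j<l. l2 {..<l} (\<lambda>i. A $$ (i, j))) * 1"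
        by (intro mult_left_mono v sum_nonneg) simp
      finally show "vec_norm2 (A *\<^sub>v v) \<le> (\<Sum>j<l. l2 {..<l} (\<lambda>i. A $$ (i, j)))" by simp
    qed
    from cSUP_upper[OF v this] have "vec_norm2 (A *\<^sub>v v) \<le> op_norm A" by (simp add: op_norm_def)
    thus ?thesis using c by simp
  qed
  define n where "n = l2 {..<l} x"
  have n0: "n \<ge> 0" by (simp add: n_def)
  show ?thesis
  proof (cases "n = 0")
    case True
    have "l2 {..<l} (mapp l A x) \<le> (\<Sum>j<l. l2 {..<l} (\<lambda>i. A $$ (i, j))) * n" unfolding n_def by (rule l2_mapp_le)
    hence "l2 {..<l} (mapp l A x) \<le> 0" using True by simp
    thus ?thesis using True by (simp add: n_def)
  next
    case False
    hence n: "n > 0" using n0 by simp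
    define v where "v = vec l (\<lambda>j. of_real (1 / n) * x j)"
    have v: "v \<in> carrier_vec l" by (simp add: v_def)
    have "vec_norm2 v = l2 {..<l} (\<lambda>j. of_real (1 / n) * x j)"
    proof -
      have d: "dim_vec v = l" by (simp add: v_def)
      show ?thesis unfolding vec_norm2_l2 d by (rule l2_cong) (simp add: v_def)
    qed
    also have "\<dots> = 1" unfolding l2_cmult n_def[symmetric] norm_of_real using n by simp
    finally have "v \<in> ?U" using A v by simp
    from le[OF this] have "l2 {..<l} (mapp l A (\<lambda>j. v $ j)) \<le> c" unfolding vec_norm2_mult[OF A v] .
    also have "l2 {..<l} (mapp l A (\<lambda>j. v $ j)) = l2 {..<l} (\<lambda>i. of_real (1 / n) * mapp l A x i)"
    proof (rule l2_cong)
      fix i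
      show "mapp l A (\<lambda>j. v $ j) i = of_real (1 / n) * mapp l A x i"
        unfolding mapp_def sum_distrib_left by (intro sum.cong refl) (simp add: v_def)
    qed
    also have "\<dots> = 1 / n * l2 {..<l} (mapp l A x)" unfolding l2_cmult norm_of_real using n by simp
    finally show ?thesis using n by (simp add: n_def field_simps)
  qed
qed

lemma op_norm_leI:
  assumes A: "A \<in> carrier_mat l l" and c: "c \<ge> 0" and le: "\<And>x. l2 {..<l} (mapp l A x) \<le> c * l2 {..<l} x"
  shows "op_norm A \<le> c"
  unfolding op_norm_def
proof (rule cSUP_least)
  have "vec_norm2 (0\<^sub>v l) = 0" by (simp add: vec_norm2_def L2_set_def)
  thus "{v \<in> carrier_vec (dim_col A). vec_norm2 v \<le> 1} \<noteq> {}" using A by (auto intro!: exI[of _ "0\<^sub>v l"])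
  fix v assume "v \<in> {v \<in> carrier_vec (dim_col A). vec_norm2 v \<le> 1}"
  hence v: "v \<in> carrier_vec l" "l2 {..<l} (\<lambda>j. v $ j) \<le> 1" using A by (auto simp: vec_norm2_l2)
  have "vec_norm2 (A *\<^sub>v v) \<le> c * l2 {..<l} (\<lambda>j. v $ j)" unfolding vec_norm2_mult[OF A v(1)] by (rule le)
  also have "\<dots> \<le> c * 1" by (intro mult_left_mono v c)
  finally show "vec_norm2 (A *\<^sub>v v) \<le> c" by simp
qed

lemma word_mat_snoc: "word_mat l f (w @ [a]) = f a * word_mat l f w"
  by (simp add: word_mat_def)

lemma word_mat_carrier:
  assumes "\<And>a. a \<in> set w \<Longrightarrow> f a \<in> carrier_mat l l"
  shows "word_mat l f w \<in> carrier_mat l l"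
  using assms by (induction w rule: rev_induct) (auto simp: word_mat_snoc intro!: mult_carrier_mat, simp add: word_mat_def)

text \<open>\<open>word_mat\<close> puts the first letter rightmost and the word is a reversed list,
  so the head of \<open>vs\<close> ends up outermost, as in \<open>foldr\<close>.\<close>

lemma mapp_word_mat:
  assumes "\<And>v. v \<in> set vs \<Longrightarrow> f (g v) \<in> carrier_mat l l" "i < l"
  shows "mapp l (word_mat l f (rev (map g vs))) x i = foldr (\<lambda>v. mapp l (f (g v))) vs x i"
  using assms
proof (induction vs arbitrary: i)
  case Nil
  have "mapp l (1\<^sub>m l) x i = (\<Sum>j<l. if i = j then x j else 0)"
    unfolding mapp_def using Nil by (intro sum.cong refl) auto
  thus ?case using Nil by (simp add: word_mat_def)
next
  case (Cons v vs)
  let ?W = "word_mat l f (rev (map g vs))"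
  have W: "?W \<in> carrier_mat l l" by (rule word_mat_carrier) (use Cons.prems in auto)
  have fv: "f (g v) \<in> carrier_mat l l" using Cons.prems by simp
  have "mapp l (word_mat l f (rev (map g (v # vs)))) x i = (\<Sum>j<l. (\<Sum>k<l. f (g v) $$ (i, k) * ?W $$ (k, j)) * x j)"
    unfolding mapp_def using W fv Cons.prems(2) by (simp add: word_mat_snoc scalar_prod_def lessThan_atLeast0)
  also have "\<dots> = (\<Sum>k<l. f (g v) $$ (i, k) * mapp l ?W x k)"
    unfolding mapp_def sum_distrib_left sum_distrib_right by (subst sum.swap) (simp add: mult.assoc)
  also have "\<dots> = (\<Sum>k<l. f (g v) $$ (i, k) * foldr (\<lambda>v. mapp l (f (g v))) vs x k)"
    by (intro sum.cong refl arg_cong2[where f = "(*)"] Cons.IH) (use Cons.prems in auto)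
  also have "\<dots> = mapp l (f (g v)) (foldr (\<lambda>v. mapp l (f (g v))) vs x) i"
    by (subst mapp_def[of l "f (g v)" "foldr (\<lambda>v. mapp l (f (g v))) vs x"]) (rule refl)
  finally show ?case by (simp only: foldr.simps comp_apply)
qed

lemma mat_expectation_carrier: "mat_expectation l X g \<in> carrier_mat l l"
  by (simp add: mat_expectation_def)

lemma sum_mset_list: "(\<Sum>x\<in>#mset xs. g x) = (\<Sum>x\<leftarrow>xs. g x)"
  by (simp flip: sum_mset_sum_list)

lemma mapp_expectation:
  assumes "i < l"
  shows "mapp l (mat_expectation l (mset (map h [0..<n])) g) x i = (\<Sum>k<n. mapp l (g (h k)) x i) / of_nat n"
proof -
  have "(\<Sum>y\<in>#mset (map h [0..<n]). g y $$ (i, j)) = (\<Sum>k<n. g (h k) $$ (i, j))" for j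
    by (simp only: sum_mset_list map_map) (simp add: interv_sum_list_conv_sum_set_nat lessThan_atLeast0 comp_def)
  hence "mapp l (mat_expectation l (mset (map h [0..<n])) g) x i = (\<Sum>j<l. (\<Sum>k<n. g (h k) $$ (i, j)) / of_nat n * x j)"
    unfolding mapp_def mat_expectation_def using assms by simp
  also have "\<dots> = (\<Sum>k<n. mapp l (g (h k)) x i) / of_nat n"
    unfolding mapp_def sum_distrib_right sum_divide_distrib by (subst sum.swap) (simp add: field_simps)
  finally show ?thesis .
qed

text \<open>With labels \<open>v mod n\<close> every letter occurs \<open>N div n\<close> times, and
  the first \<open>N mod n\<close> letters occur once more.\<close>

lemma sum_mod_block:
  fixes g :: "nat \<Rightarrow> complex"
  assumes "n > 0"
  shows "(\<Sum>v<N. g (v mod n)) = of_nat (N div n) * (\<Sum>k<n. g k) + (\<Sum>k<N mod n. g k)"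
proof -
  have "(\<Sum>v<n * a + r. g (v mod n)) = of_nat a * (\<Sum>k<n. g k) + (\<Sum>k<r. g k)" if "r < n" for a r
  proof -
    have 1: "(\<Sum>v<n * a. g (v mod n)) = (\<Sum>x<n. \<Sum>y<a. g x)"
      unfolding sum_split[OF assms] by (intro sum.cong refl) simp
    have "(\<Sum>v<n * a + r. g (v mod n)) = (\<Sum>v<n * a. g (v mod n)) + (\<Sum>v<r. g ((n * a + v) mod n))"
      by (induction r) simp_all
    moreover have "(\<Sum>v<r. g ((n * a + v) mod n)) = (\<Sum>k<r. g k)"
      by (intro sum.cong refl) (use that in simp)
    ultimately show ?thesis using 1 by (simp add: sum_distrib_left)
  qed
  from this[of "N mod n" "N div n"] show ?thesis using assms by (simp add: mult.commute)
qed

lemma letters_visited: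
  assumes i: "i < t" and len: "length as = t" and as: "\<And>j. j < t \<Longrightarrow> as ! j = labf p s b (J mod p ^ (s * b)) (J div p ^ (s * b)) j"
    and J: "J = w div (q * q)"
  shows "letter n q p s b t w i = rev (map (\<lambda>v. v mod n) (visited q as (w mod (q * q)))) ! i"
proof -
  have "rev (map (\<lambda>v. v mod n) (visited q as (w mod (q * q)))) ! i = visited q as (w mod (q * q)) ! (t - Suc i) mod n"
    using i len by (simp add: rev_nth)
  also have "visited q as (w mod (q * q)) ! (t - Suc i) = vtx q (\<lambda>j. as ! j) (w mod (q * q)) (Suc (t - Suc i))"
    by (rule visited_nth) (use i len in simp)
  also have "Suc (t - Suc i) = t - i" using i by simp
  also have "vtx q (\<lambda>j. as ! j) (w mod (q * q)) (t - i) = vtx q (labf p s b (J mod p ^ (s * b)) (J div p ^ (s * b))) (w mod (q * q)) (t - i)"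
    by (rule vtx_cong) (use as in simp)
  finally show ?thesis by (simp add: letter_def Let_def J)
qed

text \<open>Vertices are labelled by residues mod \<open>n\<close>. Half of the gap
  \<open>1 - \<rho>0\<close> pays for the uneven labelling, so the walk runs with bias
  \<open>(1 + \<rho>0) / 2\<close>; this is why \<open>\<kappa>\<close> contains
  \<open>(1 - \<rho>0) / 2\<close>.\<close>

theorem amplify:
  fixes f :: "'a \<Rightarrow> complex mat" and e :: "nat \<Rightarrow> 'a" and \<rho>0 :: real
  defines "\<kappa> \<equiv> sqrt (1 - 39/800 * ((1 - \<rho>0) / 2)\<^sup>2)"
  assumes n: "n > 0" and q: "q > 0" and p: "prime p" "p \<ge> 200" and sb: "s > 0" "b = 2 * b'" "b' > 0"
    and \<rho>: "0 < \<rho>0" "\<rho>0 < 1" and qn: "2 * real n \<le> (1 - \<rho>0) * real (q * q)"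
    and gap: "\<kappa> ^ b' \<le> real (s * b) / real p" and mp: "s * b \<le> p"
    and f: "\<And>k. k < n \<Longrightarrow> f (e k) \<in> carrier_mat l l" "\<And>k. k < n \<Longrightarrow> op_norm (f (e k)) \<le> 1"
    and avg: "op_norm (mat_expectation l (mset (map e [0..<n])) f) \<le> \<rho>0"
    and t: "t = s * kk * b" and tot: "tot = q * q * (p ^ (s * b) * p ^ (2 * (s * kk)))"
  shows "op_norm (mat_expectation l (mset (map (\<lambda>w. map e (map (letter n q p s b t w) [0..<t])) [0..<tot])) (word_mat l f))
     \<le> ((real s + 1)\<^sup>2 * (real (s * b) / real p) ^ (s - 1)) ^ kk"
proof -
  define m where "m = s * b"
  define F where "F v = f (e (v mod n))" for v
  have F: "F v \<in> carrier_mat l l" "op_norm (F v) \<le> 1" for v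
    using f[of "v mod n"] n by (auto simp: F_def)
  define N where "N = q * q"
  have N: "N > 0" using q by (simp add: N_def)
  have avgx: "l2 {..<l} (\<lambda>i. (\<Sum>k<n. mapp l (f (e k)) x i) / of_nat n) \<le> \<rho>0 * l2 {..<l} x" for x
  proof -
    have "l2 {..<l} (\<lambda>i. (\<Sum>k<n. mapp l (f (e k)) x i) / of_nat n) = l2 {..<l} (mapp l (mat_expectation l (mset (map e [0..<n])) f) x)"
      by (rule l2_cong) (simp only: mapp_expectation lessThan_iff)
    also have "\<dots> \<le> \<rho>0 * l2 {..<l} x" by (rule op_norm_bound[OF mat_expectation_carrier avg])
    finally show ?thesis .
  qed
  \<comment> \<open>Complete runs of \<open>n\<close> vertices have bias at most
    \<open>\<rho>0\<close>; the fewer than \<open>n\<close> remaining vertices have weight at most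
    \<open>n / N\<close>, which \<open>qn\<close> bounds by
    \<open>(1 - \<rho>0) / 2\<close>.\<close>
  have meanF: "l2 {..<l} (\<lambda>i. mean {..<q*q} (\<lambda>v. \<Sum>j<l. F v $$ (i, j) * x j)) \<le> (1 + \<rho>0) / 2 * l2 {..<l} x" for x
  proof -
    define g where "g k i = mapp l (f (e k)) x i" for k i
    have g: "l2 {..<l} (g k) \<le> l2 {..<l} x" if "k < n" for k
      unfolding g_def using op_norm_bound[OF f(1)[OF that] f(2)[OF that], of x] by simp
    define a r where "a = N div n" and "r = N mod n"
    have anr: "N = a * n + r" "r < n" using n by (simp_all add: a_def r_def)
    have eq: "mean {..<q*q} (\<lambda>v. \<Sum>j<l. F v $$ (i, j) * x j) = of_real (real (a * n) / real N) * ((\<Sum>k<n. g k i) / of_nat n) + of_real (1 / real N) * (\<Sum>k<r. g k i)" for i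
    proof -
      have "(\<Sum>v<N. \<Sum>j<l. F v $$ (i, j) * x j) = (\<Sum>v<N. g (v mod n) i)" by (simp add: F_def g_def mapp_def)
      also have "\<dots> = of_nat a * (\<Sum>k<n. g k i) + (\<Sum>k<r. g k i)"
        unfolding a_def r_def by (rule sum_mod_block[OF n])
      finally show ?thesis using n unfolding mean_def N_def[symmetric] by (simp add: add_divide_distrib)
    qed
    have "l2 {..<l} (\<lambda>i. mean {..<q*q} (\<lambda>v. \<Sum>j<l. F v $$ (i, j) * x j))
       \<le> l2 {..<l} (\<lambda>i. of_real (real (a * n) / real N) * ((\<Sum>k<n. g k i) / of_nat n)) + l2 {..<l} (\<lambda>i. of_real (1 / real N) * (\<Sum>k<r. g k i))"
      unfolding eq by (rule l2_add)
    also have "\<dots> = real (a * n) / real N * l2 {..<l} (\<lambda>i. (\<Sum>k<n. g k i) / of_nat n) + 1 / real N * l2 {..<l} (\<lambda>i. \<Sum>k<r. g k i)"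
      unfolding l2_cmult norm_of_real by simp
    also have "\<dots> \<le> 1 * (\<rho>0 * l2 {..<l} x) + 1 / real N * (real n * l2 {..<l} x)"
    proof (intro add_mono mult_mono)
      have "a * n \<le> N" using anr by simp
      hence "real (a * n) \<le> real N" by (simp only: of_nat_le_iff)
      thus "real (a * n) / real N \<le> 1" using N by (simp del: of_nat_mult)
      show "l2 {..<l} (\<lambda>i. (\<Sum>k<n. g k i) / of_nat n) \<le> \<rho>0 * l2 {..<l} x" unfolding g_def by (rule avgx)
      have "l2 {..<l} (\<lambda>i. \<Sum>k<r. g k i) \<le> (\<Sum>k<r. l2 {..<l} (g k))" by (rule l2_sum)
      also have "\<dots> \<le> (\<Sum>k<r. l2 {..<l} x)" by (intro sum_mono g) (use anr in simp)
      also have "\<dots> \<le> real n * l2 {..<l} x" using anr by (simp add: mult_right_mono)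
      finally show "l2 {..<l} (\<lambda>i. \<Sum>k<r. g k i) \<le> real n * l2 {..<l} x" .
    qed (use \<rho> in auto)
    also have "\<dots> = (\<rho>0 + real n / real N) * l2 {..<l} x" by (simp add: algebra_simps)
    also have "\<dots> \<le> (1 + \<rho>0) / 2 * l2 {..<l} x"
    proof (rule mult_right_mono)
      have "real n / real N \<le> (1 - \<rho>0) / 2" using qn N unfolding N_def[symmetric] by (simp add: field_simps)
      thus "\<rho>0 + real n / real N \<le> (1 + \<rho>0) / 2" by (simp add: field_simps)
    qed simp
    finally show ?thesis .
  qed
  interpret opwalk q p m l "\<lambda>v i j. F v $$ (i, j)" "(1 + \<rho>0) / 2"
  proof
    show "l2 {..<l} (\<lambda>i. \<Sum>j<l. F v $$ (i, j) * x j) \<le> l2 {..<l} x" for v x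
      using op_norm_bound[OF F, of v x] by (simp add: mapp_def[abs_def])
  qed (use q p \<rho> meanF in auto)
  interpret wide_walk q p m l "\<lambda>v i j. F v $$ (i, j)" "(1 + \<rho>0) / 2" s b
    by unfold_locales (use sb in \<open>auto simp: m_def\<close>)
  have kap: "kap = \<kappa>"
  proof -
    have "1 - (1 + \<rho>0) / 2 = (1 - \<rho>0) / 2" by (simp add: field_simps)
    thus ?thesis by (simp only: kap_def \<kappa>_def)
  qed
  interpret wide_walk_gap q p m l "\<lambda>v i j. F v $$ (i, j)" "(1 + \<rho>0) / 2" s b b'
  proof
    have "real m \<le> real p" using mp by (simp only: m_def of_nat_le_iff)
    thus "lam2 \<le> 1" unfolding lam2_def using p0 by simp
    have "\<kappa> ^ b' \<le> real m / real p" using gap by (simp only: m_def)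
    thus "kap ^ b' \<le> lam2" unfolding kap lam2_def .
  qed (rule sb(2))
  have lam2_eq: "lam2 = real (s * b) / real p" unfolding lam2_def by (simp only: m_def)
  have app: "app = (\<lambda>v. mapp l (F v))" by (intro ext) (simp add: app_def mapp_def)
  define W where "W w = map e (map (letter n q p s b t w) [0..<t])" for w
  define yw where "yw w = digits p m ((w div N) mod p ^ m)" for w
  define rw where "rw w = (w div N) div p ^ m" for w
  define K where "K = s * kk"
  have b0: "b > 0" using sb by simp
  \<comment> \<open>The backward listing and the order of factors in \<open>word_mat\<close> cancel:
    the vertex visited first acts last, as in \<open>runl\<close>.\<close>
  have W: "mapp l (word_mat l f (W w)) x i = runl (labs K 0 (yw w) (rw w)) (w mod N) x i" if "i < l" for w x i
  proof -
    have yG: "yw w \<in> grp p m" unfolding yw_def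
      using digits_bij[OF p0, of m] p0 by (auto simp: bij_betw_def)
    define as where "as = labs K 0 (yw w) (rw w)"
    have as: "as = map (lab (yw w) (rw w)) [0..<t]"
      unfolding as_def labs_eq[OF yG b0] by (simp add: t K_def)
    have nth: "as ! j = labf p s b ((w div N) mod p ^ (s * b)) ((w div N) div p ^ (s * b)) j" if "j < t" for j
    proof -
      define c where "c = (j div b mod s) * b + j mod b"
      have "c < Suc (j div b mod s) * b" using b0 by (simp add: c_def)
      also have "\<dots> \<le> s * b" using sb by (intro mult_le_mono1) (simp add: Suc_leI)
      finally have "yw w c = digit p ((w div N) mod p ^ (s * b)) c" by (simp add: yw_def digits_def m_def)
      thus ?thesis using that by (simp add: as lab_def genrow_def labf_def Let_def c_def[symmetric] rw_def m_def)
    qed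
    have "map (letter n q p s b t w) [0..<t] = rev (map (\<lambda>v. v mod n) (visited q as (w mod N)))"
    proof (rule nth_equalityI)
      fix i assume "i < length (map (letter n q p s b t w) [0..<t])"
      hence i: "i < t" by simp
      have "letter n q p s b t w i = rev (map (\<lambda>v. v mod n) (visited q as (w mod (q * q)))) ! i"
        by (rule letters_visited[OF i _ _ refl]) (use nth as in \<open>auto simp: N_def\<close>)
      thus "map (letter n q p s b t w) [0..<t] ! i = rev (map (\<lambda>v. v mod n) (visited q as (w mod N))) ! i"
        using i by (simp add: N_def)
    qed (simp add: as)
    hence "W w = rev (map (\<lambda>v. e (v mod n)) (visited q as (w mod N)))"
      by (simp add: W_def rev_map comp_def)
    hence "mapp l (word_mat l f (W w)) x i = foldr (\<lambda>v. mapp l (F v)) (visited q as (w mod N)) x i"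
      using mapp_word_mat[of "visited q as (w mod N)" f "\<lambda>v. e (v mod n)" l i x] that F by (simp add: F_def)
    also have "\<dots> = runl as (w mod N) x i" by (simp only: runl_visited app)
    finally show ?thesis by (simp add: as_def)
  qed
  define P R where "P = p ^ m" and "R = p ^ (2 * K)"
  have PR: "P > 0" using p0 by (simp add: P_def)
  \<comment> \<open>Summation over \<open>w\<close> is summation over its mixed-radix digits: the
    vertex below \<open>N\<close>, the index of \<open>y\<close> below \<open>P\<close>, and
    \<open>r\<close> below \<open>R\<close>.\<close>
  have sumW: "(\<Sum>w<tot. runl (labs K 0 (yw w) (rw w)) (w mod N) x i) = (\<Sum>v\<in>V. \<Sum>y\<in>G. \<Sum>r<R. runl (labs K 0 y r) v x i)" for x i
  proof -
    have "(\<Sum>w<tot. runl (labs K 0 (yw w) (rw w)) (w mod N) x i)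
       = (\<Sum>v<N. \<Sum>j<P * R. runl (labs K 0 (digits p m (j mod P)) (j div P)) v x i)"
      unfolding tot N_def[symmetric] m_def[symmetric] K_def[symmetric] P_def[symmetric] R_def[symmetric] sum_split[OF N]
      by (intro sum.cong refl) (simp add: yw_def rw_def P_def)
    also have "\<dots> = (\<Sum>v<N. \<Sum>y<P. \<Sum>r<R. runl (labs K 0 (digits p m y) r) v x i)"
      unfolding sum_split[OF PR] by (intro sum.cong refl) simp
    also have "\<dots> = (\<Sum>v<N. \<Sum>y\<in>G. \<Sum>r<R. runl (labs K 0 y r) v x i)"
      unfolding P_def
      by (intro sum.cong refl sum.reindex_bij_betw[OF digits_bij[OF p0], of "\<lambda>y. \<Sum>r<R. runl (labs K 0 y r) _ x i"])
    finally show ?thesis by (simp only: N_def)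
  qed
  show ?thesis unfolding W_def[symmetric]
  proof (rule op_norm_leI[OF mat_expectation_carrier])
    fix x
    have "mapp l (mat_expectation l (mset (map W [0..<tot])) (word_mat l f)) x i
      = (\<Sum>v\<in>V. \<Sum>y\<in>G. \<Sum>r<p ^ (2 * (s * kk)). runl (labs (s * kk) 0 y r) v x i) / of_nat (q * q * p ^ m * p ^ (2 * (s * kk)))" if "i < l" for i
    proof -
      have "(\<Sum>w<tot. mapp l (word_mat l f (W w)) x i) = (\<Sum>v\<in>V. \<Sum>y\<in>G. \<Sum>r<R. runl (labs K 0 y r) v x i)"
        unfolding sumW[symmetric] by (intro sum.cong refl W that)
      moreover have "tot = q * q * p ^ m * p ^ (2 * (s * kk))" by (simp add: tot m_def)
      ultimately show ?thesis unfolding mapp_expectation[OF that] by (simp only: R_def K_def)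
    qed
    hence "l2 {..<l} (mapp l (mat_expectation l (mset (map W [0..<tot])) (word_mat l f)) x)
      = l2 {..<l} (\<lambda>i. (\<Sum>v\<in>V. \<Sum>y\<in>G. \<Sum>r<p ^ (2 * (s * kk)). runl (labs (s * kk) 0 y r) v x i) / of_nat (q * q * p ^ m * p ^ (2 * (s * kk))))"
      by (intro l2_cong) simp
    also have "\<dots> \<le> ((real s + 1)\<^sup>2 * lam2 ^ (s - 1)) ^ kk * l2 {..<l} x" by (rule word_avg)
    finally show "l2 {..<l} (mapp l (mat_expectation l (mset (map W [0..<tot])) (word_mat l f)) x)
      \<le> ((real s + 1)\<^sup>2 * (real (s * b) / real p) ^ (s - 1)) ^ kk * l2 {..<l} x" by (simp only: lam2_eq)
  qed (auto intro!: zero_le_power mult_nonneg_nonneg)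
qed

section \<open>Choice of the parameters\<close>

lemma sq_le_power2: "s \<ge> 10 \<Longrightarrow> 3 * s * s + 1 \<le> (2::nat) ^ (s - 1)"
proof (induction s rule: nat_induct_at_least)
  case (Suc s)
  have "3 * Suc s * Suc s + 1 = (3 * s * s + 1) + (6 * s + 3)" by (simp add: algebra_simps)
  also have "6 * s + 3 \<le> 3 * s * s + 1"
  proof -
    have "10 * s \<le> s * s" using Suc by (intro mult_le_mono1)
    moreover have "3 * s * s = 3 * (s * s)" by simp
    ultimately show ?thesis using Suc.hyps by linarith
  qed
  finally have "3 * Suc s * Suc s + 1 \<le> 2 * (3 * s * s + 1)" by simp
  also have "\<dots> \<le> 2 * 2 ^ (s - 1)" using Suc by simp
  also have "\<dots> = 2 ^ (Suc s - 1)" using Suc by (cases s) simp_all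
  finally show ?case .
qed simp

lemma pow4_le_power2: "l \<ge> 30 \<Longrightarrow> 4 * (l * l) * (l * l) + 1 \<le> (2::nat) ^ (l - 1)"
proof (induction l rule: nat_induct_at_least)
  case (Suc l)
  have a: "30 * (l * l * l) \<le> l * (l * l * l)" using Suc by (intro mult_le_mono1)
  have b: "l * l \<le> l * l * l" "l \<le> l * l * l" "1 \<le> l * l * l" using Suc by simp_all
  have "4 * (Suc l * Suc l) * (Suc l * Suc l) + 1 = (4 * (l * l) * (l * l) + 1) + (16 * (l * l * l) + 24 * (l * l) + 16 * l + 4)"
    by (simp add: algebra_simps)
  also have "16 * (l * l * l) + 24 * (l * l) + 16 * l + 4 \<le> 60 * (l * l * l)" using b by linarith
  also have "\<dots> \<le> 4 * (l * l) * (l * l)"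
  proof -
    have "4 * (l * l) * (l * l) = 4 * (l * (l * l * l))" by simp
    thus ?thesis using a by linarith
  qed
  finally have "4 * (Suc l * Suc l) * (Suc l * Suc l) + 1 \<le> 2 * (4 * (l * l) * (l * l) + 1)" by simp
  also have "\<dots> \<le> 2 * 2 ^ (l - 1)" using Suc by simp
  also have "\<dots> = 2 ^ (Suc l - 1)" using Suc by (cases l) simp_all
  finally show ?case .
qed simp

lemma blen_mono_bound: assumes "2 ^ a \<le> x" shows "a < blen x"
proof -
  have "(2::nat) ^ a < 2 ^ blen x" using assms blen_less[of x] by linarith
  thus ?thesis by simp
qed

text \<open>Taking bit lengths twice makes \<open>3 * s\<^sup>2 < ell\<close> and
  \<open>4 * ell ^ 4 < p\<close>; the first pays for the losses in a block, the second for the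
  initial vectors.\<close>

locale params =
  fixes p ell s b m :: nat
  assumes ell: "ell = blen p" and s: "s = blen ell" and b: "b = ell * (ell + ell)" and m: "m = s * b" and s10: "10 \<le> s"
begin

lemma ell_s: "2 ^ (s - 1) \<le> ell" "ell < 2 ^ s"
  using blen_ge[of "s - 1" ell] blen_less[of ell] s10 by (auto simp: s)

lemma ell_big: "3 * s * s + 1 \<le> ell" "30 \<le> ell" "512 \<le> ell"
proof -
  show 1: "3 * s * s + 1 \<le> ell" using sq_le_power2[OF s10] ell_s by linarith
  have "(2::nat) ^ 9 \<le> 2 ^ (s - 1)" using s10 by (intro power_increasing) auto
  thus "512 \<le> ell" "30 \<le> ell" using ell_s by simp_all
qed

lemma p_ell: "2 ^ (ell - 1) \<le> p" "p < 2 ^ ell" "ell \<le> p" "s \<le> ell"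
  using blen_ge[of "ell - 1" p] blen_less[of p] blen_le[of p] blen_le[of ell] ell_big by (auto simp: ell s)

lemma p_big: "200 \<le> p" using p_ell ell_big by linarith

lemma pos: "p > 0" "ell > 0" "s > 0" "b > 0" "m > 0"
  using p_big ell_big s10 by (auto simp: b m)

text \<open>One factor \<open>p\<close> pays for all losses of a block: both \<open>s + 1\<close>
  and the cube root of \<open>m\<close> are at most \<open>2 ^ s\<close>, so the product is below
  \<open>2 ^ (3 * s * s)\<close>, and \<open>3 * s * s < ell\<close>.\<close>

lemma block: "(s + 1) ^ 2 * m ^ (s - 1) \<le> p"
proof -
  have s2: "s + 1 \<le> 2 ^ s" using less_exp[of s] by (simp add: Suc_leI)
  have s2': "2 * s \<le> 2 ^ s"
  proof -
    have "s \<le> 2 ^ (s - 1)" using less_exp[of "s - 1"] s10 by linarith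
    moreover have "(2::nat) ^ s = 2 * 2 ^ (s - 1)" using s10 by (cases s) simp_all
    ultimately show ?thesis by simp
  qed
  have "m = (2 * s) * (ell * ell)" by (simp add: m b)
  also have "\<dots> \<le> 2 ^ s * (2 ^ s * 2 ^ s)" using s2' ell_s by (intro mult_le_mono) auto
  also have "\<dots> = 2 ^ (3 * s)" by (simp add: power_add[symmetric])
  finally have "m ^ (s - 1) \<le> (2 ^ (3 * s)) ^ (s - 1)" by (rule power_mono) simp
  moreover have "(s + 1) ^ 2 \<le> (2 ^ s) ^ 2" using s2 by (rule power_mono) simp
  ultimately have "(s + 1) ^ 2 * m ^ (s - 1) \<le> (2 ^ s) ^ 2 * (2 ^ (3 * s)) ^ (s - 1)" by (rule mult_le_mono[rotated])
  also have "\<dots> = 2 ^ (s * 2 + 3 * s * (s - 1))" by (simp only: power_add power_mult)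
  also have "\<dots> \<le> 2 ^ (ell - 1)"
  proof (rule power_increasing)
    have "s * 2 + 3 * s * (s - 1) \<le> 3 * s + 3 * s * (s - 1)" by simp
    also have "\<dots> = 3 * s * s" using s10 by (cases s) simp_all
    finally show "s * 2 + 3 * s * (s - 1) \<le> ell - 1" using ell_big by linarith
  qed simp
  finally show ?thesis using p_ell by linarith
qed

lemma m_le_p: "m \<le> p"
proof -
  have "m \<le> m ^ (s - 1)" using pos s10 by (intro self_le_power) auto
  also have "\<dots> \<le> (s + 1) ^ 2 * m ^ (s - 1)" by simp
  finally show ?thesis using block by linarith
qed

lemma block_real: "(real s + 1)\<^sup>2 * (real m / real p) ^ (s - 1) \<le> 1 / real p ^ (s - 2)"
proof -
  have "real ((s + 1) ^ 2 * m ^ (s - 1)) \<le> real p" using block by (simp only: of_nat_le_iff)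
  hence "(real s + 1)\<^sup>2 * real m ^ (s - 1) \<le> real p" by (simp add: add.commute)
  hence "(real s + 1)\<^sup>2 * real m ^ (s - 1) / real p ^ (s - 1) \<le> real p / real p ^ (s - 1)"
    by (rule divide_right_mono) simp
  also have "\<dots> = 1 / real p ^ (s - 2)"
  proof -
    have "s - 1 = Suc (s - 2)" using s10 by simp
    hence "real p ^ (s - 1) = real p * real p ^ (s - 2)" by (simp only: power_Suc)
    thus ?thesis using pos(1) by (simp del: One_nat_def)
  qed
  finally show ?thesis by (simp add: power_divide)
qed

text \<open>The \<open>p ^ m\<close> initial vectors, together with one surplus block of
  \<open>p ^ (2 * s)\<close> choices, number at most the \<open>s\<close>-th root of
  \<open>L\<close>. In the exponent this compares a fourth power of \<open>ell\<close> with
  \<open>p - 1\<close>, which is less than the bit length of \<open>L\<close>.\<close>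

lemma growth:
  assumes "p \<le> blen L" shows "p ^ ((m + 2 * s) * s) \<le> L"
proof -
  have le: "ell * ((m + 2 * s) * s) \<le> p - 1"
  proof -
    have ss: "s * s \<le> ell" using ell_big by linarith
    have "ell * ((m + 2 * s) * s) = 2 * (s * s) * (ell * (ell * ell + 1))" by (simp add: m b algebra_simps)
    also have "\<dots> \<le> 2 * ell * (ell * (2 * (ell * ell)))"
      using ss pos by (intro mult_le_mono order_refl) (simp_all add: Suc_leI)
    also have "\<dots> = 4 * (ell * ell) * (ell * ell)" by simp
    also have "\<dots> \<le> p - 1" using pow4_le_power2[OF ell_big(2)] p_ell by linarith
    finally show ?thesis .
  qed
  have "p ^ ((m + 2 * s) * s) \<le> (2 ^ ell) ^ ((m + 2 * s) * s)" using p_ell by (intro power_mono) auto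
  also have "\<dots> = 2 ^ (ell * ((m + 2 * s) * s))" by (simp only: power_mult)
  also have "\<dots> \<le> 2 ^ (p - 1)" using le by (intro power_increasing) auto
  also have "\<dots> \<le> L" using assms pos by (intro blen_ge) simp
  finally show ?thesis .
qed

lemma growth_real:
  assumes "p \<le> blen L" "L > 0" shows "real (p ^ (m + 2 * s)) \<le> real L powr (1 / real s)"
proof -
  have "real ((p ^ (m + 2 * s)) ^ s) \<le> real L" using growth[OF assms(1)] by (simp only: of_nat_le_iff power_mult)
  hence "(real (p ^ (m + 2 * s)) ^ s) powr (1 / real s) \<le> real L powr (1 / real s)"
    by (intro powr_mono2) simp_all
  moreover have "(real (p ^ (m + 2 * s)) ^ s) powr (1 / real s) = real (p ^ (m + 2 * s))"
  proof -
    have "real (p ^ (m + 2 * s)) ^ s = real (p ^ (m + 2 * s)) powr real s" using pos by (subst powr_realpow) simp_all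
    thus ?thesis using pos by (simp add: powr_powr)
  qed
  ultimately show ?thesis by simp
qed

text \<open>One block fewer would miss \<open>L\<close>, so all blocks but one cost at most
  \<open>L\<close> to the power \<open>2 * s / (s - 2) = 2 + 4 / (s - 2)\<close>. The surplus block
  is the separate factor \<open>p ^ (2 * s)\<close>.\<close>

lemma reps_growth:
  assumes "L \<ge> 2"
  shows "reps p (s - 2) L > 0" "real (p ^ (2 * (s * reps p (s - 2) L))) \<le> real (p ^ (2 * s)) * real L powr (2 + 4 / (real s - 2))"
proof -
  let ?k = "reps p (s - 2) L"
  have "L \<le> p ^ ((s - 2) * ?k)" using p_big s10 by (intro reps_ge) auto
  thus k: "?k > 0" using assms by (cases ?k) auto
  define x where "x = real p ^ ((s - 2) * (?k - 1))"
  have x: "x > 0" using pos by (simp add: x_def)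
  have "p ^ ((s - 2) * (?k - 1)) < L" using k by (intro reps_less) simp
  hence "real (p ^ ((s - 2) * (?k - 1))) \<le> real L" by (simp only: of_nat_le_iff)
  hence xL: "x \<le> real L" by (simp add: x_def)
  have s2: "real (s - 2) = real s - 2" "real s - 2 > 0" using s10 by auto
  have e: "2 + 4 / (real s - 2) = 2 * real s / (real s - 2)" using s2 by (simp add: field_simps)
  have "x powr (2 + 4 / (real s - 2)) = real p ^ (2 * s * (?k - 1))"
  proof -
    have "x = real p powr (real (s - 2) * real (?k - 1))"
      using pos unfolding x_def by (simp add: powr_realpow[symmetric])
    hence "x powr (2 + 4 / (real s - 2)) = real p powr ((real s - 2) * real (?k - 1) * (2 * real s / (real s - 2)))"
      by (simp only: powr_powr e s2)
    also have "(real s - 2) * real (?k - 1) * (2 * real s / (real s - 2)) = real (2 * s * (?k - 1))"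
      using s2 by simp
    finally show ?thesis using pos by (simp only: powr_realpow of_nat_0_less_iff)
  qed
  hence "real p ^ (2 * s * (?k - 1)) \<le> real L powr (2 + 4 / (real s - 2))"
    using powr_mono2[OF _ _ xL, of "2 + 4 / (real s - 2)"] x s2 by simp
  hence "real p ^ (2 * s) * real p ^ (2 * s * (?k - 1)) \<le> real p ^ (2 * s) * real L powr (2 + 4 / (real s - 2))"
    by (rule mult_left_mono) simp
  moreover have "real p ^ (2 * s) * real p ^ (2 * s * (?k - 1)) = real (p ^ (2 * (s * ?k)))"
  proof -
    have "2 * s + 2 * s * (?k - 1) = 2 * (s * ?k)" using k by (cases ?k) simp_all
    thus ?thesis by (simp only: power_add[symmetric] of_nat_power)
  qed
  ultimately show "real (p ^ (2 * (s * ?k))) \<le> real (p ^ (2 * s)) * real L powr (2 + 4 / (real s - 2))"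
    by simp
qed

text \<open>Once \<open>ell\<close> exceeds the halving time \<open>ell0\<close> of
  \<open>\<kappa>\<close>, the power \<open>ell * ell\<close> is below \<open>2\<close> to the
  \<open>- ell\<close>, hence below \<open>1 / p\<close>.\<close>

lemma kappa_power_le:
  assumes "0 \<le> \<kappa>" "\<kappa> \<le> 1" "\<kappa> ^ ell0 \<le> 1/2" "ell0 \<le> ell"
  shows "\<kappa> ^ (ell * ell) \<le> real m / real p"
proof -
  have "\<kappa> ^ ell \<le> \<kappa> ^ ell0" using assms by (intro power_decreasing) auto
  hence "(\<kappa> ^ ell) ^ ell \<le> (1/2) ^ ell" using assms by (intro power_mono) auto
  also have "(1/2::real) ^ ell = 1 / real (2 ^ ell)" by (simp add: power_divide)
  also have "\<dots> \<le> 1 / real p"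
  proof (rule divide_left_mono)
    show "real p \<le> real (2 ^ ell)" using p_ell(2) by (simp only: of_nat_le_iff less_imp_le_nat)
  qed (use pos in simp_all)
  also have "\<dots> \<le> real m / real p" using pos by (intro divide_right_mono) (simp_all add: Suc_leI)
  finally show ?thesis by (simp add: power_mult)
qed

end

lemma side_le: assumes "x > 0" shows "side x * side x \<le> 4 * x"
proof -
  define r where "r = side x - 1"
  have r: "side x = r + 1" using side_less(2)[OF assms] by (simp add: r_def)
  have "r * r < x" using side_less(1)[OF assms] by (simp add: r_def)
  moreover have "2 * r \<le> r * r + 1" by (cases r) (simp_all add: algebra_simps)
  ultimately show ?thesis unfolding r by (simp add: algebra_simps)
qed

text \<open>The width is computed here from the largest prime at most \<open>blen L\<close>. The algorithm uses the same width
  unless this prime is below its threshold \<open>p0\<close>, which depends on \<open>\<lambda>\<^sub>0\<close>; this happens only for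
  \<open>\<lambda>\<close> bounded away from 0 and affects only the constant.\<close>

definition beta :: "real \<Rightarrow> real" where
  "beta lam = (let w = blen (blen (pr 2 (blen (nat \<lceil>1 / lam\<rceil>)))) in if w > 2 then 5 / (real w - 2) else 1)"

lemma beta_pos: "0 < beta lam" "beta lam \<le> 5"
proof -
  have "5 / (real w - 2) \<le> 5 \<and> 0 < 5 / (real w - 2)" if "w > 2" for w
  proof -
    have "real w \<ge> 3" using that by linarith
    thus ?thesis by (simp add: divide_le_eq)
  qed
  thus "0 < beta lam" "beta lam \<le> 5" by (auto simp: beta_def Let_def)
qed

lemma prime_above: "\<exists>P::nat. prime P \<and> n \<le> P"
  using bigger_prime[of n] by (meson less_imp_le_nat)

text \<open>The width tends to infinity because any prime \<open>P\<close> is eventually at most the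
  bit length of \<open>1 / \<lambda>\<close>; \<open>P\<close> is taken above a double exponential
  of \<open>M\<close> so that two bit lengths leave more than \<open>M\<close>.\<close>

lemma beta_lim: "(beta \<longlongrightarrow> 0) (at_right 0)"
proof (rule tendstoI)
  fix \<epsilon> :: real assume \<epsilon>: "0 < \<epsilon>"
  obtain M where M: "5 / \<epsilon> + 2 < real M" using reals_Archimedean2 by blast
  obtain P :: nat where P: "prime P" "2 ^ 2 ^ M \<le> P" using prime_above by blast
  have "dist (beta lam) 0 < \<epsilon>" if lam: "0 < lam" "lam < 1 / 2 ^ P" for lam
  proof -
    define L where "L = nat \<lceil>1 / lam\<rceil>"
    have "2 ^ P \<le> 1 / lam" using lam by (simp add: field_simps)
    also have "1 / lam \<le> real L" unfolding L_def by linarith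
    finally have "real (2 ^ P) \<le> real L" by simp
    hence "2 ^ P \<le> L" by (simp only: of_nat_le_iff)
    hence "P \<le> blen L" using blen_mono_bound[of P L] by simp
    hence "P \<le> pr 2 (blen L)" using pr_props[of 2 "blen L"] P(1) prime_ge_2_nat by auto
    hence "2 ^ 2 ^ M \<le> pr 2 (blen L)" using P by linarith
    hence "2 ^ M < blen (pr 2 (blen L))" by (rule blen_mono_bound)
    hence "M < blen (blen (pr 2 (blen L)))" by (intro blen_mono_bound) simp
    moreover define w where "w = blen (blen (pr 2 (blen L)))"
    ultimately have w: "5 / \<epsilon> + 2 < real w" using M by linarith
    hence "0 < 5 / \<epsilon>" "5 / \<epsilon> < real w - 2" using \<epsilon> by simp_all
    hence w2: "real w - 2 > 0" by linarith
    have "5 / (real w - 2) < \<epsilon>" using \<open>5 / \<epsilon> < real w - 2\<close> \<epsilon> w2 by (simp add: field_simps)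
    moreover have "beta lam = 5 / (real w - 2)" using w2 by (auto simp: beta_def Let_def w_def L_def)
    ultimately show ?thesis using beta_pos[of lam] by simp
  qed
  thus "\<forall>\<^sub>F lam in at_right 0. dist (beta lam) 0 < \<epsilon>"
    by (intro eventually_at_rightI[of 0 "1 / 2 ^ P"]) auto
qed


text \<open>The call supplies a third variable, so that the parameters get the numbers 3 to 9 here
  as well; in \<open>letter_prog\<close> that variable is the position of the entry.\<close>

definition length_prog :: "nat \<Rightarrow> nat \<Rightarrow> ex" where
  "length_prog p0 K0 = ex.Call (ex.V 0) (ex.V 1) (ex.N 0) (par_ex p0 K0 (ex.V 9))"

definition total_prog :: "nat \<Rightarrow> nat \<Rightarrow> ex" where
  "total_prog p0 K0 = ex.Call (ex.V 0) (ex.V 1) (ex.N 0) (par_ex p0 K0 count_ex)"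

definition letter_prog :: "nat \<Rightarrow> nat \<Rightarrow> ex" where
  "letter_prog p0 K0 = par_ex p0 K0 letter_ex"

text \<open>The entries are written as one sequence; position \<open>i\<close> is entry
  \<open>i mod t\<close> of word \<open>i div t\<close>, and \<open>concat_blocks\<close> turns the
  sequence into the concatenated words.\<close>

lemma program_correct:
  fixes p0 K0 n L k :: nat
  defines "p \<equiv> pr p0 (blen L)"
  defines "ell \<equiv> blen p"
  defines "s \<equiv> blen ell"
  defines "b \<equiv> ell * (ell + ell)"
  defines "q \<equiv> side (K0 * n)"
  defines "kk \<equiv> reps p (s - 2) L"
  defines "t \<equiv> s * kk * b"
  defines "tot \<equiv> q * q * (p ^ (s * b) * p ^ (2 * (s * kk)))"
  defines "Z \<equiv> (n + L) ^ 2 ^ k"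
  assumes pos: "0 < n" "0 < q" "8 \<le> p" "0 < s" "0 < b" "0 < kk"
    and Z: "L + 8 \<le> Z" "p \<le> Z" "K0 \<le> Z" "K0 * n \<le> Z" "s * L \<le> Z" "tot * t \<le> Z"
  shows "\<exists>T. runs (main_com k (length_prog p0 K0) (total_prog p0 K0) (letter_prog p0 K0)) n L T
      (t # concat (map (\<lambda>w. map (letter n q p s b t w) [0..<t]) [0..<tot])) \<and>
     T \<le> (20 * k + cst (length_prog p0 K0) + cst (total_prog p0 K0) + cst (letter_prog p0 K0) + 10) * (Z + 1) ^ (dep (length_prog p0 K0) + dep (total_prog p0 K0) + dep (letter_prog p0 K0) + 2)"
proof -
  have t0: "t > 0" using pos by (simp add: t_def)
  have qq: "q * q > 0" using pos by simp
  have P0: "p ^ (s * b) > 0" "p ^ (2 * (s * kk)) > 0" using pos by simp_all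
  have totZ: "tot \<le> Z"
  proof -
    have "tot * 1 \<le> tot * t" using t0 by (intro mult_le_mono2) simp
    from order_trans[OF this Z(6)] show ?thesis by simp
  qed
  have par: "ev Z (par_ex p0 K0 body) [n, L, idx] = ev Z body [n, L, idx, p, ell, s, b, q, kk, t]" for body idx
    unfolding p_def ell_def s_def b_def q_def kk_def t_def
    by (rule ev_par) (use Z in \<open>simp_all add: p_def ell_def s_def\<close>)
  have te: "ev Z (length_prog p0 K0) [n, L] = t"
    unfolding length_prog_def by (simp add: par)
  have PR: "p ^ (s * b) \<le> tot" "p ^ (2 * (s * kk)) \<le> tot" "q * q \<le> tot"
  proof -
    have "y \<le> v * (y * z)" "z \<le> v * (y * z)" "v \<le> v * (y * z)" if "0 < y" "0 < z" "0 < v" for y z v :: nat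
      using that by simp_all
    from this[OF P0 qq] show "p ^ (s * b) \<le> tot" "p ^ (2 * (s * kk)) \<le> tot" "q * q \<le> tot"
      unfolding tot_def by blast+
  qed
  have lexp: "x \<le> p ^ x" for x
  proof -
    have "x \<le> 2 ^ x" using less_exp[of x] by simp
    also have "(2::nat) ^ x \<le> p ^ x" using pos by (intro power_mono) auto
    finally show ?thesis .
  qed
  have "ev Z count_ex [n, L, 0, p, ell, s, b, q, kk, t] = tot * t"
    unfolding tot_def
  proof (rule ev_count)
    show "q * q \<le> Z" using PR totZ by linarith
    moreover have "q \<le> q * q" using pos by simp
    ultimately show "q \<le> Z" by linarith
    have "s * b \<le> p ^ (s * b)" by (rule lexp)
    thus sb: "s * b \<le> Z" using PR totZ by linarith
    have "s * 1 \<le> s * b" using pos by (intro mult_le_mono2) simp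
    from order_trans[OF this sb] show "s \<le> Z" by simp
    have "2 * (s * kk) \<le> p ^ (2 * (s * kk))" by (rule lexp)
    thus "2 * (s * kk) \<le> Z" using PR totZ by linarith
    show "p ^ (s * b) \<le> Z" using PR totZ by linarith
    show "q * q * (p ^ (s * b) * p ^ (2 * (s * kk))) \<le> Z" using totZ by (simp add: tot_def)
  qed (use Z in simp_all)
  hence ne: "ev Z (total_prog p0 K0) [n, L] = tot * t"
    unfolding total_prog_def by (simp add: par)
  have le: "ev Z (letter_prog p0 K0) [n, L, i] = letter n q p s b t (i div t) (i mod t)" if "i < tot * t" for i
  proof -
    have "ev Z letter_ex [n, L, i, p, ell, s, b, q, kk, s * kk * b] = letter n q p s b (s * kk * b) (i div (s * kk * b)) (i mod (s * kk * b))"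
    proof (rule ev_letter)
      show "q * q * (p ^ (s * b) * p ^ (2 * (s * kk))) * (s * kk * b) \<le> Z" using Z(6) by (simp only: tot_def t_def)
      show "i < q * q * (p ^ (s * b) * p ^ (2 * (s * kk))) * (s * kk * b)" using that by (simp only: tot_def t_def)
      show "8 \<le> Z" using Z(1) by simp
    qed (rule pos)+
    thus ?thesis unfolding letter_prog_def par by (simp only: t_def)
  qed
  have "map (\<lambda>i. ev Z (letter_prog p0 K0) [n, L, i]) [0..<tot * t] = map (\<lambda>i. letter n q p s b t (i div t) (i mod t)) [0..<tot * t]"
    by (intro map_cong refl le) simp
  also have "\<dots> = concat (map (\<lambda>w. map (letter n q p s b t w) [0..<t]) [0..<tot])"
    by (rule concat_blocks[OF t0, symmetric])
  finally have out: "map (\<lambda>i. ev Z (letter_prog p0 K0) [n, L, i]) [0..<tot * t] = concat (map (\<lambda>w. map (letter n q p s b t w) [0..<t]) [0..<tot])" .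
  have "n + L > 0" using pos by simp
  moreover have "ev Z (total_prog p0 K0) [n, L] \<le> Z" using ne Z by simp
  ultimately show ?thesis
    using main_com_runs[where x = n and y = L and k = k and ne = "total_prog p0 K0" and te = "length_prog p0 K0" and we = "letter_prog p0 K0", folded Z_def] unfolding te ne out by blast
qed

text \<open>The threshold is a double exponential: 1024 is 2 to the 10, so two bit lengths leave a
  width above 10.\<close>

lemma params_pr:
  assumes "prime p0" "2 ^ 1024 \<le> p0"
  shows "params (pr p0 u) (blen (pr p0 u)) (blen (blen (pr p0 u))) (blen (pr p0 u) * (blen (pr p0 u) + blen (pr p0 u)))
    (blen (blen (pr p0 u)) * (blen (pr p0 u) * (blen (pr p0 u) + blen (pr p0 u))))"
proof
  have "2 ^ 1024 \<le> pr p0 u" using pr_props[OF assms(1), of u] assms(2) by linarith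
  hence "1024 < blen (pr p0 u)" by (rule blen_mono_bound)
  hence "2 ^ 10 \<le> blen (pr p0 u)" by simp
  hence "10 < blen (blen (pr p0 u))" by (rule blen_mono_bound)
  thus "10 \<le> blen (blen (pr p0 u))" by simp
qed (rule refl)+

text \<open>Two regimes. If \<open>p \<le> blen L\<close>, the prime agrees with the one in
  \<open>beta\<close>, and \<open>growth_real\<close> makes the initial vectors negligible.
  Otherwise \<open>p = p0\<close> and \<open>L < 2 ^ p0\<close>, so everything except the vertices
  is bounded by the constant \<open>D\<close>. The second inequality, polynomial in \<open>n\<close>
  and \<open>L\<close>, serves the running time.\<close>

lemma size_bounds:
  fixes p0 K0 n L :: nat and lam :: real
  defines "p \<equiv> pr p0 (blen L)"
  defines "ell \<equiv> blen p"
  defines "s \<equiv> blen ell"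
  defines "b \<equiv> ell * (ell + ell)"
  defines "q \<equiv> side (K0 * n)"
  defines "kk \<equiv> reps p (s - 2) L"
  defines "tot \<equiv> q * q * (p ^ (s * b) * p ^ (2 * (s * kk)))"
  defines "D \<equiv> p0 ^ (blen (blen p0) * (blen p0 * (blen p0 + blen p0)) + 2 * blen (blen p0)) * (2 ^ p0) ^ 3"
  assumes p0: "prime p0" "2 ^ 1024 \<le> p0" and n: "0 < n" "0 < K0" and lam: "0 < lam" "lam < 1"
    and L: "L = nat \<lceil>1 / lam\<rceil>"
  shows "real tot \<le> real (4 * K0 * (128 + D)) * real n / lam powr (2 + beta lam)"
    and "tot \<le> 4 * K0 * (1 + D) * n * L ^ 3"
proof -
  interpret params p ell s b "s * b"
    unfolding p_def ell_def s_def b_def by (rule params_pr[OF p0])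
  have lamL: "1 < 1 / lam" using lam by simp
  have L1: "1 / lam \<le> real L" "real L \<le> 1 / lam + 1" unfolding L using lamL by linarith+
  have L2: "2 \<le> L" using L1 lamL by linarith
  have L3: "real L \<le> 2 / lam" using L1 lamL by (simp add: field_simps)
  have Lr: "1 \<le> real L" using L2 by simp
  define Y where "Y = real (p ^ (s * b + 2 * s))"
  have s2: "real s - 2 \<ge> 8" using s10 by linarith
  have totY: "real tot \<le> real (4 * K0 * n) * (Y * real L powr (2 + 4 / (real s - 2)))"
  proof -
    have "real tot = real (q * q) * (real (p ^ (s * b)) * real (p ^ (2 * (s * kk))))"
      by (simp only: tot_def of_nat_mult)
    also have "\<dots> \<le> real (4 * K0 * n) * (real (p ^ (s * b)) * (real (p ^ (2 * s)) * real L powr (2 + 4 / (real s - 2))))"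
    proof (intro mult_mono)
      have "q * q \<le> 4 * (K0 * n)" unfolding q_def by (rule side_le) (use n in simp)
      thus "real (q * q) \<le> real (4 * K0 * n)" by (simp only: of_nat_le_iff mult.assoc)
      show "real (p ^ (2 * (s * kk))) \<le> real (p ^ (2 * s)) * real L powr (2 + 4 / (real s - 2))"
        unfolding kk_def by (rule reps_growth(2)[OF L2])
    qed simp_all
    also have "real (p ^ (s * b)) * (real (p ^ (2 * s)) * real L powr (2 + 4 / (real s - 2))) = Y * real L powr (2 + 4 / (real s - 2))"
      by (simp add: Y_def power_add)
    finally show ?thesis .
  qed
  have Lpow3: "real L powr e \<le> real L ^ 3" if "e \<le> 3" for e
  proof -
    have "real L powr e \<le> real L powr 3" using that Lr by (intro powr_mono)
    also have "\<dots> = real L ^ 3" using Lr powr_realpow[of "real L" 3] by simp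
    finally show ?thesis .
  qed
  have lam_ge: "1 \<le> 1 / lam powr (2 + beta lam)"
  proof -
    have "lam powr (2 + beta lam) \<le> 1" using lam beta_pos(1)[of lam] by (intro powr_le1) auto
    thus ?thesis using lam by simp
  qed
  have e3: "2 + 4 / (real s - 2) \<le> 3" using s2 by (simp add: divide_le_eq)
  have pp: "prime p \<and> p0 \<le> p \<and> (p = p0 \<or> p \<le> blen L) \<and> (\<forall>x\<le>blen L. prime x \<longrightarrow> p0 \<le> x \<longrightarrow> x \<le> p)"
    unfolding p_def by (rule pr_props[OF p0(1)])
  have "real tot \<le> real (4 * K0 * (128 + D)) * real n / lam powr (2 + beta lam) \<and> real tot \<le> real (4 * K0 * n) * (real (1 + D) * real L ^ 3)"
  proof (cases "p \<le> blen L")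
    case True
    have phat: "pr 2 (blen L) = p"
    proof -
      have h: "prime (pr 2 (blen L)) \<and> 2 \<le> pr 2 (blen L) \<and> (pr 2 (blen L) = 2 \<or> pr 2 (blen L) \<le> blen L) \<and> (\<forall>x\<le>blen L. prime x \<longrightarrow> 2 \<le> x \<longrightarrow> x \<le> pr 2 (blen L))"
        by (rule pr_props) simp
      have "2 \<le> p" using p_big by simp
      hence 1: "p \<le> pr 2 (blen L)" using h True pp by blast
      hence "pr 2 (blen L) \<noteq> 2" using p_big by linarith
      hence "pr 2 (blen L) \<le> p" using h pp 1 by (meson le_trans)
      with 1 show ?thesis by simp
    qed
    have bet: "beta lam = 5 / (real s - 2)"
      unfolding beta_def L[symmetric] phat Let_def using s10 by (simp add: s_def ell_def)
    have "Y * real L powr (2 + 4 / (real s - 2)) \<le> real L powr (1 / real s) * real L powr (2 + 4 / (real s - 2))"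
      unfolding Y_def using L2 by (intro mult_right_mono growth_real True) auto
    also have "\<dots> = real L powr (1 / real s + (2 + 4 / (real s - 2)))" by (simp only: powr_add)
    also have "\<dots> \<le> real L powr (2 + beta lam)"
    proof (rule powr_mono[OF _ Lr])
      \<comment> \<open>The 5 in \<open>beta\<close> is \<open>4 + 1\<close>: the 4 for incomplete
        gain in the blocks, the 1 for initial vectors and the surplus block.\<close>
      have "1 / real s \<le> 1 / (real s - 2)" using s2 by (intro divide_left_mono) auto
      thus "1 / real s + (2 + 4 / (real s - 2)) \<le> 2 + beta lam" unfolding bet by simp
    qed
    finally have Y: "Y * real L powr (2 + 4 / (real s - 2)) \<le> real L powr (2 + beta lam)" .
    have "real L powr (2 + beta lam) \<le> (2 / lam) powr (2 + beta lam)"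
      using beta_pos(1)[of lam] L3 by (intro powr_mono2) auto
    also have "\<dots> = 2 powr (2 + beta lam) / lam powr (2 + beta lam)" using lam by (simp add: powr_divide)
    also have "\<dots> \<le> 128 / lam powr (2 + beta lam)"
    proof (rule divide_right_mono)
      \<comment> \<open>Rounding gives \<open>L \<le> 2 / lam\<close>; as \<open>beta\<close> is at
        most 5, the factor 2 costs at most \<open>2 ^ 7\<close>.\<close>
      have "2 powr (2 + beta lam) \<le> 2 powr (real 7)" using beta_pos(2)[of lam] by (intro powr_mono) auto
      also have "\<dots> = 128" by (subst powr_realpow) simp_all
      finally show "2 powr (2 + beta lam) \<le> 128" .
    qed simp
    finally have A: "Y * real L powr (2 + 4 / (real s - 2)) \<le> 128 / lam powr (2 + beta lam)" using Y by linarith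
    have "beta lam \<le> 1" unfolding bet using s2 by (simp add: divide_le_eq)
    hence "real L powr (2 + beta lam) \<le> real L ^ 3" by (intro Lpow3) simp
    hence "Y * real L powr (2 + 4 / (real s - 2)) \<le> 1 * real L ^ 3" using Y by linarith
    also have "\<dots> \<le> real (1 + D) * real L ^ 3" by (rule mult_right_mono) simp_all
    finally have B: "real tot \<le> real (4 * K0 * n) * (real (1 + D) * real L ^ 3)"
      by (rule order_trans[OF totY mult_left_mono]) simp
    have "real tot \<le> real (4 * K0 * n) * (128 / lam powr (2 + beta lam))"
      by (rule order_trans[OF totY mult_left_mono[OF A]]) simp
    also have "\<dots> \<le> real (4 * K0 * n) * (real (128 + D) / lam powr (2 + beta lam))"
      by (intro mult_left_mono divide_right_mono) simp_all
    also have "\<dots> = real (4 * K0 * (128 + D)) * real n / lam powr (2 + beta lam)" by simp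
    finally show ?thesis using B by blast
  next
    case False
    hence pp0: "p = p0" using pp by blast
    have "L < 2 ^ blen L" by (rule blen_less)
    also have "(2::nat) ^ blen L \<le> 2 ^ p0" using False pp0 by (intro power_increasing) auto
    finally have Lp: "L \<le> 2 ^ p0" by simp
    have D: "real D = Y * real ((2 ^ p0) ^ 3)"
      by (simp add: D_def Y_def pp0[symmetric] ell_def[symmetric] s_def[symmetric] b_def[symmetric])
    have "real L powr (2 + 4 / (real s - 2)) \<le> real L ^ 3" by (rule Lpow3[OF e3])
    hence Y3: "Y * real L powr (2 + 4 / (real s - 2)) \<le> Y * real L ^ 3" by (rule mult_left_mono) (simp add: Y_def)
    also have "\<dots> \<le> real D"
    proof -
      have "L ^ 3 \<le> (2 ^ p0) ^ 3" using Lp by (rule power_mono) simp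
      hence "real (L ^ 3) \<le> real ((2 ^ p0) ^ 3)" by (simp only: of_nat_le_iff)
      thus ?thesis unfolding D of_nat_power by (rule mult_left_mono) (simp add: Y_def)
    qed
    finally have A: "Y * real L powr (2 + 4 / (real s - 2)) \<le> real D" .
    have "real D * 1 \<le> real (1 + D) * real L ^ 3" using Lr by (intro mult_mono one_le_power) simp_all
    hence "Y * real L powr (2 + 4 / (real s - 2)) \<le> real (1 + D) * real L ^ 3" using A by linarith
    hence B: "real tot \<le> real (4 * K0 * n) * (real (1 + D) * real L ^ 3)"
      by (rule order_trans[OF totY mult_left_mono]) simp
    have "real D * 1 \<le> real (128 + D) * (1 / lam powr (2 + beta lam))"
      using lam_ge by (intro mult_mono) simp_all
    hence "Y * real L powr (2 + 4 / (real s - 2)) \<le> real (128 + D) / lam powr (2 + beta lam)" using A by simp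
    hence "real tot \<le> real (4 * K0 * n) * (real (128 + D) / lam powr (2 + beta lam))"
      by (rule order_trans[OF totY mult_left_mono]) simp
    also have "\<dots> = real (4 * K0 * (128 + D)) * real n / lam powr (2 + beta lam)" by simp
    finally show ?thesis using B by blast
  qed
  hence 1: "real tot \<le> real (4 * K0 * (128 + D)) * real n / lam powr (2 + beta lam)"
    and 2: "real tot \<le> real (4 * K0 * n) * (real (1 + D) * real L ^ 3)" by blast+
  show "real tot \<le> real (4 * K0 * (128 + D)) * real n / lam powr (2 + beta lam)" by (rule 1)
  have "real tot \<le> real (4 * K0 * n * ((1 + D) * L ^ 3))" using 2 by (simp only: of_nat_mult of_nat_power)
  hence "tot \<le> 4 * K0 * n * ((1 + D) * L ^ 3)" by (simp only: of_nat_le_iff)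
  thus "tot \<le> 4 * K0 * (1 + D) * n * L ^ 3" by (simp only: mult_ac)
qed

text \<open>As \<open>x \<ge> 2\<close>, a constant factor \<open>E\<close> is at most
  \<open>x ^ E\<close>, so a fixed number of squarings reaches any polynomial bound.\<close>

lemma cutoff_ok:
  fixes E x y :: nat
  assumes "2 \<le> x" "y \<le> E * x ^ 8" shows "y \<le> x ^ 2 ^ (E + 8)"
proof -
  have "E \<le> 2 ^ E" using less_exp[of E] by simp
  also have "(2::nat) ^ E \<le> x ^ E" using assms(1) by (intro power_mono) auto
  finally have "E * x ^ 8 \<le> x ^ E * x ^ 8" by (rule mult_le_mono1)
  also have "\<dots> = x ^ (E + 8)" by (simp add: power_add)
  also have "\<dots> \<le> x ^ 2 ^ (E + 8)"
    using assms(1) less_exp[of "E + 8"] by (intro power_increasing less_imp_le_nat) auto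
  finally show ?thesis using assms(2) by simp
qed

text \<open>The threshold \<open>p0\<close>, the oversampling factor \<open>K0\<close> and the
  number \<open>k\<close> of squarings depend on \<open>lam0\<close> alone and are constants of the
  program.\<close>

theorem theorem1p9:
  shows "\<exists>\<beta> :: real \<Rightarrow> real.
    (\<forall>lam \<in> {0<..<1}. 0 < \<beta> lam) \<and> (\<beta> \<longlongrightarrow> 0) (at_right 0) \<and>
    (\<forall>lam0 :: real. 0 < lam0 \<and> lam0 < 1 \<longrightarrow>
      (\<exists>C :: real. \<exists>(p :: com) (c :: nat) (k :: nat).
        \<forall>(S :: 'a set) (e :: nat \<Rightarrow> 'a) (lam :: real).
          finite S \<and> S \<noteq> {} \<and> bij_betw e {..<card S} S \<and> 0 < lam \<and> lam < 1 \<longrightarrow>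
          (\<exists>(T :: nat) (t :: nat) (W :: 'a list multiset).
             constructs p S e lam T t W \<and>
             real T \<le> real c * (real (card S) + 1 / lam) ^ k \<and>
             0 < t \<and>
             W \<noteq> {#} \<and>
             (\<forall>w \<in># W. length w = t \<and> set w \<subseteq> S) \<and>
             real (size W) \<le> C * real (card S) / lam powr (2 + \<beta> lam) \<and>
             (\<forall>(l :: nat) (f :: 'a \<Rightarrow> complex mat).
                0 < l \<and> (\<forall>s \<in> S. f s \<in> carrier_mat l l) \<and>
                op_norm (mat_expectation l (mset_set S) f) \<le> lam0 \<and>
                (MAX s\<in>S. op_norm (f s)) \<le> 1 \<longrightarrow>
                op_norm (mat_expectation l W (word_mat l f)) \<le> lam))))"
proof (intro exI[of _ beta] conjI ballI allI impI, goal_cases)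
  case 1
  show ?case by (rule beta_pos)
next
  case 2
  show ?case by (rule beta_lim)
next
  case (3 lam0)
  note lam0 = this
  define \<kappa> where "\<kappa> = sqrt (1 - 39/800 * ((1 - lam0) / 2)\<^sup>2)"
  have k2: "0 < ((1 - lam0) / 2)\<^sup>2" "((1 - lam0) / 2)\<^sup>2 \<le> 1" using lam0 by (simp_all add: power_le_one)
  have \<kappa>: "0 \<le> \<kappa>" "\<kappa> < 1" using k2 by (simp_all add: \<kappa>_def)
  obtain ell0 where ell0: "\<kappa> ^ ell0 < 1/2" using real_arch_pow_inv[of "1/2" \<kappa>] \<kappa> by auto
  \<comment> \<open>The summand 1024 in the exponent makes the width at least 10, the summand
    \<open>ell0\<close> makes \<open>ell\<close> long enough for
    \<open>kappa_power_le\<close>.\<close>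
  obtain p0 :: nat where p0: "prime p0" "2 ^ (1024 + ell0) \<le> p0" using prime_above by blast
  have p01024: "2 ^ 1024 \<le> p0"
  proof -
    have "(2::nat) ^ 1024 \<le> 2 ^ (1024 + ell0)" by (rule power_increasing) simp_all
    thus ?thesis using p0(2) by (rule le_trans)
  qed
  \<comment> \<open>With at least \<open>K0 * n\<close> vertices the uneven labelling costs at most
    half of \<open>1 - lam0\<close>.\<close>
  define K0 where "K0 = nat \<lceil>2 / (1 - lam0)\<rceil>"
  have K0: "2 / (1 - lam0) \<le> real K0" unfolding K0_def by linarith
  have "0 < 2 / (1 - lam0)" using lam0 by simp
  hence K00: "0 < K0" using K0 by linarith
  define D where "D = p0 ^ (blen (blen p0) * (blen p0 * (blen p0 + blen p0)) + 2 * blen (blen p0)) * (2 ^ p0) ^ 3"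
  define D' where "D' = 4 * K0 * (1 + D)"
  \<comment> \<open>The summands cover the bounds that the cutoff must meet: \<open>D' * D'\<close>
    for the number of entries, \<open>p0 + 1\<close> for \<open>p\<close> and \<open>s * L\<close>,
    \<open>K0\<close> for the grid, 8 for \<open>L + 8\<close>.\<close>
  define E where "E = D' * D' + p0 + K0 + 8"
  define k where "k = E + 8"
  define dd where "dd = dep (length_prog p0 K0) + dep (total_prog p0 K0) + dep (letter_prog p0 K0) + 2"
  define c0 where "c0 = 20 * k + cst (length_prog p0 K0) + cst (total_prog p0 K0) + cst (letter_prog p0 K0) + 10"
  define prog where "prog = main_com k (length_prog p0 K0) (total_prog p0 K0) (letter_prog p0 K0)"
  show ?case
  proof (rule exI[of _ "real (4 * K0 * (128 + D))"], rule exI[of _ prog], rule exI[of _ "c0 * 2 ^ dd * 2 ^ (2 ^ k * dd)"],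
      rule exI[of _ "2 ^ k * dd"], intro allI impI, elim conjE, goal_cases)
    case (1 S e lam)
    note S = 1(1,2) and e = 1(3) and lam = 1(4,5)
    define n where "n = card S"
    have n: "0 < n" using S by (simp add: n_def card_gt_0_iff)
    define L where "L = nat \<lceil>1 / lam\<rceil>"
    have lamL: "1 < 1 / lam" using lam by simp
    have L1: "1 / lam \<le> real L" "real L \<le> 1 / lam + 1" unfolding L_def using lamL by linarith+
    have L2: "2 \<le> L" using L1 lamL by linarith
    define p where "p = pr p0 (blen L)"
    define ell where "ell = blen p"
    define s where "s = blen ell"
    define b where "b = ell * (ell + ell)"
    define q where "q = side (K0 * n)"
    define kk where "kk = reps p (s - 2) L"
    define t where "t = s * kk * b"
    define tot where "tot = q * q * (p ^ (s * b) * p ^ (2 * (s * kk)))"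
    define Z where "Z = (n + L) ^ 2 ^ k"
    interpret params p ell s b "s * b"
      unfolding p_def ell_def s_def b_def by (rule params_pr[OF p0(1) p01024])
    have pp: "prime p \<and> p0 \<le> p \<and> (p = p0 \<or> p \<le> blen L) \<and> (\<forall>x\<le>blen L. prime x \<longrightarrow> p0 \<le> x \<longrightarrow> x \<le> p)"
      unfolding p_def by (rule pr_props[OF p0(1)])
    have ell0_le: "ell0 \<le> ell"
    proof -
      have "2 ^ (1024 + ell0) \<le> p" using pp p0(2) by linarith
      hence "1024 + ell0 < ell" unfolding ell_def by (rule blen_mono_bound)
      thus ?thesis by simp
    qed
    have q0: "0 < q" unfolding q_def by (rule side_less(2)) (use K00 n in simp)
    have kk0: "0 < kk" unfolding kk_def by (rule reps_growth(1)[OF L2])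
    have t0: "0 < t" using pos kk0 by (simp add: t_def)
    have P0: "0 < p ^ (s * b)" "0 < p ^ (2 * (s * kk))" using pos by simp_all
    have tot0: "0 < tot" unfolding tot_def using q0 P0 by simp
    have size1: "real tot \<le> real (4 * K0 * (128 + D)) * real n / lam powr (2 + beta lam)"
      and size2: "tot \<le> D' * n * L ^ 3"
      unfolding D'_def D_def tot_def kk_def q_def b_def s_def ell_def p_def
      by (rule size_bounds[OF p0(1) p01024 n K00 lam L_def])+
    define x where "x = n + L"
    have x: "2 \<le> x" "n \<le> x" "L \<le> x" "1 \<le> x" using L2 n by (auto simp: x_def)
    have xk: "y \<le> Z" if "y \<le> E * x ^ 8" for y
      unfolding Z_def k_def x_def[symmetric] by (rule cutoff_ok[OF x(1) that])
    have xp: "x ^ i \<le> x ^ j" if "i \<le> j" for i j using that x by (intro power_increasing) auto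
    have tot4: "tot \<le> D' * x ^ 4"
    proof -
      have "n * L ^ 3 \<le> x * x ^ 3" using x by (intro mult_le_mono power_mono) auto
      also have "x * x ^ 3 = x ^ 4" by (simp add: eval_nat_numeral)
      finally have "D' * (n * L ^ 3) \<le> D' * x ^ 4" by (rule mult_le_mono2)
      thus ?thesis using size2 by (simp only: mult.assoc) 
    qed
    have lexp: "y \<le> p ^ y" for y
    proof -
      have "y \<le> 2 ^ y" using less_exp[of y] by simp
      also have "(2::nat) ^ y \<le> p ^ y" using p_big by (intro power_mono) auto
      finally show ?thesis .
    qed
    \<comment> \<open>Both factors of the length appear as exponents in the number of words, and
      \<open>y \<le> p ^ y\<close>. Hence the output has at most \<open>tot * tot\<close> entries,
      of degree 8 in \<open>x\<close>.\<close>
    have t_le: "t \<le> tot"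
    proof -
      have "s * kk \<le> 2 * (s * kk)" by simp
      also have "\<dots> \<le> p ^ (2 * (s * kk))" by (rule lexp)
      finally have 1: "s * kk \<le> p ^ (2 * (s * kk))" .
      have "b \<le> s * b" using pos by simp
      also have "\<dots> \<le> p ^ (s * b)" by (rule lexp)
      finally have "b * (s * kk) \<le> p ^ (s * b) * p ^ (2 * (s * kk))" using 1 by (rule mult_le_mono)
      also have "\<dots> \<le> q * q * \<dots>" using q0 by simp
      finally show ?thesis by (simp only: t_def tot_def mult.commute)
    qed
    have p_le: "p \<le> p0 + L" using pp blen_le[of L] by linarith
    have D'D': "D' \<le> D' * D'" by simp
    have Zs: "L + 8 \<le> Z" "p \<le> Z" "K0 \<le> Z" "K0 * n \<le> Z" "s * L \<le> Z" "tot * t \<le> Z"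
    proof -
      have x1: "x \<le> x ^ 8" using xp[of 1 8] by simp
      have one: "1 \<le> x ^ 8" using x1 x by linarith
      have scale: "a * y \<le> E * x ^ 8" if "a \<le> E" "y \<le> x ^ 8" for a y using that by (rule mult_le_mono)
      have "L + 8 \<le> 8 * x" using x L2 n by (simp add: x_def)
      also have "8 * x \<le> E * x ^ 8" by (rule scale[OF _ x1]) (simp add: E_def)
      finally show "L + 8 \<le> Z" by (rule xk)
      have "p \<le> (p0 + 1) * x"
      proof -
        have "p0 * 1 \<le> p0 * x" using x by (intro mult_le_mono2) simp
        hence "p0 \<le> p0 * x" by (simp only: mult_1_right)
        thus ?thesis using p_le x(3) unfolding add_mult_distrib mult_1 by linarith
      qed
      note px = this
      also have "(p0 + 1) * x \<le> E * x ^ 8" by (rule scale[OF _ x1]) (simp add: E_def)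
      finally show "p \<le> Z" by (rule xk)
      have "K0 * 1 \<le> E * x ^ 8" by (rule scale[OF _ one]) (simp add: E_def)
      thus "K0 \<le> Z" by (intro xk) simp
      have "K0 * n \<le> E * x ^ 8" by (rule scale[OF _ le_trans[OF x(2) x1]]) (simp add: E_def)
      thus "K0 * n \<le> Z" by (rule xk)
      have "s * L \<le> (p0 + 1) * x * x"
        using px p_ell x by (intro mult_le_mono) linarith+
      also have "\<dots> = (p0 + 1) * x ^ 2" by (simp only: power2_eq_square mult.assoc)
      also have "\<dots> \<le> E * x ^ 8" by (rule scale[OF _ xp]) (simp_all add: E_def)
      finally show "s * L \<le> Z" by (rule xk)
      have "tot * t \<le> (D' * x ^ 4) * (D' * x ^ 4)" using tot4 t_le by (intro mult_le_mono) linarith+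
      also have "\<dots> = (D' * D') * x ^ 8"
      proof -
        have "x ^ 4 * x ^ 4 = x ^ 8" by (simp add: power_add[symmetric])
        thus ?thesis by (metis mult.assoc mult.left_commute)
      qed
      also have "\<dots> \<le> E * x ^ 8" by (rule scale[OF _ order_refl]) (simp add: E_def)
      finally show "tot * t \<le> Z" by (rule xk)
    qed
    define J where "J = map (\<lambda>w. map (letter n q p s b t w) [0..<t]) [0..<tot]"
    obtain T where T: "runs prog n L T (t # concat J)" "T \<le> c0 * (Z + 1) ^ dd"
    proof -
      have p8: "8 \<le> p" using p_big by simp
      have "\<exists>T. runs prog n L T (t # concat J) \<and> T \<le> c0 * (Z + 1) ^ dd"
        unfolding prog_def c0_def dd_def J_def
        by (rule program_correct[where ?p0.0 = p0 and ?K0.0 = K0 and n = n and L = L and k = k, folded p_def, folded ell_def, folded s_def, folded b_def q_def kk_def, folded t_def tot_def Z_def,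
          OF n q0 p8 pos(3,4) kk0 Zs])
      thus ?thesis using that by blast
    qed
    define W where "W = mset (map (map e) J)"
    have J_ne: "J \<noteq> []" using tot0 by (simp add: J_def)
    have J_words: "length w = t \<and> set w \<subseteq> {..<card S}" if "w \<in> set J" for w
      using that n by (auto simp: J_def letter_def Let_def n_def)
    have cons: "constructs prog S e lam T t W"
      unfolding constructs_def L_def[symmetric] n_def[symmetric]
      using J_ne J_words T(1) by (intro exI[of _ J]) (auto simp: W_def n_def)
    have time: "real T \<le> real (c0 * 2 ^ dd * 2 ^ (2 ^ k * dd)) * (real (card S) + 1 / lam) ^ (2 ^ k * dd)"
    proof -
      \<comment> \<open>Rounding adds at most 1 to \<open>1 / lam\<close>, and this is paid by
        \<open>n \<ge> 1\<close>.\<close>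
      have xr: "real x \<le> 2 * (real n + 1 / lam)"
      proof -
        have "1 \<le> real n" using n by simp
        thus ?thesis using L1 lamL by (simp add: x_def)
      qed
      have Z1: "1 \<le> Z" using Zs(1) by simp
      have "T \<le> c0 * (2 * Z) ^ dd"
        using T(2) by (rule le_trans) (use Z1 in \<open>intro mult_le_mono2 power_mono; simp\<close>)
      also have "\<dots> = c0 * 2 ^ dd * x ^ (2 ^ k * dd)"
        unfolding Z_def x_def[symmetric] by (simp add: power_mult_distrib power_mult)
      finally have "real T \<le> real (c0 * 2 ^ dd * x ^ (2 ^ k * dd))" by (simp only: of_nat_le_iff)
      also have "\<dots> = real (c0 * 2 ^ dd) * real x ^ (2 ^ k * dd)" by (simp only: of_nat_mult of_nat_power)
      also have "\<dots> \<le> real (c0 * 2 ^ dd) * (2 * (real n + 1 / lam)) ^ (2 ^ k * dd)"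
        by (intro mult_left_mono power_mono xr) simp_all
      also have "\<dots> = real (c0 * 2 ^ dd * 2 ^ (2 ^ k * dd)) * (real n + 1 / lam) ^ (2 ^ k * dd)"
        by (simp only: power_mult_distrib of_nat_mult of_nat_power of_nat_numeral mult.assoc)
      finally show ?thesis by (simp only: n_def)
    qed
    have sizeW: "size W = tot" by (simp add: W_def J_def)
    have W_ne: "W \<noteq> {#}" using J_ne by (simp add: W_def)
    have W_words: "\<forall>w\<in>#W. length w = t \<and> set w \<subseteq> S"
    proof
      fix w assume "w \<in># W"
      then obtain v where v: "v \<in> set J" "w = map e v" by (auto simp: W_def)
      have "e ` {..<card S} = S" using e by (simp add: bij_betw_def)
      thus "length w = t \<and> set w \<subseteq> S" using J_words[OF v(1)] v(2) by auto
    qed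
    have norm: "op_norm (mat_expectation l W (word_mat l f)) \<le> lam"
      if l: "0 < l" and f: "\<forall>s\<in>S. f s \<in> carrier_mat l l" and avg: "op_norm (mat_expectation l (mset_set S) f) \<le> lam0"
        and mx: "(MAX s\<in>S. op_norm (f s)) \<le> 1" for l and f :: "'a \<Rightarrow> complex mat"
    proof -
      have eS: "e i \<in> S" if "i < n" for i using e that by (auto simp: bij_betw_def n_def)
      have f1: "op_norm (f s) \<le> 1" if "s \<in> S" for s
        using mx Max_ge[of "(\<lambda>s. op_norm (f s)) ` S" "op_norm (f s)"] S that by (auto intro: order_trans)
      have ms: "mset (map e [0..<n]) = mset_set S"
      proof -
        have "inj_on e {0..<n}" "e ` {0..<n} = S" using e by (auto simp: bij_betw_def n_def lessThan_atLeast0)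
        thus ?thesis using image_mset_mset_set[of e "{0..<n}"] by simp
      qed
      have Wm: "W = mset (map (\<lambda>w. map e (map (letter n q p s b t w) [0..<t])) [0..<tot])"
        by (simp only: W_def J_def map_map o_def)
      have "op_norm (mat_expectation l W (word_mat l f)) \<le> ((real s + 1)\<^sup>2 * (real (s * b) / real p) ^ (s - 1)) ^ kk"
        unfolding Wm
      proof (rule amplify[where b' = "ell * ell" and ?\<rho>0.0 = lam0])
        show "2 * real n \<le> (1 - lam0) * real (q * q)"
        proof -
          have "2 \<le> (1 - lam0) * real K0" using K0 lam0 by (simp add: field_simps)
          hence "2 * real n \<le> (1 - lam0) * real K0 * real n" by (rule mult_right_mono) simp
          also have "\<dots> = (1 - lam0) * real (K0 * n)" by simp
          also have "\<dots> \<le> (1 - lam0) * real (q * q)"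
            using side_sq[of "K0 * n"] lam0 unfolding q_def by (intro mult_left_mono) (simp_all only: of_nat_le_iff, simp)
          finally show ?thesis .
        qed
        show "sqrt (1 - 39/800 * ((1 - lam0) / 2)\<^sup>2) ^ (ell * ell) \<le> real (s * b) / real p"
          unfolding \<kappa>_def[symmetric] using \<kappa> ell0 ell0_le by (intro kappa_power_le[of _ ell0]) auto
        show "f (e i) \<in> carrier_mat l l" "op_norm (f (e i)) \<le> 1" if "i < n" for i
          using f f1 eS[OF that] by auto
        show "op_norm (mat_expectation l (mset (map e [0..<n])) f) \<le> lam0" unfolding ms by (rule avg)
        show "prime p" using pp by blast
        show "b = 2 * (ell * ell)" by (simp add: b_def)
        show "0 < ell * ell" using pos by simp
        show "t = s * kk * b" by (rule t_def)
        show "tot = q * q * (p ^ (s * b) * p ^ (2 * (s * kk)))" by (rule tot_def)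
      qed (use n q0 p_big pos m_le_p lam0 in simp_all)
      also have "\<dots> \<le> (1 / real p ^ (s - 2)) ^ kk"
        by (intro power_mono block_real) (auto intro!: mult_nonneg_nonneg zero_le_power)
      also have "\<dots> = 1 / real (p ^ ((s - 2) * kk))" by (simp add: power_divide power_mult)
      also have "\<dots> \<le> 1 / real L"
      proof (rule divide_left_mono)
        have "L \<le> p ^ ((s - 2) * kk)" unfolding kk_def by (rule reps_ge) (use p_big s10 in auto)
        thus "real L \<le> real (p ^ ((s - 2) * kk))" by (simp only: of_nat_le_iff)
      qed (use L2 pos in simp_all)
      also have "\<dots> \<le> lam" using L1(1) lam L2 by (simp add: field_simps)
      finally show ?thesis .
    qed
    show ?case
    proof (intro exI conjI)
      show "real (size W) \<le> real (4 * K0 * (128 + D)) * real (card S) / lam powr (2 + beta lam)"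
        unfolding sizeW using size1 by (simp only: n_def)
      show "\<forall>(l :: nat) (f :: 'a \<Rightarrow> complex mat).
                0 < l \<and> (\<forall>s \<in> S. f s \<in> carrier_mat l l) \<and>
                op_norm (mat_expectation l (mset_set S) f) \<le> lam0 \<and>
                (MAX s\<in>S. op_norm (f s)) \<le> 1 \<longrightarrow>
                op_norm (mat_expectation l W (word_mat l f)) \<le> lam"
        using norm by blast
    qed (rule cons time t0 W_ne W_words)+
  qed
qed

end
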